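(* Let $\widetilde{\mathcal H}_{\mathcal T}$ be the specified graphs graded bialgebra of a theory $\mathcal T$ and let $\varphi$ be a character of $\widetilde{\mathcal H}_{\mathcal T}$ with values in the unitary commutative algebra $\mathcal B$. Further let $P_\cdot:\mathbb N\to\mathrm{End}(\mathcal B)$ be an indexed renormalization scheme, that is, a family $(P_t)_{t\in\mathbb N}$ of endomorphisms such that for all $s,t\in\mathbb N$ $$\mu\circ(P_s\otimes P_t)=P_{s+t}\circ\mu\circ[P_s\otimes\mathrm{Id}+\mathrm{Id}\otimes P_t-\mathrm{Id}\otimes\mathrm{Id}],$$ where $\mu$ denotes the product of $\mathcal B$. Define $\varphi_-$ and $\varphi_+$ recursively by $\varphi_-(\bar\Gamma)=\varphi_+(\bar\Gamma)=\varphi(\bar\Gamma)=\mathbf 1_{V_\Gamma}$ for any specified graph $\bar\Gamma$ of degree zero (i.e. without internal edges) and, for any specified graph $\bar\Gamma=(\Gamma,\underline i)$ of degree $m\ge1$, assuming $\varphi_-$ and $\varphi_+$ known in degrees $k\le m-1$, $$\varphi_-(\bar\Gamma)=-P_m\Big(\varphi(\Gamma)+\sum_{\bar\gamma\subsetneq\bar\Gamma,\ \bar\Gamma/\bar\gamma\in\mathcal T}\pi_{\gamma,\Gamma}[\varphi_-(\gamma)]\; i_{\Gamma,\gamma}\big[\varphi(\Gamma/(\gamma,\underline j))\big]\Big),$$ $$\varphi_+(\bar\Gamma)=(I-P_m)\Big(\varphi(\Gamma)+\sum_{\bar\gamma\subsetneq\bar\Gamma,\ \bar\Gamma/\bar\gamma\in\mathcal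 T}\pi_{\gamma,\Gamma}[\varphi_-(\gamma)]\; i_{\Gamma,\gamma}\big[\varphi(\Gamma/(\gamma,\underline j))\big]\Big),$$ where the sums run over the proper locally 1PI specified covering subgraphs $\bar\gamma=(\gamma,\underline j)$ of $\bar\Gamma$ with $\bar\Gamma/\bar\gamma$ in the theory $\mathcal T$. Then the two maps $\varphi_-$ and $\varphi_+$ are two characters.
   Context: Graphs. A (Feynman) graph $\Gamma$ consists of a finite set $\mathcal V(\Gamma)$ of vertices, a finite set $\mathcal E(\Gamma)$ of half-edges, an involution $\sigma_\Gamma:\mathcal E(\Gamma)\to\mathcal E(\Gamma)$ and a map $\partial:\mathcal E(\Gamma)\to\mathcal V(\Gamma)$. For a vertex $v$, $st(v)=\{e:\partial(e)=v\}$. Fixed points of $\sigma_\Gamma$ are the external edges; pairs $\{e,\sigma_\Gamma(e)\}$ with $e\ne\sigma_\Gamma(e)$ are the internal edges, forming the set $\mathcal I(\Gamma)$. Cutting an internal edge means modifying $\sigma_\Gamma$ so that its two half-edges become fixed points. $\pi_0(\Gamma)$ is the set of connected components. The degree of $\Gamma$ is the loop number $|\Gamma|=L(\Gamma)=|\mathcal I(\Gamma)|-|\mathcal V(\Gamma)|+|\pi_0(\Gamma)|$. A graph is 1PI if it is connected and remains connected when any internal edge is cut; it is locally 1PI if each of its connected components is 1PI. A covering subgraph $\gamma$ of $\Gamma$ is a graph (not necessarily connected) obtained from $\Gamma$ by cutting internal edges (possibly none, possibly all); it has the same vertices and half-edges as $\Gamma$. The contracted graph $\Gamma/\gamma$ is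 obtained by shrinking each connected component of $\gamma$ inside $\Gamma$ onto a point; its half-edges are the half-edges of $\Gamma$ not belonging to internal edges of $\gamma$, so $\mathcal E(\Gamma/\gamma)\subset\mathcal E(\Gamma)$. The residue is $\mathrm{res}\,\Gamma=\Gamma/\Gamma$; the skeleton $\mathrm{sk}\,\Gamma$ is obtained by cutting all internal edges. $\Gamma\Gamma'$ denotes concatenation (disjoint union). Theory. A theory $\mathcal T$ prescribes a set $\mathcal E(\mathcal T)$ of types of half-edges (the involutions $\sigma_\Gamma$ respect types) and a set $\mathcal V(\mathcal T)$ of types of vertices, a vertex type being a function $\mathcal E(\mathcal T)\to\mathbb N$ giving the number of half-edges of each type at the vertex. It also prescribes a set $\widetilde{\mathcal V}(\mathcal T)$ of refined types of vertices, written $(t,k)$ with $t\in\mathcal V(\mathcal T)$ the underlying type, the index $k$ serving to distinguish refined types with the same underlying type. A locally 1PI graph is superficially divergent if the residue of each of its connected components is a vertex with type in $\mathcal V(\mathcal T)$. Specified graphs. A specified graph of $\mathcal T$ is a pair $\bar\Gamma=(\Gamma,\underline i)$ where $\Gamma$ is a locally 1PI superficially divergent graph with half-edges and vertices of the types prescribed in $\mathcal T$, and $\underline i:\pi_0(\Gamma)\to\mathbb N$, the values of $\underline i$ on a connected component being prescribed by the possible (refined) types of the vertex obtained by contracting this component onto a point. A specified graph $\bar\gamma=(\gamma,\underline j)$ is a specified covering subgraph of $\bar\Gamma=(\Gamma,\underline i)$, written $\bar\gamma\subset\bar\Gamma$, if $\gamma$ is a covering subgraph of $\Gamma$ and $\underline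 j(\gamma_0)=\underline i(\gamma_0)$ for every connected component $\gamma_0$ of $\gamma$ which is also a full connected component of $\Gamma$. It is proper, written $\bar\gamma\subsetneq\bar\Gamma$, if $\gamma\ne\Gamma$ and $\gamma\ne\mathrm{sk}\,\Gamma$. The contracted specified graph is $\bar\Gamma/\bar\gamma=(\Gamma/\bar\gamma,\underline i)$, where $\Gamma/\bar\gamma=\Gamma/(\gamma,\underline j)$ is obtained by contracting each connected component of $\gamma$ onto a point and specifying the vertex obtained with $\underline j$. $\widetilde{\mathcal H}_{\mathcal T}$ is the vector space generated by the specified graphs, graded by $L$, with product given by concatenation, unit $\mathbf 1$ the empty graph, and coproduct $\Delta(\bar\Gamma)=\sum_{\bar\gamma\subseteq\bar\Gamma,\ \bar\Gamma/\bar\gamma\in\mathcal T}\bar\gamma\otimes\bar\Gamma/\bar\gamma$, summed over all locally 1PI specified covering subgraphs $\bar\gamma$ of $\bar\Gamma$ (including those with $\gamma=\Gamma$ and $\gamma=\mathrm{sk}\,\Gamma$) such that $\bar\Gamma/\bar\gamma$ is in the theory $\mathcal T$. Function spaces. Fix an integer $D\ge1$. The momentum space of $\Gamma$ is $$W_\Gamma=\Big\{p:\mathcal E(\Gamma)\to\mathbb R^D\ :\ \sum_{e\in st(v)}p_e=0\ \forall v\in\mathcal V(\Gamma),\ \ p_e+p_{\sigma_\Gamma(e)}=0\ \forall e\in\mathcal E(\Gamma)\text{ with }e\ne\sigma_\Gamma(e)\Big\}.$$ For $\Gamma$ connected, $V_\Gamma=\mathcal C^\infty(W_\Gamma,\mathbb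 C)$; in general $V_\Gamma=\bigotimes_jV_{\Gamma_j}$ is the unordered tensor product over the connected components $\Gamma_j$ of $\Gamma$, identified with a subspace of $\mathcal C^\infty(W_\Gamma,\mathbb C)$ via $(\bigotimes_jv_j)(p)=\prod_jv_j(p|_{\mathcal E(\Gamma_j)})$; $\mathbf 1_{V_\Gamma}$ is the constant function equal to $1$ on $W_\Gamma$. $\mathcal B=\prod_\Gamma V_\Gamma$, product over all graphs, connected or not. The product of $\mathcal B$ is the commutative unordered concatenation product $\bullet$: for $v=\bigotimes_{j\in A}v_j\in V_\Gamma$ and $v'=\bigotimes_{j\in B}v_j\in V_{\Gamma'}$ with $A\cap B=\emptyset$, $v\bullet v'=\bigotimes_{j\in A\sqcup B}v_j\in V_{\Gamma\Gamma'}$, extended to a bilinear product on $\mathcal B$; its unit is denoted $\mathbf 1_{\mathcal B}$. For $\gamma$ a covering subgraph of $\Gamma$: $i_{\Gamma,\gamma}:V_{\Gamma/\gamma}\to V_\Gamma$ is the pullback of functions along the map $W_\Gamma\to W_{\Gamma/\gamma}$ restricting $p$ to $\mathcal E(\Gamma/\gamma)\subset\mathcal E(\Gamma)$; $\pi_{\gamma,\Gamma}:V_\gamma\to V_\Gamma$ is the restriction of functions along the inclusion $W_\Gamma\hookrightarrow W_\gamma$. Products $\pi_{\gamma,\Gamma}[\cdot]\,i_{\Gamma,\gamma}[\cdot]$ are pointwise products in $V_\Gamma$. Characters. The characters considered are the elements of $G$, the set of $\mathbb C$-linear maps $\varphi:\widetilde{\mathcal H}_{\mathcal T}\to\mathcal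 B$ such that (1) $\varphi$ does not depend on the specification: $\varphi(\Gamma,\underline i)=\varphi(\Gamma)$; (2) $\varphi(\Gamma)\in V_\Gamma$ for any graph $\Gamma$; (3) $\varphi(\Gamma)=\mathbf 1_{V_\Gamma}$ if $\Gamma$ has no internal edges; (4) $\varphi(\Gamma\Gamma')=\varphi(\Gamma)\bullet\varphi(\Gamma')$ and $\varphi(\mathbf 1)=\mathbf 1_{\mathcal B}$.
   Formalization: Added: each P_t maps every V_Γ to itself and satisfies P_t(x•1_{V_Γ'}) = P_t(x)•1_{V_Γ'} for x in V_Γ and Γ' without internal edges (without the latter the claim fails); each vertex type has finitely many refined types, so the sums are finite. *)

theory Defs
  imports "HOL-Analysis.Analysis" "HOL-Library.Function_Algebras"
begin

section \<open>Feynman graphs\<close>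

text \<open>
  Graphs are labelled: vertices and half-edges are drawn from the types \<open>'v\<close> and \<open>'e\<close>.
  Besides the data \<open>(V, E, \<sigma>, \<partial>)\<close> a graph records the type of every half-edge and the index
  \<open>k\<close> of the refined type \<open>(t, k)\<close> of every vertex; the underlying type \<open>t\<close> is determined by the
  half-edges at the vertex. All maps are extensional, so that equality of records is
  equality of graphs.
\<close>

record ('v, 'e, 't) fgraph =
  verts :: "'v set"
  hedges :: "'e set"
  sigma :: "'e \<Rightarrow> 'e"
  bdry :: "'e \<Rightarrow> 'v"
  htype :: "'e \<Rightarrow> 't"
  vindex :: "'v \<Rightarrow> nat"

definition graph :: "('v, 'e, 't) fgraph \<Rightarrow> bool" where
  "graph \<Gamma> \<longleftrightarrow> finite (verts \<Gamma>) \<and> finite (hedges \<Gamma>) \<and>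
     sigma \<Gamma> \<in> hedges \<Gamma> \<rightarrow>\<^sub>E hedges \<Gamma> \<and>
     (\<forall>e\<in>hedges \<Gamma>. sigma \<Gamma> (sigma \<Gamma> e) = e) \<and>
     bdry \<Gamma> \<in> hedges \<Gamma> \<rightarrow>\<^sub>E verts \<Gamma> \<and>
     htype \<Gamma> \<in> extensional (hedges \<Gamma>) \<and>
     vindex \<Gamma> \<in> extensional (verts \<Gamma>)"

definition star :: "('v, 'e, 't) fgraph \<Rightarrow> 'v \<Rightarrow> 'e set" where
  "star \<Gamma> v = {e \<in> hedges \<Gamma>. bdry \<Gamma> e = v}"

definition internal :: "('v, 'e, 't) fgraph \<Rightarrow> 'e set set" where
  "internal \<Gamma> = {{e, sigma \<Gamma> e} | e. e \<in> hedges \<Gamma> \<and> sigma \<Gamma> e \<noteq> e}"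

definition cut :: "('v, 'e, 't) fgraph \<Rightarrow> 'e set set \<Rightarrow> ('v, 'e, 't) fgraph" where
  "cut \<Gamma> S = \<Gamma>\<lparr>sigma := (\<lambda>e. if e \<in> \<Union>S then e else sigma \<Gamma> e)\<rparr>"

definition skeleton :: "('v, 'e, 't) fgraph \<Rightarrow> ('v, 'e, 't) fgraph" where
  "skeleton \<Gamma> = cut \<Gamma> (internal \<Gamma>)"

definition covering_subgraph :: "('v, 'e, 't) fgraph \<Rightarrow> ('v, 'e, 't) fgraph \<Rightarrow> bool" where
  "covering_subgraph \<gamma> \<Gamma> \<longleftrightarrow> (\<exists>S \<subseteq> internal \<Gamma>. \<gamma> = cut \<Gamma> S)"

subsection \<open>Connected components\<close>

definition conn :: "('v, 'e, 't) fgraph \<Rightarrow> ('v \<times> 'v) set" where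
  "conn \<Gamma> = {(u, v). u \<in> verts \<Gamma> \<and> v \<in> verts \<Gamma> \<and>
     (u, v) \<in> {(bdry \<Gamma> e, bdry \<Gamma> (sigma \<Gamma> e)) | e. e \<in> hedges \<Gamma>}\<^sup>*}"

text \<open>A connected component is identified by its vertex set; \<open>induced \<Gamma> C\<close> is the component
  as a graph.\<close>

definition pi0 :: "('v, 'e, 't) fgraph \<Rightarrow> 'v set set" where
  "pi0 \<Gamma> = verts \<Gamma> // conn \<Gamma>"

definition comp_of :: "('v, 'e, 't) fgraph \<Rightarrow> 'v \<Rightarrow> 'v set" where
  "comp_of \<Gamma> v = conn \<Gamma> `` {v}"

definition induced :: "('v, 'e, 't) fgraph \<Rightarrow> 'v set \<Rightarrow> ('v, 'e, 't) fgraph" where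
  "induced \<Gamma> U =
     (let V = verts \<Gamma> \<inter> U; E = {e \<in> hedges \<Gamma>. bdry \<Gamma> e \<in> U} in
      \<lparr>verts = V, hedges = E,
       sigma = restrict (sigma \<Gamma>) E, bdry = restrict (bdry \<Gamma>) E,
       htype = restrict (htype \<Gamma>) E, vindex = restrict (vindex \<Gamma>) V\<rparr>)"

definition connected_graph :: "('v, 'e, 't) fgraph \<Rightarrow> bool" where
  "connected_graph \<Gamma> \<longleftrightarrow> card (pi0 \<Gamma>) = 1"

text \<open>Since \<open>\<bar>I\<bar> + \<bar>\<pi>\<^sub>0\<bar> \<ge> \<bar>V\<bar>\<close> holds for every graph, no truncation occurs here.\<close>

definition loops :: "('v, 'e, 't) fgraph \<Rightarrow> nat" where
  "loops \<Gamma> = card (internal \<Gamma>) + card (pi0 \<Gamma>) - card (verts \<Gamma>)"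

definition one_PI :: "('v, 'e, 't) fgraph \<Rightarrow> bool" where
  "one_PI \<Gamma> \<longleftrightarrow> connected_graph \<Gamma> \<and> (\<forall>d \<in> internal \<Gamma>. connected_graph (cut \<Gamma> {d}))"

definition locally_one_PI :: "('v, 'e, 't) fgraph \<Rightarrow> bool" where
  "locally_one_PI \<Gamma> \<longleftrightarrow> (\<forall>C \<in> pi0 \<Gamma>. one_PI (induced \<Gamma> C))"

subsection \<open>Contraction and concatenation\<close>

text \<open>
  \<open>contract \<Gamma> \<gamma> j\<close> is \<open>\<Gamma>/(\<gamma>, j)\<close>. The vertex obtained from a component \<open>C\<close> of \<open>\<gamma>\<close> is labelled
  by \<open>Min C\<close>, so that contracting a single vertex does not change its label, and it receives
  the index \<open>j C\<close>.
\<close>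

definition contract ::
  "('v::linorder, 'e, 't) fgraph \<Rightarrow> ('v, 'e, 't) fgraph \<Rightarrow> ('v set \<Rightarrow> nat) \<Rightarrow> ('v, 'e, 't) fgraph"
where
  "contract \<Gamma> \<gamma> j =
     (let V = Min ` pi0 \<gamma>; E = {e \<in> hedges \<Gamma>. sigma \<gamma> e = e} in
      \<lparr>verts = V, hedges = E,
       sigma = restrict (sigma \<Gamma>) E,
       bdry = (\<lambda>e\<in>E. Min (comp_of \<gamma> (bdry \<Gamma> e))),
       htype = restrict (htype \<Gamma>) E,
       vindex = (\<lambda>v\<in>V. j (comp_of \<gamma> v))\<rparr>)"

definition residue ::
  "('v::linorder, 'e, 't) fgraph \<Rightarrow> ('v set \<Rightarrow> nat) \<Rightarrow> ('v, 'e, 't) fgraph" where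
  "residue \<Gamma> i = contract \<Gamma> \<Gamma> i"

definition disjoint_graphs :: "('v, 'e, 't) fgraph \<Rightarrow> ('v, 'e, 't) fgraph \<Rightarrow> bool" where
  "disjoint_graphs \<Gamma> \<Gamma>' \<longleftrightarrow> verts \<Gamma> \<inter> verts \<Gamma>' = {} \<and> hedges \<Gamma> \<inter> hedges \<Gamma>' = {}"

definition concat_graph ::
  "('v, 'e, 't) fgraph \<Rightarrow> ('v, 'e, 't) fgraph \<Rightarrow> ('v, 'e, 't) fgraph" where
  "concat_graph \<Gamma> \<Gamma>' =
     \<lparr>verts = verts \<Gamma> \<union> verts \<Gamma>', hedges = hedges \<Gamma> \<union> hedges \<Gamma>',
      sigma = (\<lambda>e. if e \<in> hedges \<Gamma> then sigma \<Gamma> e else sigma \<Gamma>' e),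
      bdry = (\<lambda>e. if e \<in> hedges \<Gamma> then bdry \<Gamma> e else bdry \<Gamma>' e),
      htype = (\<lambda>e. if e \<in> hedges \<Gamma> then htype \<Gamma> e else htype \<Gamma>' e),
      vindex = (\<lambda>v. if v \<in> verts \<Gamma> then vindex \<Gamma> v else vindex \<Gamma>' v)\<rparr>"

definition empty_graph :: "('v, 'e, 't) fgraph" where
  "empty_graph = \<lparr>verts = {}, hedges = {}, sigma = (\<lambda>_. undefined), bdry = (\<lambda>_. undefined),
     htype = (\<lambda>_. undefined), vindex = (\<lambda>_. undefined)\<rparr>"


section \<open>Theories and specified graphs\<close>

record 't qft =
  htypes :: "'t set"
  vtypes :: "('t \<Rightarrow> nat) set"
  rtypes :: "(('t \<Rightarrow> nat) \<times> nat) set"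

text \<open>Vertex types are functions on the set of half-edge types, extended by zero. Each type
  has only finitely many refinements: otherwise the sums over specified covering
  subgraphs are infinite.\<close>

definition wf_qft :: "'t qft \<Rightarrow> bool" where
  "wf_qft T \<longleftrightarrow> (\<forall>t \<in> vtypes T. \<forall>a. a \<notin> htypes T \<longrightarrow> t a = 0) \<and>
     (\<forall>(t, k) \<in> rtypes T. t \<in> vtypes T) \<and>
     (\<forall>t \<in> vtypes T. finite {k. (t, k) \<in> rtypes T})"

definition vtype :: "('v, 'e, 't) fgraph \<Rightarrow> 'v \<Rightarrow> 't \<Rightarrow> nat" where
  "vtype \<Gamma> v = (\<lambda>a. card {e \<in> star \<Gamma> v. htype \<Gamma> e = a})"

definition graph_in :: "'t qft \<Rightarrow> ('v, 'e, 't) fgraph \<Rightarrow> bool" where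
  "graph_in T \<Gamma> \<longleftrightarrow> graph \<Gamma> \<and>
     (\<forall>e \<in> hedges \<Gamma>. htype \<Gamma> e \<in> htypes T \<and> htype \<Gamma> (sigma \<Gamma> e) = htype \<Gamma> e) \<and>
     (\<forall>v \<in> verts \<Gamma>. (vtype \<Gamma> v, vindex \<Gamma> v) \<in> rtypes T)"

type_synonym ('v, 'e, 't) sgraph = "('v, 'e, 't) fgraph \<times> ('v set \<Rightarrow> nat)"

text \<open>The type of a vertex does not depend on indices, so the index of the residue is
  irrelevant below.\<close>

definition superficially_divergent :: "'t qft \<Rightarrow> ('v::linorder, 'e, 't) fgraph \<Rightarrow> bool" where
  "superficially_divergent T \<Gamma> \<longleftrightarrow>
     (\<forall>C \<in> pi0 \<Gamma>. let R = residue (induced \<Gamma> C) (\<lambda>_. 0) in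
        \<forall>v \<in> verts R. vtype R v \<in> vtypes T)"

text \<open>
  The value \<open>i C\<close> must be such that the vertex obtained by contracting \<open>C\<close>, specified by \<open>i\<close>,
  has a refined type of the theory. If \<open>C\<close> has no internal edges, then it is a single vertex,
  contracting it changes nothing, and the vertex obtained already has a refined type: the
  only possible value is the index of that vertex.
\<close>

definition specified_graph :: "'t qft \<Rightarrow> ('v::linorder, 'e, 't) sgraph \<Rightarrow> bool" where
  "specified_graph T s \<longleftrightarrow> (case s of (\<Gamma>, i) \<Rightarrow>
     graph_in T \<Gamma> \<and> locally_one_PI \<Gamma> \<and> superficially_divergent T \<Gamma> \<and>
     i \<in> extensional (pi0 \<Gamma>) \<and>
     (\<forall>C \<in> pi0 \<Gamma>. let R = residue (induced \<Gamma> C) i in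
        \<forall>v \<in> verts R. (vtype R v, vindex R v) \<in> rtypes T) \<and>
     (\<forall>C \<in> pi0 \<Gamma>. internal (induced \<Gamma> C) = {} \<longrightarrow> (\<forall>v \<in> C. i C = vindex \<Gamma> v)))"

definition spec_subgraph ::
  "'t qft \<Rightarrow> ('v::linorder, 'e, 't) sgraph \<Rightarrow> ('v, 'e, 't) sgraph \<Rightarrow> bool" where
  "spec_subgraph T u s \<longleftrightarrow> (case (u, s) of ((\<gamma>, j), (\<Gamma>, i)) \<Rightarrow>
     specified_graph T (\<gamma>, j) \<and> specified_graph T (\<Gamma>, i) \<and> covering_subgraph \<gamma> \<Gamma> \<and>
     (\<forall>C \<in> pi0 \<gamma> \<inter> pi0 \<Gamma>. induced \<gamma> C = induced \<Gamma> C \<longrightarrow> j C = i C))"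

definition proper_spec_subgraph ::
  "'t qft \<Rightarrow> ('v::linorder, 'e, 't) sgraph \<Rightarrow> ('v, 'e, 't) sgraph \<Rightarrow> bool" where
  "proper_spec_subgraph T u s \<longleftrightarrow>
     spec_subgraph T u s \<and> fst u \<noteq> fst s \<and> fst u \<noteq> skeleton (fst s)"

text \<open>The components of \<open>\<Gamma>/\<gamma>\<close> correspond to those of \<open>\<Gamma>\<close>; \<open>i\<close> is transported along this
  bijection.\<close>

definition spec_contract ::
  "('v::linorder, 'e, 't) sgraph \<Rightarrow> ('v, 'e, 't) sgraph \<Rightarrow> ('v, 'e, 't) sgraph" where
  "spec_contract s u = (case (s, u) of ((\<Gamma>, i), (\<gamma>, j)) \<Rightarrow>
     (contract \<Gamma> \<gamma> j, \<lambda>C \<in> pi0 (contract \<Gamma> \<gamma> j). i (comp_of \<Gamma> (Min C))))"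

definition proper_subs ::
  "'t qft \<Rightarrow> ('v::linorder, 'e, 't) sgraph \<Rightarrow> ('v, 'e, 't) sgraph set" where
  "proper_subs T s =
     {u. proper_spec_subgraph T u s \<and> specified_graph T (spec_contract s u)}"

definition concat_spec ::
  "('v, 'e, 't) sgraph \<Rightarrow> ('v, 'e, 't) sgraph \<Rightarrow> ('v, 'e, 't) sgraph" where
  "concat_spec s s' = (concat_graph (fst s) (fst s'),
     \<lambda>C. if C \<in> pi0 (fst s) then snd s C else snd s' C)"

definition empty_spec :: "('v, 'e, 't) sgraph" where
  "empty_spec = (empty_graph, \<lambda>_. undefined)"


section \<open>Linear structure\<close>

definition linear_between ::
  "'a::plus set \<Rightarrow> (complex \<Rightarrow> 'a \<Rightarrow> 'a) \<Rightarrow> (complex \<Rightarrow> 'b \<Rightarrow> 'b) \<Rightarrow> ('a \<Rightarrow> 'b::plus) \<Rightarrow> bool" where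
  "linear_between S sa sb f \<longleftrightarrow>
     (\<forall>x\<in>S. \<forall>y\<in>S. f (x + y) = f x + f y) \<and> (\<forall>c. \<forall>x\<in>S. f (sa c x) = sb c (f x))"

text \<open>The vector space generated by the specified graphs, as finitely supported functions.\<close>

type_synonym ('v, 'e, 't) hvec = "('v, 'e, 't) sgraph \<Rightarrow> complex"

definition Hspace :: "'t qft \<Rightarrow> ('v::linorder, 'e, 't) hvec set" where
  "Hspace T = {x. finite {s. x s \<noteq> 0} \<and> {s. x s \<noteq> 0} \<subseteq> Collect (specified_graph T)}"

definition hscale :: "complex \<Rightarrow> ('v, 'e, 't) hvec \<Rightarrow> ('v, 'e, 't) hvec" where
  "hscale c x = (\<lambda>s. c * x s)"

definition gen :: "('v, 'e, 't) sgraph \<Rightarrow> ('v, 'e, 't) hvec" where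
  "gen s = (\<lambda>s'. if s' = s then 1 else 0)"


section \<open>Function spaces\<close>

text \<open>The dimension \<open>D\<close> is \<open>CARD('d)\<close>. A map on half-edges is extended by zero to all of \<open>'e\<close>.\<close>

type_synonym ('e, 'd) mom = "'e \<Rightarrow> (real, 'd) vec"

definition W :: "('v, 'e, 't) fgraph \<Rightarrow> ('e, 'd::finite) mom set" where
  "W \<Gamma> = {p. (\<forall>e. e \<notin> hedges \<Gamma> \<longrightarrow> p e = 0) \<and>
     (\<forall>v \<in> verts \<Gamma>. (\<Sum>e \<in> star \<Gamma> v. p e) = 0) \<and>
     (\<forall>e \<in> hedges \<Gamma>. e \<noteq> sigma \<Gamma> e \<longrightarrow> p e + p (sigma \<Gamma> e) = 0)}"

definition mom_restrict :: "'e set \<Rightarrow> ('e, 'd::finite) mom \<Rightarrow> ('e, 'd) mom" where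
  "mom_restrict E p = (\<lambda>e. if e \<in> E then p e else 0)"

text \<open>
  \<open>C\<^sup>k\<close> functions on a linear subspace \<open>X\<close> of momenta: all iterated directional derivatives up to
  order \<open>k\<close> along vectors of \<open>X\<close> exist and are continuous. Elements of \<open>X = W \<Gamma>\<close> are
  supported in a fixed finite set, so the product topology induces the usual
  topology of the finite-dimensional space \<open>X\<close>.
\<close>

primrec C_diff ::
  "nat \<Rightarrow> ('e, 'd::finite) mom set \<Rightarrow> (('e, 'd) mom \<Rightarrow> complex) \<Rightarrow> bool" where
  "C_diff 0 X f \<longleftrightarrow> continuous_on X f"
| "C_diff (Suc k) X f \<longleftrightarrow> continuous_on X f \<and>
     (\<forall>q\<in>X. \<exists>g. (\<forall>p\<in>X. ((\<lambda>t. f (\<lambda>e. p e + t *\<^sub>R q e)) has_vector_derivative g p) (at 0)) \<and>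
        C_diff k X g)"

text \<open>A function on \<open>X\<close> is represented by its extension by zero.\<close>

definition C_infinity ::
  "('e, 'd::finite) mom set \<Rightarrow> (('e, 'd) mom \<Rightarrow> complex) set" where
  "C_infinity X = {f. (\<forall>k. C_diff k X f) \<and> (\<forall>p. p \<notin> X \<longrightarrow> f p = 0)}"

text \<open>The algebraic tensor product over the components, inside the functions on \<open>W \<Gamma>\<close>: the
  span of the products \<open>\<Prod>\<^sub>C v\<^sub>C(p|\<^sub>C)\<close>. For connected \<open>\<Gamma>\<close> this is \<open>C_infinity (W \<Gamma>)\<close>, for the
  empty graph it is the line of constants.\<close>

definition V :: "('v, 'e, 't) fgraph \<Rightarrow> (('e, 'd::finite) mom \<Rightarrow> complex) set" where
  "V \<Gamma> = {f. \<exists>(n::nat) (c :: nat \<Rightarrow> complex) (v :: nat \<Rightarrow> 'v set \<Rightarrow> ('e, 'd) mom \<Rightarrow> complex).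
     (\<forall>k<n. \<forall>C \<in> pi0 \<Gamma>. v k C \<in> C_infinity (W (induced \<Gamma> C))) \<and>
     f = (\<lambda>p. if p \<in> W \<Gamma>
       then \<Sum>k<n. c k * (\<Prod>C \<in> pi0 \<Gamma>. v k C (mom_restrict (hedges (induced \<Gamma> C)) p))
       else 0)}"

definition one_V :: "('v, 'e, 't) fgraph \<Rightarrow> ('e, 'd::finite) mom \<Rightarrow> complex" where
  "one_V \<Gamma> = (\<lambda>p. if p \<in> W \<Gamma> then 1 else 0)"

text \<open>\<open>pull_i \<Gamma> \<gamma>\<close> is the map \<open>i\<^sub>\<Gamma>\<^sub>,\<^sub>\<gamma>\<close>, where the second argument is the contracted graph,
  and \<open>restr_pi \<Gamma>\<close> is \<open>\<pi>\<^sub>\<gamma>\<^sub>,\<^sub>\<Gamma>\<close>, which depends on \<open>\<gamma>\<close> only through its source.\<close>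

definition pull_i :: "('v, 'e, 't) fgraph \<Rightarrow> ('v, 'e, 't) fgraph \<Rightarrow>
    (('e, 'd::finite) mom \<Rightarrow> complex) \<Rightarrow> ('e, 'd) mom \<Rightarrow> complex" where
  "pull_i \<Gamma> \<Gamma>q f = (\<lambda>p. if p \<in> W \<Gamma> then f (mom_restrict (hedges \<Gamma>q) p) else 0)"

definition restr_pi :: "('v, 'e, 't) fgraph \<Rightarrow>
    (('e, 'd::finite) mom \<Rightarrow> complex) \<Rightarrow> ('e, 'd) mom \<Rightarrow> complex" where
  "restr_pi \<Gamma> f = (\<lambda>p. if p \<in> W \<Gamma> then f p else 0)"

subsection \<open>The algebra \<open>B\<close>\<close>

type_synonym ('v, 'e, 't, 'd) bvec = "('v, 'e, 't) fgraph \<Rightarrow> ('e, 'd) mom \<Rightarrow> complex"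

definition Bspace :: "('v, 'e, 't, 'd::finite) bvec set" where
  "Bspace = {x. \<forall>\<Gamma>. if graph \<Gamma> then x \<Gamma> \<in> V \<Gamma> else x \<Gamma> = 0}"

definition bscale :: "complex \<Rightarrow> ('v, 'e, 't, 'd::finite) bvec \<Rightarrow> ('v, 'e, 't, 'd) bvec" where
  "bscale c x = (\<lambda>\<Gamma> p. c * x \<Gamma> p)"

definition emb :: "('v, 'e, 't) fgraph \<Rightarrow> (('e, 'd::finite) mom \<Rightarrow> complex) \<Rightarrow>
    ('v, 'e, 't, 'd) bvec" where
  "emb \<Gamma> f = (\<lambda>\<Delta>. if \<Delta> = \<Gamma> then f else 0)"

text \<open>\<open>V \<Gamma>\<close> as a subspace of \<open>Bspace\<close>.\<close>

definition VB :: "('v, 'e, 't) fgraph \<Rightarrow> ('v, 'e, 't, 'd::finite) bvec set" where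
  "VB \<Gamma> = emb \<Gamma> ` V \<Gamma>"

text \<open>
  The bilinear extension of the concatenation \<open>v \<bullet> v' \<in> V (\<Gamma>\<Gamma>')\<close> for \<open>v \<in> V \<Gamma>\<close>, \<open>v' \<in> V \<Gamma>'\<close> with
  \<open>\<Gamma>\<close>, \<open>\<Gamma>'\<close> disjoint: the component of a product at \<open>\<Gamma>\<close> collects all ways of writing \<open>\<Gamma>\<close> as a
  concatenation, that is, all splittings \<open>\<pi>\<^sub>0(\<Gamma>) = A \<squnion> B\<close>.
\<close>

definition bmul :: "('v, 'e, 't, 'd::finite) bvec \<Rightarrow> ('v, 'e, 't, 'd) bvec \<Rightarrow>
    ('v, 'e, 't, 'd) bvec"  (infixl "\<bullet>\<^sub>B" 70) where
  "x \<bullet>\<^sub>B y = (\<lambda>\<Gamma> p. if graph \<Gamma> \<and> p \<in> W \<Gamma>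
     then \<Sum>A \<in> Pow (pi0 \<Gamma>).
       (let \<Gamma>1 = induced \<Gamma> (\<Union>A); \<Gamma>2 = induced \<Gamma> (\<Union>(pi0 \<Gamma> - A)) in
        x \<Gamma>1 (mom_restrict (hedges \<Gamma>1) p) * y \<Gamma>2 (mom_restrict (hedges \<Gamma>2) p))
     else 0)"

definition one_B :: "('v, 'e, 't, 'd::finite) bvec" where
  "one_B = (let \<Gamma> = (empty_graph :: ('v, 'e, 't) fgraph) in emb \<Gamma> (one_V \<Gamma>))"

definition endo_B :: "(('v, 'e, 't, 'd::finite) bvec \<Rightarrow> ('v, 'e, 't, 'd) bvec) \<Rightarrow> bool" where
  "endo_B F \<longleftrightarrow> F ` Bspace \<subseteq> Bspace \<and> linear_between Bspace bscale bscale F"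


section \<open>Characters and renormalization\<close>

definition character ::
  "'t qft \<Rightarrow> (('v::linorder, 'e, 't) hvec \<Rightarrow> ('v, 'e, 't, 'd::finite) bvec) \<Rightarrow> bool" where
  "character T \<phi> \<longleftrightarrow>
     \<phi> ` Hspace T \<subseteq> Bspace \<and> linear_between (Hspace T) hscale bscale \<phi> \<and>
     (\<forall>\<Gamma> i i'. specified_graph T (\<Gamma>, i) \<and> specified_graph T (\<Gamma>, i') \<longrightarrow>
        \<phi> (gen (\<Gamma>, i)) = \<phi> (gen (\<Gamma>, i'))) \<and>
     (\<forall>\<Gamma> i. specified_graph T (\<Gamma>, i) \<longrightarrow> \<phi> (gen (\<Gamma>, i)) \<in> VB \<Gamma>) \<and>
     (\<forall>\<Gamma> i. specified_graph T (\<Gamma>, i) \<and> internal \<Gamma> = {} \<longrightarrow>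
        \<phi> (gen (\<Gamma>, i)) = emb \<Gamma> (one_V \<Gamma>)) \<and>
     (\<forall>s s'. specified_graph T s \<and> specified_graph T s' \<and> disjoint_graphs (fst s) (fst s') \<longrightarrow>
        \<phi> (gen (concat_spec s s')) = \<phi> (gen s) \<bullet>\<^sub>B \<phi> (gen s')) \<and>
     \<phi> (gen empty_spec) = one_B"

text \<open>The identity \<open>\<mu> \<circ> (P\<^sub>s \<otimes> P\<^sub>t) = P\<^sub>s\<^sub>+\<^sub>t \<circ> \<mu> \<circ> (P\<^sub>s \<otimes> Id + Id \<otimes> P\<^sub>t - Id \<otimes> Id)\<close>, evaluated on
  \<open>x \<otimes> y\<close>. Two further conditions on \<open>P\<close> are stated separately as hypotheses of the theorem.
  First, \<open>P\<^sub>t\<close> maps each \<open>V \<Gamma>\<close> to itself, without which the recursion for \<open>\<phi>\<^sub>-\<close> makes no sense.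
  Second, \<open>P\<^sub>t\<close> commutes with concatenation by the constant function \<open>1\<close> on a graph \<open>\<Gamma>'\<close>
  without internal edges. This does not follow from the identity, because that function
  is not the unit of the algebra, and \<open>\<phi>\<^sub>- (\<Gamma>\<Gamma>') = \<phi>\<^sub>- (\<Gamma>) \<bullet> \<phi>\<^sub>- (\<Gamma>')\<close> amounts to an instance of it.\<close>

definition indexed_renormalization_scheme ::
  "(nat \<Rightarrow> ('v, 'e, 't, 'd::finite) bvec \<Rightarrow> ('v, 'e, 't, 'd) bvec) \<Rightarrow> bool" where
  "indexed_renormalization_scheme P \<longleftrightarrow> (\<forall>t. endo_B (P t)) \<and>
     (\<forall>s t. \<forall>x\<in>Bspace. \<forall>y\<in>Bspace.
        P s x \<bullet>\<^sub>B P t y = P (s + t) (P s x \<bullet>\<^sub>B y + x \<bullet>\<^sub>B P t y - x \<bullet>\<^sub>B y))"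

text \<open>The argument of \<open>P\<^sub>m\<close> in the recursion; \<open>\<psi>\<close> stands for the values of \<open>\<phi>\<^sub>-\<close> on the proper
  subgraphs. Sums and products of functions are pointwise.\<close>

definition bracket ::
  "'t qft \<Rightarrow> (('v::linorder, 'e, 't) hvec \<Rightarrow> ('v, 'e, 't, 'd::finite) bvec) \<Rightarrow>
   (('v, 'e, 't) sgraph \<Rightarrow> ('v, 'e, 't, 'd) bvec) \<Rightarrow>
   ('v, 'e, 't) sgraph \<Rightarrow> ('v, 'e, 't, 'd) bvec" where
  "bracket T \<phi> \<psi> s = (let \<Gamma> = fst s in
     \<phi> (gen s) + emb \<Gamma> (\<Sum>u \<in> proper_subs T s. let \<gamma> = fst u; q = spec_contract s u in
       restr_pi \<Gamma> (\<psi> u \<gamma>) * pull_i \<Gamma> (fst q) (\<phi> (gen q) (fst q))))"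

lemma bracket_cong [fundef_cong]:
  assumes "T = T'" "\<phi> = \<phi>'" "s = s'" "\<And>u. u \<in> proper_subs T' s' \<Longrightarrow> \<psi> u = \<psi>' u"
  shows "bracket T \<phi> \<psi> s = bracket T' \<phi>' \<psi>' s'"
  using assms by (auto simp: bracket_def Let_def intro!: arg_cong[where f = "emb _"] sum.cong)

lemma proper_subs_internal_less:
  assumes "u \<in> proper_subs T s"
  shows "card (internal (fst u)) < card (internal (fst s))"
proof -
  obtain \<gamma> j \<Gamma> i where [simp]: "u = (\<gamma>, j)" "s = (\<Gamma>, i)" by (metis surj_pair)
  have gr: "graph \<Gamma>" and cov: "covering_subgraph \<gamma> \<Gamma>" and ne: "\<gamma> \<noteq> \<Gamma>"
    using assms
    by (auto simp: proper_subs_def proper_spec_subgraph_def spec_subgraph_def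
        specified_graph_def graph_in_def)
  obtain S where S: "S \<subseteq> internal \<Gamma>" "\<gamma> = cut \<Gamma> S"
    using cov by (auto simp: covering_subgraph_def)
  have "S \<noteq> {}" using ne S by (auto simp: cut_def)
  then obtain d where d: "d \<in> S" by auto
  have sub: "internal \<gamma> \<subseteq> internal \<Gamma>"
    unfolding S(2) internal_def cut_def by auto
  moreover have "d \<notin> internal \<gamma>"
    using d unfolding S(2) internal_def cut_def by auto
  ultimately have "internal \<gamma> \<subset> internal \<Gamma>" using S(1) d by blast
  moreover have "finite (internal \<Gamma>)"
    using gr by (auto simp: internal_def graph_def)
  ultimately show ?thesis by (simp add: psubset_card_mono)
qed

function phi_minus_gen ::
  "'t qft \<Rightarrow> (nat \<Rightarrow> ('v, 'e, 't, 'd::finite) bvec \<Rightarrow> ('v, 'e, 't, 'd) bvec) \<Rightarrow>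
   (('v::linorder, 'e, 't) hvec \<Rightarrow> ('v, 'e, 't, 'd) bvec) \<Rightarrow>
   ('v, 'e, 't) sgraph \<Rightarrow> ('v, 'e, 't, 'd) bvec" where
  "phi_minus_gen T P \<phi> s =
     (if loops (fst s) = 0 then emb (fst s) (one_V (fst s))
      else - P (loops (fst s)) (bracket T \<phi> (\<lambda>u. phi_minus_gen T P \<phi> u) s))"
  by pat_completeness auto
termination
  by (relation "Wellfounded.measure (\<lambda>(T, P, \<phi>, s). card (internal (fst s)))")
     (auto dest: proper_subs_internal_less)

declare phi_minus_gen.simps [simp del]

definition phi_plus_gen ::
  "'t qft \<Rightarrow> (nat \<Rightarrow> ('v, 'e, 't, 'd::finite) bvec \<Rightarrow> ('v, 'e, 't, 'd) bvec) \<Rightarrow>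
   (('v::linorder, 'e, 't) hvec \<Rightarrow> ('v, 'e, 't, 'd) bvec) \<Rightarrow>
   ('v, 'e, 't) sgraph \<Rightarrow> ('v, 'e, 't, 'd) bvec" where
  "phi_plus_gen T P \<phi> s =
     (if loops (fst s) = 0 then emb (fst s) (one_V (fst s))
      else let X = bracket T \<phi> (phi_minus_gen T P \<phi>) s in X - P (loops (fst s)) X)"

definition linear_ext ::
  "(('v, 'e, 't) sgraph \<Rightarrow> ('v, 'e, 't, 'd::finite) bvec) \<Rightarrow>
   ('v, 'e, 't) hvec \<Rightarrow> ('v, 'e, 't, 'd) bvec" where
  "linear_ext f x = (\<Sum>s \<in> {s. x s \<noteq> 0}. bscale (x s) (f s))"

definition phi_minus ::
  "'t qft \<Rightarrow> (nat \<Rightarrow> ('v, 'e, 't, 'd::finite) bvec \<Rightarrow> ('v, 'e, 't, 'd) bvec) \<Rightarrow>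
   (('v::linorder, 'e, 't) hvec \<Rightarrow> ('v, 'e, 't, 'd) bvec) \<Rightarrow>
   ('v, 'e, 't) hvec \<Rightarrow> ('v, 'e, 't, 'd) bvec" where
  "phi_minus T P \<phi> = linear_ext (phi_minus_gen T P \<phi>)"

definition phi_plus ::
  "'t qft \<Rightarrow> (nat \<Rightarrow> ('v, 'e, 't, 'd::finite) bvec \<Rightarrow> ('v, 'e, 't, 'd) bvec) \<Rightarrow>
   (('v::linorder, 'e, 't) hvec \<Rightarrow> ('v, 'e, 't, 'd) bvec) \<Rightarrow>
   ('v, 'e, 't) hvec \<Rightarrow> ('v, 'e, 't, 'd) bvec" where
  "phi_plus T P \<phi> = linear_ext (phi_plus_gen T P \<phi>)"

end

theory Submission
  imports Defs
begin

text \<open>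
  Let \<open>b(s)\<close> be the sum over all specified covering subgraphs of \<open>s\<close> except \<open>s\<close> itself. When \<open>s\<close> has
  internal edges, the skeleton contributes \<open>\<phi>(\<Gamma>)\<close>, so \<open>b(s)\<close> is the argument of \<open>P\<^sub>m\<close>; otherwise
  \<open>b(s) = 0\<close>. In both cases \<open>\<phi>\<^sub>+ = b + \<phi>\<^sub>-\<close> is the sum over all subgraphs. Pairs of subgraphs of \<open>s\<close>
  and \<open>s'\<close> correspond to subgraphs of \<open>ss'\<close>, so by induction on the number of internal edges
  \<open>b(ss') = b \<bullet> b' + b \<bullet> \<phi>\<^sub>-' + \<phi>\<^sub>- \<bullet> b'\<close>. Substituting \<open>\<phi>\<^sub>- = - P b\<close>, the identity of the scheme gives
  \<open>\<phi>\<^sub>-(ss') = \<phi>\<^sub>- \<bullet> \<phi>\<^sub>-'\<close>, and then \<open>\<phi>\<^sub>+(ss') = (b + \<phi>\<^sub>-) \<bullet> (b' + \<phi>\<^sub>-') = \<phi>\<^sub>+ \<bullet> \<phi>\<^sub>+'\<close>. If one factor has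
  degree zero, the hypothesis on products with \<open>1\<close> replaces the identity.

  Independence of the specification is clear for connected graphs, where no proper subgraph
  contains a full component, and extends to all graphs by multiplicativity.
\<close>

subsection \<open>Connected components\<close>

text \<open>The recursion starts at loop number zero, whereas a character is normalised on graphs
  without internal edges. The two agree because specified graphs are locally 1PI: cutting an edge
  lowers the number of edges without raising the number of components, which the general bound |V|
  <= |I| + |\<pi>_0| forbids at loop number zero. So forests with edges never occur, and inductions
  may count internal edges.

  Multiplicativity forces the sums to be taken over all covering subgraphs: when both graphs have
  internal edges, the whole of one together with the skeleton of the other is a proper subgraph of
  the concatenation, although neither entry is proper.

  Independence of the specification cannot be read off the recursion directly. If \<Gamma> is
  disconnected, a proper subgraph may contain a full component and must then carry the index
  prescribed there, so the two sums run over different sets.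

  A further obstacle is that values lie in an algebraic tensor product over the components, which
  \<pi> must be shown to respect although \<gamma> may have more components than \<Gamma>.\<close>

definition closed_in :: "('v, 'e, 't) fgraph \<Rightarrow> 'v set \<Rightarrow> bool" where
  "closed_in \<Gamma> U \<longleftrightarrow> (\<forall>e\<in>hedges \<Gamma>. bdry \<Gamma> e \<in> U \<longleftrightarrow> bdry \<Gamma> (sigma \<Gamma> e) \<in> U)"

text \<open>In a graph, fixed half-edges give trivial steps and the two halves of an internal edge
  give its two directions, so a single step rule suffices.\<close>

lemma conn_induct [consumes 1, case_names refl step]:
  assumes "(u, v) \<in> conn \<Gamma>" and "Q u"
    and "\<And>e. e \<in> hedges \<Gamma> \<Longrightarrow> Q (bdry \<Gamma> e) \<Longrightarrow> Q (bdry \<Gamma> (sigma \<Gamma> e))"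
  shows "Q v"
proof -
  have "(u, v) \<in> {(bdry \<Gamma> e, bdry \<Gamma> (sigma \<Gamma> e)) | e. e \<in> hedges \<Gamma>}\<^sup>*"
    using assms(1) by (simp add: conn_def)
  then show ?thesis by (induction rule: rtrancl_induct) (use assms in auto)
qed

lemma mem_comp_of: "v \<in> comp_of \<Gamma> u \<longleftrightarrow> (u, v) \<in> conn \<Gamma>"
  by (simp add: comp_of_def)

lemma pi0_eq: "pi0 \<Gamma> = comp_of \<Gamma> ` verts \<Gamma>"
  by (auto simp: pi0_def quotient_def comp_of_def)

context
  fixes \<Gamma> :: "('v, 'e, 't) fgraph"
  assumes gr: "graph \<Gamma>"
begin

lemma sigma_hedges: "e \<in> hedges \<Gamma> \<Longrightarrow> sigma \<Gamma> e \<in> hedges \<Gamma>"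
  and sigma_sigma: "e \<in> hedges \<Gamma> \<Longrightarrow> sigma \<Gamma> (sigma \<Gamma> e) = e"
  and bdry_verts: "e \<in> hedges \<Gamma> \<Longrightarrow> bdry \<Gamma> e \<in> verts \<Gamma>"
  and finite_verts: "finite (verts \<Gamma>)"
  and finite_hedges: "finite (hedges \<Gamma>)"
  using gr by (auto simp: graph_def)

lemma finite_internal: "finite (internal \<Gamma>)"
  unfolding internal_def using finite_hedges by simp

lemma equiv_conn: "equiv (verts \<Gamma>) (conn \<Gamma>)"
proof -
  let ?R = "{(bdry \<Gamma> e, bdry \<Gamma> (sigma \<Gamma> e)) | e. e \<in> hedges \<Gamma>}"
  \<comment> \<open>Passing from e to \<open>sigma \<Gamma> e\<close> reverses a step, because
    \<open>sigma \<Gamma>\<close> is an involution.\<close>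
  have "sym ?R"
    by (auto simp: sym_def) (metis sigma_hedges sigma_sigma)
  then have "sym (?R\<^sup>*)" by (rule sym_rtrancl)
  then show ?thesis
    unfolding equiv_def refl_on_def sym_def trans_def conn_def by (auto intro: rtrancl_trans)
qed

lemma conn_edge: "e \<in> hedges \<Gamma> \<Longrightarrow> (bdry \<Gamma> e, bdry \<Gamma> (sigma \<Gamma> e)) \<in> conn \<Gamma>"
  using sigma_hedges bdry_verts by (auto simp: conn_def)

lemma conn_sym: "(u, v) \<in> conn \<Gamma> \<Longrightarrow> (v, u) \<in> conn \<Gamma>"
  using equiv_conn by (auto simp: equiv_def sym_def)

lemma conn_trans: "(u, v) \<in> conn \<Gamma> \<Longrightarrow> (v, w) \<in> conn \<Gamma> \<Longrightarrow> (u, w) \<in> conn \<Gamma>"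
  using equiv_conn by (meson equiv_def transD)

lemma conn_refl: "v \<in> verts \<Gamma> \<Longrightarrow> (v, v) \<in> conn \<Gamma>"
  by (auto simp: conn_def)

lemma conn_verts: "(u, v) \<in> conn \<Gamma> \<Longrightarrow> u \<in> verts \<Gamma>" "(u, v) \<in> conn \<Gamma> \<Longrightarrow> v \<in> verts \<Gamma>"
  by (auto simp: conn_def)

lemma comp_of_eq: "C \<in> pi0 \<Gamma> \<Longrightarrow> v \<in> C \<Longrightarrow> comp_of \<Gamma> v = C"
  unfolding pi0_eq comp_of_def using conn_trans conn_sym by blast

lemma comp_of_pi0: "v \<in> verts \<Gamma> \<Longrightarrow> comp_of \<Gamma> v \<in> pi0 \<Gamma>"
  by (simp add: pi0_eq)

lemma self_in_comp_of: "v \<in> verts \<Gamma> \<Longrightarrow> v \<in> comp_of \<Gamma> v"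
  by (simp add: mem_comp_of conn_refl)

lemma pi0_subset: "C \<in> pi0 \<Gamma> \<Longrightarrow> C \<subseteq> verts \<Gamma>"
  unfolding pi0_eq comp_of_def using conn_verts by auto

lemma pi0_nonempty: "C \<in> pi0 \<Gamma> \<Longrightarrow> C \<noteq> {}"
  unfolding pi0_eq using self_in_comp_of by auto

lemma pi0_eqI: "C \<in> pi0 \<Gamma> \<Longrightarrow> D \<in> pi0 \<Gamma> \<Longrightarrow> v \<in> C \<Longrightarrow> v \<in> D \<Longrightarrow> C = D"
  using comp_of_eq by metis

lemma Union_pi0: "\<Union>(pi0 \<Gamma>) = verts \<Gamma>"
  using pi0_subset comp_of_pi0 self_in_comp_of by blast

lemma finite_pi0: "finite (pi0 \<Gamma>)"
  by (simp add: pi0_eq finite_verts)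

lemma finite_component: "C \<in> pi0 \<Gamma> \<Longrightarrow> finite C"
  using pi0_subset finite_verts finite_subset by blast

text \<open>A path cannot cross the boundary of a closed set in either direction: the induction runs
  once for U and once for its complement. Up to elements that are not vertices, closed sets are the
  unions of components, along which graphs are split and glued.\<close>

lemma conn_closed_in: "closed_in \<Gamma> U \<Longrightarrow> (u, v) \<in> conn \<Gamma> \<Longrightarrow> u \<in> U \<longleftrightarrow> v \<in> U"
  using conn_induct[where Q = "\<lambda>x. x \<in> U"] conn_induct[where Q = "\<lambda>x. x \<notin> U"]
  unfolding closed_in_def by blast

lemma closed_in_pi0: "C \<in> pi0 \<Gamma> \<Longrightarrow> closed_in \<Gamma> C"
  unfolding closed_in_def using conn_edge comp_of_eq mem_comp_of conn_sym by metis

lemma closed_in_Union: "A \<subseteq> pi0 \<Gamma> \<Longrightarrow> closed_in \<Gamma> (\<Union>A)"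
  using closed_in_pi0 unfolding closed_in_def by blast

text \<open>Components are nonempty and disjoint, so a set of components is recovered from its
  union. The sum in the product of \<open>Bspace\<close> runs over such sets, and this singles out
  the one whose union is a given factor.\<close>

lemma subset_pi0_eq: "A \<subseteq> pi0 \<Gamma> \<Longrightarrow> A = {C \<in> pi0 \<Gamma>. C \<subseteq> \<Union>A}"
proof (intro equalityI subsetI)
  fix C assume A: "A \<subseteq> pi0 \<Gamma>" and C: "C \<in> {C \<in> pi0 \<Gamma>. C \<subseteq> \<Union>A}"
  then obtain v where "v \<in> C" using pi0_nonempty by blast
  then show "C \<in> A" using C A pi0_eqI by blast
qed auto

lemma closed_in_sigma: "closed_in \<Gamma> U \<Longrightarrow> e \<in> hedges \<Gamma> \<Longrightarrow> bdry \<Gamma> (sigma \<Gamma> e) \<in> U \<longleftrightarrow> bdry \<Gamma> e \<in> U"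
  by (auto simp: closed_in_def)

end

lemma induced_simps [simp]:
  "verts (induced \<Gamma> U) = verts \<Gamma> \<inter> U"
  "hedges (induced \<Gamma> U) = {e \<in> hedges \<Gamma>. bdry \<Gamma> e \<in> U}"
  "sigma (induced \<Gamma> U) = restrict (sigma \<Gamma>) {e \<in> hedges \<Gamma>. bdry \<Gamma> e \<in> U}"
  "bdry (induced \<Gamma> U) = restrict (bdry \<Gamma>) {e \<in> hedges \<Gamma>. bdry \<Gamma> e \<in> U}"
  "htype (induced \<Gamma> U) = restrict (htype \<Gamma>) {e \<in> hedges \<Gamma>. bdry \<Gamma> e \<in> U}"
  "vindex (induced \<Gamma> U) = restrict (vindex \<Gamma>) (verts \<Gamma> \<inter> U)"
  by (simp_all add: induced_def Let_def)

lemma graph_induced: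
  assumes gr: "graph \<Gamma>" and cl: "closed_in \<Gamma> U"
  shows "graph (induced \<Gamma> U)"
  using sigma_hedges[OF gr] bdry_verts[OF gr] sigma_sigma[OF gr] cl
    finite_verts[OF gr] finite_hedges[OF gr]
  unfolding graph_def closed_in_def by auto

lemma induced_induced: "U' \<subseteq> U \<Longrightarrow> induced (induced \<Gamma> U) U' = induced \<Gamma> U'"
  unfolding induced_def Let_def
  by (auto simp: fun_eq_iff restrict_def)

text \<open>A path starting in U stays there, since no edge leaves a closed set. Both factors of a
  concatenation are induced on closed sets, so the components of a concatenation are found through
  this.\<close>

lemma conn_induced:
  assumes gr: "graph \<Gamma>" and cl: "closed_in \<Gamma> U"
  shows "conn (induced \<Gamma> U) = conn \<Gamma> \<inter> U \<times> U"
proof -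
  have gi: "graph (induced \<Gamma> U)" by (rule graph_induced[OF gr cl])
  have "(u, v) \<in> conn (induced \<Gamma> U)" if uv: "(u, v) \<in> conn \<Gamma>" "u \<in> U" for u v
    using uv(1)
  proof (induction rule: conn_induct)
    case refl
    then show ?case using conn_refl[OF gi] conn_verts[OF gr uv(1)] uv(2) by auto
  next
    case (step e)
    then have "bdry \<Gamma> e \<in> U" using conn_verts(2)[OF gi] by auto
    then have "(bdry \<Gamma> e, bdry \<Gamma> (sigma \<Gamma> e)) \<in> conn (induced \<Gamma> U)"
      using conn_edge[OF gi, of e] step(1) cl sigma_hedges[OF gr step(1)] by (auto simp: closed_in_def)
    then show ?case using step(2) conn_trans[OF gi] by blast
  qed
  moreover have "(u, v) \<in> conn \<Gamma>" if uv: "(u, v) \<in> conn (induced \<Gamma> U)" for u v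
    using uv
  proof (induction rule: conn_induct)
    case refl
    then show ?case using conn_refl[OF gr] conn_verts[OF gi uv] by auto
  next
    case (step e)
    then have e: "e \<in> hedges \<Gamma>" "bdry \<Gamma> e \<in> U" by auto
    then have "sigma \<Gamma> e \<in> hedges \<Gamma>" "bdry \<Gamma> (sigma \<Gamma> e) \<in> U"
      using cl sigma_hedges[OF gr] by (auto simp: closed_in_def)
    then show ?case using conn_trans[OF gr step(2)] conn_edge[OF gr e(1)] e by simp
  qed
  ultimately show ?thesis using conn_verts[OF gi] by auto
qed

lemma comp_of_induced:
  assumes "graph \<Gamma>" "closed_in \<Gamma> U" "v \<in> U"
  shows "comp_of (induced \<Gamma> U) v = comp_of \<Gamma> v"
  unfolding comp_of_def conn_induced[OF assms(1,2)]
  using assms conn_closed_in[OF assms(1,2)] by blast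

lemma pi0_induced:
  assumes gr: "graph \<Gamma>" and cl: "closed_in \<Gamma> U"
  shows "pi0 (induced \<Gamma> U) = {C \<in> pi0 \<Gamma>. C \<subseteq> U}"
proof -
  have "pi0 (induced \<Gamma> U) = comp_of \<Gamma> ` (verts \<Gamma> \<inter> U)"
    using comp_of_induced[OF gr cl]
    unfolding pi0_eq by auto
  also have "\<dots> = {C \<in> pi0 \<Gamma>. C \<subseteq> U}"
  proof -
    have "comp_of \<Gamma> v \<subseteq> U \<longleftrightarrow> v \<in> U" if "v \<in> verts \<Gamma>" for v
      using that conn_closed_in[OF gr cl] self_in_comp_of[OF gr] by (auto simp: mem_comp_of)
    then show ?thesis by (auto simp: pi0_eq)
  qed
  finally show ?thesis .
qed

lemma pi0_induced_component:
  assumes gr: "graph \<Gamma>" and C: "C \<in> pi0 \<Gamma>"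
  shows "pi0 (induced \<Gamma> C) = {C}"
  unfolding pi0_induced[OF gr closed_in_pi0[OF gr C]]
  using C pi0_eqI[OF gr C] pi0_nonempty[OF gr] by blast

lemma connected_induced: "graph \<Gamma> \<Longrightarrow> C \<in> pi0 \<Gamma> \<Longrightarrow> connected_graph (induced \<Gamma> C)"
  by (simp add: connected_graph_def pi0_induced_component)

lemma internal_empty_iff: "internal \<Gamma> = {} \<longleftrightarrow> (\<forall>e\<in>hedges \<Gamma>. sigma \<Gamma> e = e)"
  by (auto simp: internal_def)

lemma comp_of_internal_empty:
  assumes gr: "graph \<Gamma>" and "internal \<Gamma> = {}" and v: "v \<in> verts \<Gamma>"
  shows "comp_of \<Gamma> v = {v}"
proof -
  have "w = v" if "(v, w) \<in> conn \<Gamma>" for w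
    using that by (induction rule: conn_induct) (use assms in \<open>auto simp: internal_empty_iff\<close>)
  then show ?thesis using conn_refl[OF gr v] unfolding comp_of_def by blast
qed

lemma pi0_internal_empty:
  assumes "graph \<Gamma>" "internal \<Gamma> = {}"
  shows "pi0 \<Gamma> = (\<lambda>v. {v}) ` verts \<Gamma>"
  using comp_of_internal_empty[OF assms] by (auto simp: pi0_eq)

subsection \<open>Covering subgraphs\<close>

lemma cut_simps [simp]:
  "verts (cut \<Gamma> S) = verts \<Gamma>" "hedges (cut \<Gamma> S) = hedges \<Gamma>" "bdry (cut \<Gamma> S) = bdry \<Gamma>"
  "htype (cut \<Gamma> S) = htype \<Gamma>" "vindex (cut \<Gamma> S) = vindex \<Gamma>"
  "sigma (cut \<Gamma> S) = (\<lambda>e. if e \<in> \<Union>S then e else sigma \<Gamma> e)"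
  by (simp_all add: cut_def)

text \<open>Each half-edge belongs to at most one internal edge, the pair with its partner. Cutting
  is defined through unions of edges; this turns it into a condition on single half-edges.\<close>

lemma Union_internal_iff:
  assumes gr: "graph \<Gamma>" and S: "S \<subseteq> internal \<Gamma>"
  shows "e \<in> \<Union>S \<longleftrightarrow> e \<in> hedges \<Gamma> \<and> sigma \<Gamma> e \<noteq> e \<and> {e, sigma \<Gamma> e} \<in> S"
proof
  assume "e \<in> \<Union>S"
  then obtain d where d: "d \<in> S" "e \<in> d" by auto
  then obtain e' where "d = {e', sigma \<Gamma> e'}" "e' \<in> hedges \<Gamma>" "sigma \<Gamma> e' \<noteq> e'"
    using S by (auto simp: internal_def)
  then show "e \<in> hedges \<Gamma> \<and> sigma \<Gamma> e \<noteq> e \<and> {e, sigma \<Gamma> e} \<in> S"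
    using d sigma_hedges[OF gr] sigma_sigma[OF gr] by (auto simp: insert_commute)
qed auto

lemma graph_cut:
  assumes gr: "graph \<Gamma>" and S: "S \<subseteq> internal \<Gamma>"
  shows "graph (cut \<Gamma> S)"
proof -
  have "sigma (cut \<Gamma> S) \<in> hedges \<Gamma> \<rightarrow>\<^sub>E hedges \<Gamma>"
    using gr Union_internal_iff[OF gr S] by (auto simp: graph_def PiE_iff extensional_def)
  moreover have "sigma (cut \<Gamma> S) (sigma (cut \<Gamma> S) e) = e" if "e \<in> hedges \<Gamma>" for e
    using that sigma_hedges[OF gr] sigma_sigma[OF gr]
    unfolding cut_simps Union_internal_iff[OF gr S] by (auto simp: insert_commute)
  ultimately show ?thesis using gr unfolding graph_def by (simp del: cut_simps(6))
qed

text \<open>The working form of covering subgraphs, half-edge by half-edge. The right side requires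
  \<open>graph \<gamma>\<close>, hence an involution, so partners are cut together. The set to cut
  is recovered as the internal edges of \<Gamma> that \<gamma> lacks.\<close>

lemma covering_iff:
  assumes gr: "graph \<Gamma>"
  shows "covering_subgraph \<gamma> \<Gamma> \<longleftrightarrow> graph \<gamma> \<and> verts \<gamma> = verts \<Gamma> \<and> hedges \<gamma> = hedges \<Gamma> \<and>
    bdry \<gamma> = bdry \<Gamma> \<and> htype \<gamma> = htype \<Gamma> \<and> vindex \<gamma> = vindex \<Gamma> \<and>
    (\<forall>e\<in>hedges \<Gamma>. sigma \<gamma> e = e \<or> sigma \<gamma> e = sigma \<Gamma> e)" (is "?L \<longleftrightarrow> ?R")
proof
  assume ?L
  then obtain S where "S \<subseteq> internal \<Gamma>" "\<gamma> = cut \<Gamma> S" by (auto simp: covering_subgraph_def)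
  then show ?R using graph_cut[OF gr] by auto
next
  assume R: ?R
  let ?S = "internal \<Gamma> - internal \<gamma>"
  have mem: "e \<in> \<Union>?S \<longleftrightarrow> e \<in> hedges \<Gamma> \<and> sigma \<Gamma> e \<noteq> e \<and> sigma \<gamma> e = e" for e
  proof -
    have "e \<in> \<Union>?S \<longleftrightarrow> e \<in> hedges \<Gamma> \<and> sigma \<Gamma> e \<noteq> e \<and> {e, sigma \<Gamma> e} \<in> ?S"
      by (rule Union_internal_iff[OF gr]) auto
    moreover have "{e, sigma \<Gamma> e} \<in> internal \<Gamma>" if "e \<in> hedges \<Gamma>" "sigma \<Gamma> e \<noteq> e"
      using that by (auto simp: internal_def)
    moreover have "{e, sigma \<Gamma> e} \<in> internal \<gamma> \<longleftrightarrow> sigma \<gamma> e \<noteq> e" if "e \<in> hedges \<Gamma>" "sigma \<Gamma> e \<noteq> e"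
    proof
      assume "{e, sigma \<Gamma> e} \<in> internal \<gamma>"
      then show "sigma \<gamma> e \<noteq> e"
        using Union_internal_iff[of \<gamma> "internal \<gamma>" e] R by auto
    next
      assume "sigma \<gamma> e \<noteq> e"
      then show "{e, sigma \<Gamma> e} \<in> internal \<gamma>"
        using R that unfolding internal_def by force
    qed
    ultimately show ?thesis by blast
  qed
  have "sigma \<gamma> e = sigma (cut \<Gamma> ?S) e" for e
  proof (cases "e \<in> hedges \<Gamma>")
    case True
    then show ?thesis using R mem[of e] by (simp del: Union_iff Diff_iff) metis
  next
    case False
    then have "sigma \<gamma> e = undefined" "sigma \<Gamma> e = undefined"
      using R gr by (auto simp: graph_def PiE_iff extensional_def)
    then show ?thesis using False mem[of e] by (simp del: Union_iff Diff_iff)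
  qed
  then have "\<gamma> = cut \<Gamma> ?S" using R by (intro fgraph.equality) auto
  then show ?L unfolding covering_subgraph_def by blast
qed

text \<open>Both maps are involutions, so an edge is cut at both ends or at neither. This is what
  makes the half-edges of a contraction stable under \<open>sigma \<Gamma>\<close>.\<close>

lemma covering_sigma_fixed:
  assumes "graph \<Gamma>" "covering_subgraph \<gamma> \<Gamma>" "e \<in> hedges \<Gamma>"
  shows "sigma \<gamma> (sigma \<Gamma> e) = sigma \<Gamma> e \<longleftrightarrow> sigma \<gamma> e = e"
  using assms sigma_hedges[OF assms(1)] sigma_sigma[OF assms(1)] sigma_sigma[of \<gamma>]
  unfolding covering_iff[OF assms(1)] by metis

lemma conn_covering:
  assumes gr: "graph \<Gamma>" and cov: "covering_subgraph \<gamma> \<Gamma>"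
  shows "conn \<gamma> \<subseteq> conn \<Gamma>"
proof -
  have g: "graph \<gamma>" using cov covering_iff[OF gr] by blast
  have "(u, v) \<in> conn \<Gamma>" if uv: "(u, v) \<in> conn \<gamma>" for u v
    using uv
  proof (induction rule: conn_induct)
    case refl
    then show ?case using conn_refl[OF gr] conn_verts[OF g uv] cov covering_iff[OF gr] by auto
  next
    case (step e)
    then show ?case using cov conn_edge[OF gr, of e] conn_trans[OF gr] unfolding covering_iff[OF gr] by metis
  qed
  then show ?thesis by auto
qed

lemma closed_in_covering: "graph \<Gamma> \<Longrightarrow> covering_subgraph \<gamma> \<Gamma> \<Longrightarrow> closed_in \<Gamma> U \<Longrightarrow> closed_in \<gamma> U"
  unfolding covering_iff closed_in_def by metis

lemma internal_covering: "graph \<Gamma> \<Longrightarrow> covering_subgraph \<gamma> \<Gamma> \<Longrightarrow> internal \<gamma> \<subseteq> internal \<Gamma>"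
  unfolding covering_iff internal_def by (force dest: bspec)

lemma covering_refl: "graph \<Gamma> \<Longrightarrow> covering_subgraph \<Gamma> \<Gamma>"
  by (simp add: covering_iff)

lemma skeleton_sigma: "graph \<Gamma> \<Longrightarrow> e \<in> hedges \<Gamma> \<Longrightarrow> sigma (skeleton \<Gamma>) e = e"
  unfolding skeleton_def by (auto simp: internal_def)

lemma skeleton_simps [simp]:
  "verts (skeleton \<Gamma>) = verts \<Gamma>" "hedges (skeleton \<Gamma>) = hedges \<Gamma>" "bdry (skeleton \<Gamma>) = bdry \<Gamma>"
  "htype (skeleton \<Gamma>) = htype \<Gamma>" "vindex (skeleton \<Gamma>) = vindex \<Gamma>"
  by (simp_all add: skeleton_def)

lemma skeleton_covering: "covering_subgraph (skeleton \<Gamma>) \<Gamma>"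
  by (auto simp: covering_subgraph_def skeleton_def)

lemma graph_covering: "graph \<Gamma> \<Longrightarrow> covering_subgraph \<gamma> \<Gamma> \<Longrightarrow> graph \<gamma>"
  using covering_iff by blast

lemma internal_skeleton: "graph \<Gamma> \<Longrightarrow> internal (skeleton \<Gamma>) = {}"
  by (simp add: internal_empty_iff skeleton_sigma)

lemma skeleton_eq_iff:
  assumes "graph \<Gamma>" shows "skeleton \<Gamma> = \<Gamma> \<longleftrightarrow> internal \<Gamma> = {}"
proof
  show "internal \<Gamma> = {}" if "skeleton \<Gamma> = \<Gamma>" using internal_skeleton[OF assms] that by simp
  show "skeleton \<Gamma> = \<Gamma>" if "internal \<Gamma> = {}" using that by (simp add: skeleton_def cut_def)
qed

subsection \<open>The loop number\<close>

lemma internal_cut_edge: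
  assumes gr: "graph \<Gamma>" and d: "d \<in> internal \<Gamma>"
  shows "internal (cut \<Gamma> {d}) = internal \<Gamma> - {d}"
proof -
  have mem: "e \<in> d \<longleftrightarrow> e \<in> hedges \<Gamma> \<and> sigma \<Gamma> e \<noteq> e \<and> {e, sigma \<Gamma> e} = d" for e
    using Union_internal_iff[OF gr, of "{d}" e] d by auto
  show ?thesis
    unfolding internal_def cut_simps by (auto simp: mem)
qed

text \<open>Restoring the edge can merge only the two components a and b at its ends. After b is
  removed, distinct components of the cut graph lie in distinct components of \<Gamma>.\<close>

lemma card_pi0_cut_edge:
  assumes gr: "graph \<Gamma>" and d: "d \<in> internal \<Gamma>"
  shows "card (pi0 (cut \<Gamma> {d})) \<le> card (pi0 \<Gamma>) + 1"
proof -
  let ?c = "cut \<Gamma> {d}"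
  have gc: "graph ?c" using graph_cut[OF gr] d by simp
  have cov: "covering_subgraph ?c \<Gamma>" using d by (auto simp: covering_subgraph_def)
  obtain e where e: "e \<in> hedges \<Gamma>" "d = {e, sigma \<Gamma> e}" using d by (auto simp: internal_def)
  define a b where "a = comp_of ?c (bdry \<Gamma> e)" and "b = comp_of ?c (bdry \<Gamma> (sigma \<Gamma> e))"
  have ab: "a \<in> pi0 ?c" "b \<in> pi0 ?c"
    unfolding a_def b_def using comp_of_pi0[OF gc] bdry_verts[OF gr] sigma_hedges[OF gr] e by auto
  \<comment> \<open>Invariant along a path of \<Gamma>: the component in the cut graph changes only
    when d is traversed, and then it stays among a and b.\<close>
  have key: "comp_of ?c v = comp_of ?c u \<or> comp_of ?c u \<in> {a, b} \<and> comp_of ?c v \<in> {a, b}"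
    if "(u, v) \<in> conn \<Gamma>" for u v
    using that
  proof (induction rule: conn_induct)
    case (step e')
    show ?case
    proof (cases "e' \<in> d")
      case True
      then have "comp_of ?c (bdry \<Gamma> e') \<in> {a, b}" "comp_of ?c (bdry \<Gamma> (sigma \<Gamma> e')) \<in> {a, b}"
        using e sigma_sigma[OF gr] by (auto simp: a_def b_def)
      then show ?thesis using step(2) by auto
    next
      case False
      then have "(bdry \<Gamma> e', bdry \<Gamma> (sigma \<Gamma> e')) \<in> conn ?c"
        using conn_edge[OF gc, of e'] step(1) by simp
      then have "comp_of ?c (bdry \<Gamma> e') = comp_of ?c (bdry \<Gamma> (sigma \<Gamma> e'))"
        using equiv_class_eq[OF equiv_conn[OF gc]] by (auto simp: comp_of_def)
      then show ?thesis using step(2) by simp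
    qed
  qed simp
  define g where "g C = comp_of \<Gamma> (SOME v. v \<in> C)" for C
  have rep: "(SOME v. v \<in> C) \<in> C" if "C \<in> pi0 ?c" for C
    using pi0_nonempty[OF gc that] some_in_eq by blast
  have "inj_on g (pi0 ?c - {b})"
  proof (rule inj_onI)
    fix C D assume CD: "C \<in> pi0 ?c - {b}" "D \<in> pi0 ?c - {b}" "g C = g D"
    let ?u = "SOME v. v \<in> C" and ?v = "SOME v. v \<in> D"
    have in_v: "?v \<in> verts \<Gamma>" using rep[of D] CD(2) pi0_subset[OF gc] by auto
    then have "(?u, ?v) \<in> conn \<Gamma>"
      using CD(3) self_in_comp_of[OF gr in_v] unfolding g_def mem_comp_of[symmetric] by simp
    from key[OF this] show "C = D"
      using CD comp_of_eq[OF gc] rep by (metis Diff_iff insert_iff singletonD)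
  qed
  moreover have "g ` (pi0 ?c - {b}) \<subseteq> pi0 \<Gamma>"
    unfolding g_def using comp_of_pi0[OF gr] rep pi0_subset[OF gc] by auto
  ultimately have "card (pi0 ?c - {b}) \<le> card (pi0 \<Gamma>)"
    using finite_pi0[OF gr] card_inj_on_le by blast
  then show ?thesis using ab finite_pi0[OF gc] by simp
qed

text \<open>Each cut loses one edge and gains at most one component; without edges every vertex is a
  component. This is the bound that keeps the natural number subtraction in \<open>loops\<close>
  exact.\<close>

lemma card_verts_le:
  "graph \<Gamma> \<Longrightarrow> card (verts \<Gamma>) \<le> card (internal \<Gamma>) + card (pi0 \<Gamma>)"
proof (induction "card (internal \<Gamma>)" arbitrary: \<Gamma>)
  case 0
  then have "internal \<Gamma> = {}" using finite_internal[OF 0(2)] by simp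
  then have "card (pi0 \<Gamma>) = card (verts \<Gamma>)"
    using pi0_internal_empty[OF 0(2)] by (simp add: card_image)
  then show ?case by simp
next
  case (Suc n)
  then obtain d where d: "d \<in> internal \<Gamma>" by (metis card.empty ex_in_conv nat.distinct(1))
  have "card (internal (cut \<Gamma> {d})) = n"
    using Suc d finite_internal by (simp add: internal_cut_edge)
  then show ?case
    using Suc(1)[of "cut \<Gamma> {d}"] graph_cut[OF Suc(3), of "{d}"] d card_pi0_cut_edge[OF Suc(3) d] Suc(2)
    by simp
qed

lemma loops_internal_empty: "graph \<Gamma> \<Longrightarrow> internal \<Gamma> = {} \<Longrightarrow> loops \<Gamma> = 0"
  by (simp add: loops_def pi0_internal_empty card_image)

text \<open>By local irreducibility, cutting an edge d does not raise the number of components. At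
  loop number zero the cut graph, with one edge fewer, would then violate
  \<open>card_verts_le\<close>.\<close>

lemma loops_eq_0_iff:
  assumes gr: "graph \<Gamma>" and pi: "locally_one_PI \<Gamma>"
  shows "loops \<Gamma> = 0 \<longleftrightarrow> internal \<Gamma> = {}"
proof
  assume l: "loops \<Gamma> = 0"
  show "internal \<Gamma> = {}"
  proof (rule ccontr)
    assume "internal \<Gamma> \<noteq> {}"
    then obtain d where d: "d \<in> internal \<Gamma>" by auto
    let ?c = "cut \<Gamma> {d}"
    have gc: "graph ?c" using graph_cut[OF gr] d by simp
    have cov: "covering_subgraph ?c \<Gamma>" using d by (auto simp: covering_subgraph_def)
    have one: "card {D \<in> pi0 ?c. D \<subseteq> C} = 1" if C: "C \<in> pi0 \<Gamma>" for C
    proof -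
      have cl: "closed_in \<Gamma> C" by (rule closed_in_pi0[OF gr C])
      have op: "one_PI (induced \<Gamma> C)" using pi C by (simp add: locally_one_PI_def)
      have "connected_graph (induced ?c C)"
      \<comment> \<open>If d lies in C, the 1PI property applies to this very cut; otherwise d has
        no half-edge in C and the component is untouched.\<close>
      proof (cases "d \<in> internal (induced \<Gamma> C)")
        case True
        have "cut (induced \<Gamma> C) {d} = induced ?c C"
        proof -
          obtain e where "d = {e, sigma \<Gamma> e}" "e \<in> hedges \<Gamma>" "bdry \<Gamma> e \<in> C"
            using True by (auto simp: internal_def)
          then have "d \<subseteq> {e \<in> hedges \<Gamma>. bdry \<Gamma> e \<in> C}"
            using cl sigma_hedges[OF gr] by (auto simp: closed_in_def)
          then show ?thesis by (intro fgraph.equality) (simp_all, auto simp: fun_eq_iff)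
        qed
        then show ?thesis using op True by (auto simp: one_PI_def)
      next
        case False
        have "e \<notin> d" if "e \<in> hedges \<Gamma>" "bdry \<Gamma> e \<in> C" for e
          using False Union_internal_iff[OF gr, of "{d}" e] d that by (auto simp: internal_def)
        then have "induced ?c C = induced \<Gamma> C"
          by (intro fgraph.equality) (auto simp: restrict_def)
        then show ?thesis using op by (simp add: one_PI_def)
      qed
      then show ?thesis
        using pi0_induced[OF gc closed_in_covering[OF gr cov cl]] by (simp add: connected_graph_def)
    qed
    \<comment> \<open>Every component of the cut graph sits inside a component of \<Gamma>, so
      counting inside each C counts them all.\<close>
    have "pi0 ?c = (\<Union>C\<in>pi0 \<Gamma>. {D \<in> pi0 ?c. D \<subseteq> C})"
    proof (intro equalityI subsetI)
      fix D assume D: "D \<in> pi0 ?c"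
      then obtain v where v: "v \<in> D" using pi0_nonempty[OF gc] by auto
      then have "D = comp_of ?c v" using comp_of_eq[OF gc D] by simp
      then have "D \<subseteq> comp_of \<Gamma> v" using conn_covering[OF gr cov] by (auto simp: comp_of_def)
      moreover have "comp_of \<Gamma> v \<in> pi0 \<Gamma>" using comp_of_pi0[OF gr] pi0_subset[OF gc D] v by auto
      ultimately show "D \<in> (\<Union>C\<in>pi0 \<Gamma>. {D \<in> pi0 ?c. D \<subseteq> C})" using D by blast
    qed auto
    then have "card (pi0 ?c) \<le> (\<Sum>C\<in>pi0 \<Gamma>. card {D \<in> pi0 ?c. D \<subseteq> C})"
      using card_UN_le[OF finite_pi0[OF gr], of "\<lambda>C. {D \<in> pi0 ?c. D \<subseteq> C}"] by simp
    also have "\<dots> = card (pi0 \<Gamma>)" using one by simp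
    finally have "card (pi0 ?c) \<le> card (pi0 \<Gamma>)" .
    moreover have "card (verts \<Gamma>) \<le> card (internal ?c) + card (pi0 ?c)"
      using card_verts_le[OF gc] by simp
    moreover have "card (internal ?c) < card (internal \<Gamma>)"
      using internal_cut_edge[OF gr d] finite_internal[OF gr] d by (simp add: card_Diff1_less del: card_Diff_insert)
    ultimately show False using l by (simp add: loops_def)
  qed
qed (rule loops_internal_empty[OF gr])

subsection \<open>Concatenation\<close>

lemma induced_verts: "graph \<Gamma> \<Longrightarrow> induced \<Gamma> (verts \<Gamma>) = \<Gamma>"
  by (intro fgraph.equality) (auto simp: graph_def restrict_def extensional_def PiE_iff fun_eq_iff)

lemma concat_simps [simp]:
  "verts (concat_graph \<Gamma> \<Gamma>') = verts \<Gamma> \<union> verts \<Gamma>'"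
  "hedges (concat_graph \<Gamma> \<Gamma>') = hedges \<Gamma> \<union> hedges \<Gamma>'"
  "sigma (concat_graph \<Gamma> \<Gamma>') = (\<lambda>e. if e \<in> hedges \<Gamma> then sigma \<Gamma> e else sigma \<Gamma>' e)"
  "bdry (concat_graph \<Gamma> \<Gamma>') = (\<lambda>e. if e \<in> hedges \<Gamma> then bdry \<Gamma> e else bdry \<Gamma>' e)"
  "htype (concat_graph \<Gamma> \<Gamma>') = (\<lambda>e. if e \<in> hedges \<Gamma> then htype \<Gamma> e else htype \<Gamma>' e)"
  "vindex (concat_graph \<Gamma> \<Gamma>') = (\<lambda>v. if v \<in> verts \<Gamma> then vindex \<Gamma> v else vindex \<Gamma>' v)"
  by (simp_all add: concat_graph_def)

lemma disjoint_graphs_commute: "disjoint_graphs \<Gamma> \<Gamma>' \<longleftrightarrow> disjoint_graphs \<Gamma>' \<Gamma>"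
  by (auto simp: disjoint_graphs_def)

lemma concat_graph_commute:
  "graph \<Gamma> \<Longrightarrow> graph \<Gamma>' \<Longrightarrow> disjoint_graphs \<Gamma> \<Gamma>' \<Longrightarrow> concat_graph \<Gamma>' \<Gamma> = concat_graph \<Gamma> \<Gamma>'"
  by (intro fgraph.equality)
    (auto simp: graph_def disjoint_graphs_def extensional_def PiE_iff fun_eq_iff)

text \<open>Gluing returns \<Delta> itself, as a record: every half-edge has its vertex on exactly
  one side, and extensionality fixes the maps elsewhere.\<close>

lemma concat_induced:
  assumes gr: "graph \<Delta>" and cl: "closed_in \<Delta> U"
  shows "disjoint_graphs (induced \<Delta> U) (induced \<Delta> (verts \<Delta> - U))"
    and "concat_graph (induced \<Delta> U) (induced \<Delta> (verts \<Delta> - U)) = \<Delta>"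
proof -
  show "disjoint_graphs (induced \<Delta> U) (induced \<Delta> (verts \<Delta> - U))"
    by (auto simp: disjoint_graphs_def)
  show "concat_graph (induced \<Delta> U) (induced \<Delta> (verts \<Delta> - U)) = \<Delta>"
    using gr
    by (intro fgraph.equality)
      (auto simp: graph_def restrict_def extensional_def PiE_iff fun_eq_iff)
qed

lemma closed_in_diff: "graph \<Gamma> \<Longrightarrow> closed_in \<Gamma> U \<Longrightarrow> closed_in \<Gamma> (verts \<Gamma> - U)"
  using bdry_verts sigma_hedges by (fastforce simp: closed_in_def)

context
  fixes \<Gamma> \<Gamma>' :: "('v, 'e, 't) fgraph"
  assumes gr: "graph \<Gamma>" and gr': "graph \<Gamma>'" and dj: "disjoint_graphs \<Gamma> \<Gamma>'"
begin

lemma concat_right_simps: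
  "e \<in> hedges \<Gamma>' \<Longrightarrow> e \<notin> hedges \<Gamma>" "v \<in> verts \<Gamma>' \<Longrightarrow> v \<notin> verts \<Gamma>"
  using dj by (auto simp: disjoint_graphs_def)

lemma graph_concat: "graph (concat_graph \<Gamma> \<Gamma>')"
  using gr gr' dj concat_right_simps
  by (auto simp: graph_def extensional_def PiE_iff)

lemma induced_concat_left: "U \<subseteq> verts \<Gamma> \<Longrightarrow> induced (concat_graph \<Gamma> \<Gamma>') U = induced \<Gamma> U"
  using concat_right_simps bdry_verts[OF gr] bdry_verts[OF gr']
  by (intro fgraph.equality) (auto simp: fun_eq_iff restrict_def)

lemma closed_in_concat: "closed_in (concat_graph \<Gamma> \<Gamma>') (verts \<Gamma>)"
  using concat_right_simps bdry_verts[OF gr] bdry_verts[OF gr'] sigma_hedges[OF gr] sigma_hedges[OF gr']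
  by (auto simp: closed_in_def)

lemma internal_concat: "internal (concat_graph \<Gamma> \<Gamma>') = internal \<Gamma> \<union> internal \<Gamma>'"
  using concat_right_simps by (fastforce simp: internal_def)

lemma internal_disjoint: "internal \<Gamma> \<inter> internal \<Gamma>' = {}"
proof -
  have "d \<noteq> {} \<and> d \<subseteq> hedges \<Gamma>" if "d \<in> internal \<Gamma>" for d
    using that sigma_hedges[OF gr] by (auto simp: internal_def)
  moreover have "d \<subseteq> hedges \<Gamma>'" if "d \<in> internal \<Gamma>'" for d
    using that sigma_hedges[OF gr'] by (auto simp: internal_def)
  ultimately show ?thesis using dj unfolding disjoint_graphs_def by blast
qed

end

lemma induced_concat_right:
  assumes "graph \<Gamma>" "graph \<Gamma>'" "disjoint_graphs \<Gamma> \<Gamma>'" "U \<subseteq> verts \<Gamma>'"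
  shows "induced (concat_graph \<Gamma> \<Gamma>') U = induced \<Gamma>' U"
  using induced_concat_left[OF assms(2,1)] assms concat_graph_commute[OF assms(1-3)]
  by (simp add: disjoint_graphs_commute)

lemma closed_in_concat_right:
  assumes "graph \<Gamma>" "graph \<Gamma>'" "disjoint_graphs \<Gamma> \<Gamma>'"
  shows "closed_in (concat_graph \<Gamma> \<Gamma>') (verts \<Gamma>')"
  using closed_in_concat[OF assms(2,1)] assms concat_graph_commute[OF assms(1-3)]
  by (simp add: disjoint_graphs_commute)

lemma induced_concat:
  assumes "graph \<Gamma>" "graph \<Gamma>'" "disjoint_graphs \<Gamma> \<Gamma>'"
  shows "induced (concat_graph \<Gamma> \<Gamma>') (verts \<Gamma>) = \<Gamma>" "induced (concat_graph \<Gamma> \<Gamma>') (verts \<Gamma>') = \<Gamma>'"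
  using induced_concat_left[OF assms, of "verts \<Gamma>"] induced_concat_right[OF assms, of "verts \<Gamma>'"]
    induced_verts assms by auto

context
  fixes \<Gamma> \<Gamma>' :: "('v, 'e, 't) fgraph"
  assumes gr: "graph \<Gamma>" and gr': "graph \<Gamma>'" and dj: "disjoint_graphs \<Gamma> \<Gamma>'"
begin

lemma comp_of_concat:
  "v \<in> verts \<Gamma> \<Longrightarrow> comp_of (concat_graph \<Gamma> \<Gamma>') v = comp_of \<Gamma> v"
  "v \<in> verts \<Gamma>' \<Longrightarrow> comp_of (concat_graph \<Gamma> \<Gamma>') v = comp_of \<Gamma>' v"
  using comp_of_induced[OF graph_concat[OF gr gr' dj] closed_in_concat[OF gr gr' dj], of v]
    comp_of_induced[OF graph_concat[OF gr gr' dj] closed_in_concat_right[OF gr gr' dj], of v]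
    induced_concat[OF gr gr' dj] by simp_all

lemma pi0_concat: "pi0 (concat_graph \<Gamma> \<Gamma>') = pi0 \<Gamma> \<union> pi0 \<Gamma>'"
  unfolding pi0_eq concat_simps image_Un using comp_of_concat by (simp cong: image_cong_simp)

lemma pi0_disjoint: "pi0 \<Gamma> \<inter> pi0 \<Gamma>' = {}"
proof -
  have False if "C \<in> pi0 \<Gamma>" "C \<in> pi0 \<Gamma>'" for C
    using pi0_subset[OF gr that(1)] pi0_subset[OF gr' that(2)] pi0_nonempty[OF gr that(1)] dj
    by (auto simp: disjoint_graphs_def)
  then show ?thesis by blast
qed

lemma loops_concat: "loops (concat_graph \<Gamma> \<Gamma>') = loops \<Gamma> + loops \<Gamma>'"
proof -
  have "card (internal \<Gamma> \<union> internal \<Gamma>') = card (internal \<Gamma>) + card (internal \<Gamma>')"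
    using internal_disjoint[OF gr gr' dj] by (intro card_Un_disjoint finite_internal gr gr')
  moreover have "card (pi0 \<Gamma> \<union> pi0 \<Gamma>') = card (pi0 \<Gamma>) + card (pi0 \<Gamma>')"
    using pi0_disjoint by (intro card_Un_disjoint finite_pi0 gr gr')
  moreover have "card (verts \<Gamma> \<union> verts \<Gamma>') = card (verts \<Gamma>) + card (verts \<Gamma>')"
    using dj by (intro card_Un_disjoint finite_verts gr gr') (simp add: disjoint_graphs_def)
  \<comment> \<open>No subtraction in \<open>loops\<close> is truncated, so the three counts simply
    add.\<close>
  ultimately show ?thesis
    using card_verts_le[OF gr] card_verts_le[OF gr']
    by (simp add: loops_def internal_concat[OF gr gr' dj] pi0_concat)
qed

lemma vtype_concat:
  "v \<in> verts \<Gamma> \<Longrightarrow> vtype (concat_graph \<Gamma> \<Gamma>') v = vtype \<Gamma> v"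
  "v \<in> verts \<Gamma>' \<Longrightarrow> vtype (concat_graph \<Gamma> \<Gamma>') v = vtype \<Gamma>' v"
proof -
  have "star (concat_graph \<Gamma> \<Gamma>') v = star \<Gamma> v" if "v \<in> verts \<Gamma>"
  proof -
    have "bdry \<Gamma>' e \<noteq> v" if "e \<in> hedges \<Gamma>'" for e
      using that concat_right_simps(2)[OF gr gr' dj] bdry_verts[OF gr'] \<open>v \<in> verts \<Gamma>\<close> by blast
    then show ?thesis using concat_right_simps(1)[OF gr gr' dj] by (auto simp: star_def)
  qed
  then show "v \<in> verts \<Gamma> \<Longrightarrow> vtype (concat_graph \<Gamma> \<Gamma>') v = vtype \<Gamma> v"
    by (auto simp: vtype_def star_def intro!: arg_cong[where f = card])
  have "star (concat_graph \<Gamma> \<Gamma>') v = star \<Gamma>' v" if "v \<in> verts \<Gamma>'"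
    using that concat_right_simps[OF gr gr' dj] bdry_verts[OF gr]
    by (auto simp: star_def)
  then have "v \<in> verts \<Gamma>' \<Longrightarrow> {e \<in> star (concat_graph \<Gamma> \<Gamma>') v. htype (concat_graph \<Gamma> \<Gamma>') e = a} =
      {e \<in> star \<Gamma>' v. htype \<Gamma>' e = a}" for a
    using concat_right_simps[OF gr gr' dj] by (auto simp: star_def)
  then show "v \<in> verts \<Gamma>' \<Longrightarrow> vtype (concat_graph \<Gamma> \<Gamma>') v = vtype \<Gamma>' v"
    unfolding vtype_def by simp
qed

lemma graph_in_concat: "graph_in T (concat_graph \<Gamma> \<Gamma>') \<longleftrightarrow> graph_in T \<Gamma> \<and> graph_in T \<Gamma>'"
  unfolding graph_in_def
  using concat_right_simps[OF gr gr' dj] gr gr' graph_concat[OF gr gr' dj]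
    sigma_hedges[OF gr] sigma_hedges[OF gr']
  by (auto simp: ball_Un vtype_concat)

lemma covering_concat:
  assumes "covering_subgraph \<gamma> \<Gamma>" "covering_subgraph \<gamma>' \<Gamma>'"
  shows "covering_subgraph (concat_graph \<gamma> \<gamma>') (concat_graph \<Gamma> \<Gamma>')"
proof -
  have "graph \<gamma>" "graph \<gamma>'" "disjoint_graphs \<gamma> \<gamma>'"
    using assms dj by (auto simp: covering_iff gr gr' disjoint_graphs_def)
  then show ?thesis
    using assms concat_right_simps[OF gr gr' dj]
    unfolding covering_iff[OF gr] covering_iff[OF gr'] covering_iff[OF graph_concat[OF gr gr' dj]]
    by (intro conjI ballI) (auto simp: graph_concat)
qed

text \<open>A subgraph has no edges that the concatenation lacks, so the vertex sets of both factors
  remain closed in it and it splits along them.\<close>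

lemma covering_concat_cases:
  assumes cov: "covering_subgraph \<delta> (concat_graph \<Gamma> \<Gamma>')"
  obtains \<gamma> \<gamma>' where "covering_subgraph \<gamma> \<Gamma>" "covering_subgraph \<gamma>' \<Gamma>'" "\<delta> = concat_graph \<gamma> \<gamma>'"
proof -
  let ?\<Delta> = "concat_graph \<Gamma> \<Gamma>'"
  have gd: "graph ?\<Delta>" by (rule graph_concat[OF gr gr' dj])
  have g: "graph \<delta>" by (rule graph_covering[OF gd cov])
  note cv = cov[unfolded covering_iff[OF gd]]
  have cl: "closed_in \<delta> (verts \<Gamma>)" "closed_in \<delta> (verts \<Gamma>')"
    using closed_in_covering[OF gd cov] closed_in_concat[OF gr gr' dj] closed_in_concat_right[OF gr gr' dj] by auto
  have d: "verts \<delta> - verts \<Gamma> = verts \<Gamma>'" using cv dj by (auto simp: disjoint_graphs_def)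
  have sub: "covering_subgraph (induced \<delta> U) (induced ?\<Delta> U)" if U: "closed_in ?\<Delta> U" for U
    unfolding covering_iff[OF graph_induced[OF gd U]]
    using cv graph_induced[OF g closed_in_covering[OF gd cov U]] by auto
  show thesis
  proof (rule that)
    show "covering_subgraph (induced \<delta> (verts \<Gamma>)) \<Gamma>"
      using sub[OF closed_in_concat[OF gr gr' dj]] induced_concat[OF gr gr' dj] by simp
    show "covering_subgraph (induced \<delta> (verts \<Gamma>')) \<Gamma>'"
      using sub[OF closed_in_concat_right[OF gr gr' dj]] induced_concat[OF gr gr' dj] by simp
    show "\<delta> = concat_graph (induced \<delta> (verts \<Gamma>)) (induced \<delta> (verts \<Gamma>'))"
      using concat_induced(2)[OF g cl(1)] d by simp
  qed
qed

end

subsection \<open>Specified graphs\<close>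

text \<open>The type of the vertex to which C is contracted, read from the external half-edges at C
  without forming the contraction. Taken in \<gamma>, it is also the type of the corresponding
  vertex of \<Gamma>/\<gamma>.\<close>

definition residue_type :: "('v, 'e, 't) fgraph \<Rightarrow> 'v set \<Rightarrow> 't \<Rightarrow> nat" where
  "residue_type \<Gamma> C = (\<lambda>a. card {e \<in> hedges \<Gamma>. bdry \<Gamma> e \<in> C \<and> sigma \<Gamma> e = e \<and> htype \<Gamma> e = a})"

text \<open>What \<open>specified_graph\<close> asks at one component. It depends only on the graph
  induced on C, and so can be transported between a concatenation and its factors.\<close>

definition specified_component ::
  "'t qft \<Rightarrow> ('v::linorder, 'e, 't) fgraph \<Rightarrow> 'v set \<Rightarrow> nat \<Rightarrow> bool" where
  "specified_component T \<Gamma> C k \<longleftrightarrow> one_PI (induced \<Gamma> C) \<and> residue_type \<Gamma> C \<in> vtypes T \<and>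
     (residue_type \<Gamma> C, k) \<in> rtypes T \<and>
     (internal (induced \<Gamma> C) = {} \<longrightarrow> (\<forall>v\<in>C. k = vindex \<Gamma> v))"

lemma residue_component:
  fixes \<Gamma> :: "('v::linorder, 'e, 't) fgraph"
  assumes gr: "graph \<Gamma>" and C: "C \<in> pi0 \<Gamma>"
  shows "verts (residue (induced \<Gamma> C) i) = {Min C}"
    and "vtype (residue (induced \<Gamma> C) i) (Min C) = residue_type \<Gamma> C"
    and "vindex (residue (induced \<Gamma> C) i) (Min C) = i C"
proof -
  let ?X = "induced \<Gamma> C"
  have gx: "graph ?X" by (rule graph_induced[OF gr closed_in_pi0[OF gr C]])
  have p: "pi0 ?X = {C}" by (rule pi0_induced_component[OF gr C])
  have m: "Min C \<in> C" using finite_component[OF gr C] pi0_nonempty[OF gr C] by simp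
  have comp: "comp_of ?X v = C" if "v \<in> C" for v
    using comp_of_eq[OF gx] p that by simp
  show "verts (residue ?X i) = {Min C}" "vindex (residue ?X i) (Min C) = i C"
    by (auto simp: residue_def contract_def Let_def p comp m)
  have "{e \<in> star (residue ?X i) (Min C). htype (residue ?X i) e = a} =
      {e \<in> hedges \<Gamma>. bdry \<Gamma> e \<in> C \<and> sigma \<Gamma> e = e \<and> htype \<Gamma> e = a}" for a
  proof -
    have "hedges (residue ?X i) = {e \<in> hedges \<Gamma>. bdry \<Gamma> e \<in> C \<and> sigma \<Gamma> e = e}"
      by (auto simp: residue_def contract_def Let_def)
    moreover have "htype (residue ?X i) e = htype \<Gamma> e" "bdry (residue ?X i) e = Min C"
      if "e \<in> hedges (residue ?X i)" for e
      using that by (auto simp: residue_def contract_def Let_def comp)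
    ultimately show ?thesis by (auto simp: star_def)
  qed
  then show "vtype (residue ?X i) (Min C) = residue_type \<Gamma> C"
    unfolding vtype_def residue_type_def by simp
qed

text \<open>The residue of a component has the one vertex \<open>Min C\<close>, so the quantifiers
  over its vertices disappear.\<close>

lemma specified_iff:
  "specified_graph T (\<Gamma>, i) \<longleftrightarrow> graph_in T \<Gamma> \<and> i \<in> extensional (pi0 \<Gamma>) \<and>
     (\<forall>C\<in>pi0 \<Gamma>. specified_component T \<Gamma> C (i C))"
proof (cases "graph \<Gamma>")
  case True
  then show ?thesis
    unfolding specified_graph_def locally_one_PI_def superficially_divergent_def
      specified_component_def Let_def
    by (auto simp: residue_component)
next
  case False
  then show ?thesis by (auto simp: specified_graph_def graph_in_def)
qed

lemma specified_graph_graph: "specified_graph T (\<Gamma>, i) \<Longrightarrow> graph \<Gamma>"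
  by (simp add: specified_iff graph_in_def)

lemma specified_component_induced:
  assumes "C \<subseteq> U" "C \<subseteq> verts \<Gamma>"
  shows "specified_component T (induced \<Gamma> U) C k \<longleftrightarrow> specified_component T \<Gamma> C k"
proof -
  have "residue_type (induced \<Gamma> U) C = residue_type \<Gamma> C"
    unfolding residue_type_def fun_eq_iff using assms(1)
    by (auto intro!: arg_cong[where f = card])
  then show ?thesis
    using assms by (auto simp: specified_component_def induced_induced)
qed

lemma specified_component_concat:
  assumes "graph \<Gamma>" "graph \<Gamma>'" "disjoint_graphs \<Gamma> \<Gamma>'"
  shows "C \<in> pi0 \<Gamma> \<Longrightarrow> specified_component T (concat_graph \<Gamma> \<Gamma>') C k \<longleftrightarrow> specified_component T \<Gamma> C k"
    and "C \<in> pi0 \<Gamma>' \<Longrightarrow> specified_component T (concat_graph \<Gamma> \<Gamma>') C k \<longleftrightarrow> specified_component T \<Gamma>' C k"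
  using specified_component_induced[of C "verts \<Gamma>" "concat_graph \<Gamma> \<Gamma>'" T k]
    specified_component_induced[of C "verts \<Gamma>'" "concat_graph \<Gamma> \<Gamma>'" T k]
    induced_concat[OF assms] pi0_subset[OF assms(1), of C] pi0_subset[OF assms(2), of C] by auto

text \<open>\<open>concat_spec\<close> forgets the values of i off the components of \<Gamma> and
  those of i' on them, so their extensionality cannot be recovered from the left side and is
  assumed.\<close>

lemma specified_concat_iff:
  assumes g: "graph \<Gamma>" "graph \<Gamma>'" "disjoint_graphs \<Gamma> \<Gamma>'"
    and i: "i \<in> extensional (pi0 \<Gamma>)" "i' \<in> extensional (pi0 \<Gamma>')"
  shows "specified_graph T (concat_spec (\<Gamma>, i) (\<Gamma>', i')) \<longleftrightarrow>
    specified_graph T (\<Gamma>, i) \<and> specified_graph T (\<Gamma>', i')"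
  using i pi0_disjoint[OF g]
  unfolding concat_spec_def fst_conv snd_conv specified_iff pi0_concat[OF g] graph_in_concat[OF g] ball_Un
  by (auto simp: extensional_def specified_component_concat[OF g])

lemma concat_spec_split:
  assumes gr: "graph \<Delta>" and cl: "closed_in \<Delta> U" and k: "k \<in> extensional (pi0 \<Delta>)"
  shows "(\<Delta>, k) = concat_spec (induced \<Delta> U, restrict k (pi0 (induced \<Delta> U)))
    (induced \<Delta> (verts \<Delta> - U), restrict k (pi0 (induced \<Delta> (verts \<Delta> - U))))"
proof -
  have "pi0 \<Delta> = pi0 (induced \<Delta> U) \<union> pi0 (induced \<Delta> (verts \<Delta> - U))"
    using pi0_concat[OF graph_induced[OF gr cl] graph_induced[OF gr closed_in_diff[OF gr cl]]
        concat_induced(1)[OF gr cl]] concat_induced(2)[OF gr cl] by simp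
  then show ?thesis
    using k by (auto simp: concat_spec_def concat_induced(2)[OF gr cl] fun_eq_iff extensional_def restrict_def)
qed

subsection \<open>Contraction\<close>

lemma contract_simps [simp]:
  "verts (contract \<Gamma> \<gamma> j) = Min ` pi0 \<gamma>"
  "hedges (contract \<Gamma> \<gamma> j) = {e \<in> hedges \<Gamma>. sigma \<gamma> e = e}"
  "sigma (contract \<Gamma> \<gamma> j) = restrict (sigma \<Gamma>) {e \<in> hedges \<Gamma>. sigma \<gamma> e = e}"
  "bdry (contract \<Gamma> \<gamma> j) = (\<lambda>e\<in>{e \<in> hedges \<Gamma>. sigma \<gamma> e = e}. Min (comp_of \<gamma> (bdry \<Gamma> e)))"
  "htype (contract \<Gamma> \<gamma> j) = restrict (htype \<Gamma>) {e \<in> hedges \<Gamma>. sigma \<gamma> e = e}"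
  "vindex (contract \<Gamma> \<gamma> j) = (\<lambda>v\<in>Min ` pi0 \<gamma>. j (comp_of \<gamma> v))"
  by (simp_all add: contract_def Let_def)

lemma Min_component:
  fixes \<Gamma> :: "('v::linorder, 'e, 't) fgraph"
  shows "graph \<Gamma> \<Longrightarrow> C \<in> pi0 \<Gamma> \<Longrightarrow> Min C \<in> C"
  by (simp add: finite_component pi0_nonempty)

lemma comp_of_Min:
  fixes \<Gamma> :: "('v::linorder, 'e, 't) fgraph"
  shows "graph \<Gamma> \<Longrightarrow> C \<in> pi0 \<Gamma> \<Longrightarrow> comp_of \<Gamma> (Min C) = C"
  by (simp add: comp_of_eq Min_component)

lemma vtype_internal_empty:
  assumes "internal \<Gamma> = {}" shows "residue_type \<Gamma> {v} = vtype \<Gamma> v"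
  using assms unfolding residue_type_def vtype_def star_def fun_eq_iff internal_empty_iff
  by (auto intro!: arg_cong[where f = card])

text \<open>Components are single vertices, and the residue of a vertex is the vertex itself. Its
  refined type is already in the theory, which leaves exactly one specification. This applies to the
  skeleton and to \<Gamma>/\<Gamma>.\<close>

lemma specified_internal_empty:
  fixes \<Gamma> :: "('v::linorder, 'e, 't) fgraph"
  assumes wf: "wf_qft T" and int: "internal \<Gamma> = {}"
  shows "specified_graph T (\<Gamma>, i) \<longleftrightarrow>
    graph_in T \<Gamma> \<and> i = (\<lambda>C\<in>pi0 \<Gamma>. vindex \<Gamma> (the_elem C))"
proof (cases "graph_in T \<Gamma>")
  case True
  then have gr: "graph \<Gamma>" by (simp add: graph_in_def)
  have p: "pi0 \<Gamma> = (\<lambda>v. {v}) ` verts \<Gamma>" by (rule pi0_internal_empty[OF gr int])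
  have "specified_component T \<Gamma> C (i C) \<longleftrightarrow> i C = vindex \<Gamma> (the_elem C)" if C: "C \<in> pi0 \<Gamma>" for C
  proof -
    obtain v where v: "C = {v}" "v \<in> verts \<Gamma>" using C unfolding p by auto
    have "internal (induced \<Gamma> C) = {}" using int by (auto simp: internal_empty_iff)
    moreover from this have "one_PI (induced \<Gamma> C)"
      using connected_induced[OF gr C] by (simp add: one_PI_def)
    moreover have "(vtype \<Gamma> v, vindex \<Gamma> v) \<in> rtypes T" using True v by (simp add: graph_in_def)
    moreover from this have "vtype \<Gamma> v \<in> vtypes T" using wf by (auto simp: wf_qft_def)
    ultimately show ?thesis
      using v by (auto simp: specified_component_def vtype_internal_empty[OF int])
  qed
  then show ?thesis using True
    by (auto simp: specified_iff fun_eq_iff extensional_def)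
qed (simp add: specified_iff)

context
  fixes \<Gamma> \<gamma> :: "('v::linorder, 'e, 't) fgraph"
  assumes gr: "graph \<Gamma>" and cov: "covering_subgraph \<gamma> \<Gamma>"
begin

lemma covering_simps:
  "verts \<gamma> = verts \<Gamma>" "hedges \<gamma> = hedges \<Gamma>" "bdry \<gamma> = bdry \<Gamma>" "htype \<gamma> = htype \<Gamma>" "vindex \<gamma> = vindex \<Gamma>"
  "graph \<gamma>"
  using cov covering_iff[OF gr] by auto

lemma Min_comp_of_conn: "v \<in> verts \<Gamma> \<Longrightarrow> (v, Min (comp_of \<gamma> v)) \<in> conn \<Gamma>"
  using Min_component[OF covering_simps(6) comp_of_pi0[OF covering_simps(6)], of v] covering_simps
    conn_covering[OF gr cov] by (auto simp: mem_comp_of)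

lemma verts_contract_subset: "verts (contract \<Gamma> \<gamma> j) \<subseteq> verts \<Gamma>"
  using Min_component[OF covering_simps(6)] pi0_subset[OF covering_simps(6)] covering_simps by auto

lemma Min_comp_of_vert: "v \<in> verts (contract \<Gamma> \<gamma> j) \<Longrightarrow> Min (comp_of \<gamma> v) = v"
  using comp_of_Min[OF covering_simps(6)] by auto

lemma graph_contract: "graph (contract \<Gamma> \<gamma> j)"
  using finite_pi0[OF covering_simps(6)] finite_hedges[OF gr] sigma_hedges[OF gr]
    covering_sigma_fixed[OF gr cov] sigma_sigma[OF gr] bdry_verts[OF gr] covering_simps
    comp_of_pi0[OF covering_simps(6)]
  unfolding graph_def by auto

text \<open>Sending a vertex to the representative of its component in \<gamma> turns an edge of
  \<gamma> into a trivial step and any other edge into an edge of \<Gamma>/\<gamma>. Back in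
  \<Gamma>, each vertex is joined to its representative by a path of \<gamma>.\<close>

lemma conn_contract:
  "conn (contract \<Gamma> \<gamma> j) = conn \<Gamma> \<inter> verts (contract \<Gamma> \<gamma> j) \<times> verts (contract \<Gamma> \<gamma> j)"
proof -
  let ?q = "contract \<Gamma> \<gamma> j" and ?r = "\<lambda>v. Min (comp_of \<gamma> v)"
  note cs = covering_simps
  have r: "?r v \<in> verts ?q" if "v \<in> verts \<Gamma>" for v
    using comp_of_pi0[OF cs(6)] cs that by simp
  have 1: "(?r u, ?r v) \<in> conn ?q" if uv: "(u, v) \<in> conn \<Gamma>" for u v
    using uv
  proof (induction rule: conn_induct)
    case refl
    show ?case by (rule conn_refl[OF graph_contract]) (use r conn_verts[OF gr uv] in blast)
  next
    case (step e)
    have "(?r (bdry \<Gamma> e), ?r (bdry \<Gamma> (sigma \<Gamma> e))) \<in> conn ?q"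
    proof (cases "sigma \<gamma> e = e")
      case True
      then show ?thesis
        using conn_edge[OF graph_contract, of e j] step(1) sigma_hedges[OF gr step(1)]
          covering_sigma_fixed[OF gr cov step(1)] by simp
    next
      case False
      then have "sigma \<gamma> e = sigma \<Gamma> e" using cov step(1) covering_iff[OF gr] by metis
      then have "comp_of \<gamma> (bdry \<Gamma> e) = comp_of \<gamma> (bdry \<Gamma> (sigma \<Gamma> e))"
        using conn_edge[OF cs(6), of e] step(1) cs equiv_class_eq[OF equiv_conn[OF cs(6)]]
        by (auto simp: comp_of_def)
      then show ?thesis
        using conn_refl[OF graph_contract r[OF bdry_verts[OF gr step(1)]]] by simp
    qed
    then show ?case using step(2) conn_trans[OF graph_contract] by blast
  qed
  have 2: "(u, v) \<in> conn \<Gamma>" if uv: "(u, v) \<in> conn ?q" for u v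
    using uv
  proof (induction rule: conn_induct)
    case refl
    show ?case
      using conn_refl[OF gr] conn_verts[OF graph_contract uv] verts_contract_subset by blast
  next
    case (step e)
    then have e: "e \<in> hedges \<Gamma>" "sigma \<gamma> e = e" by auto
    then have e': "sigma \<Gamma> e \<in> hedges \<Gamma>" "sigma \<gamma> (sigma \<Gamma> e) = sigma \<Gamma> e"
      using sigma_hedges[OF gr] covering_sigma_fixed[OF gr cov] by auto
    have "(?r (bdry \<Gamma> e), ?r (bdry \<Gamma> (sigma \<Gamma> e))) \<in> conn \<Gamma>"
      using Min_comp_of_conn[OF bdry_verts[OF gr e(1)]] Min_comp_of_conn[OF bdry_verts[OF gr e'(1)]]
        conn_edge[OF gr e(1)] conn_sym[OF gr] conn_trans[OF gr] by meson
    then show ?case using step(2) conn_trans[OF gr] e e' by simp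
  qed
  have "?r v = v" if "v \<in> verts ?q" for v
    using that by (rule Min_comp_of_vert)
  then show ?thesis
    using 1 2 conn_verts[OF graph_contract] by (auto simp del: contract_simps) metis+
qed

lemma comp_of_contract:
  "v \<in> verts (contract \<Gamma> \<gamma> j) \<Longrightarrow>
    comp_of (contract \<Gamma> \<gamma> j) v = comp_of \<Gamma> v \<inter> verts (contract \<Gamma> \<gamma> j)"
  unfolding comp_of_def conn_contract by auto

text \<open>This makes explicit the correspondence of components along which
  \<open>spec_contract\<close> transports the specification: D is the trace, on the chosen
  representatives, of a component of \<Gamma>.\<close>

lemma component_contract:
  assumes D: "D \<in> pi0 (contract \<Gamma> \<gamma> j)"
  shows "comp_of \<Gamma> (Min D) \<in> pi0 \<Gamma>"
    and "D = comp_of \<Gamma> (Min D) \<inter> verts (contract \<Gamma> \<gamma> j)"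
proof -
  have "Min D \<in> verts (contract \<Gamma> \<gamma> j)"
    using Min_component[OF graph_contract D] pi0_subset[OF graph_contract D] by blast
  then show "D = comp_of \<Gamma> (Min D) \<inter> verts (contract \<Gamma> \<gamma> j)" "comp_of \<Gamma> (Min D) \<in> pi0 \<Gamma>"
    using comp_of_contract comp_of_Min[OF graph_contract D] verts_contract_subset comp_of_pi0[OF gr]
    by (metis, blast)
qed

lemma Min_comp_of_mem:
  assumes "C \<in> pi0 \<Gamma>" and "v \<in> verts \<Gamma>"
  shows "Min (comp_of \<gamma> v) \<in> C \<longleftrightarrow> v \<in> C"
  using Min_comp_of_conn[OF assms(2)] conn_closed_in[OF gr closed_in_pi0[OF gr assms(1)]] by blast

lemma vtype_contract:
  assumes A: "A \<in> pi0 \<gamma>"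
  shows "vtype (contract \<Gamma> \<gamma> j) (Min A) = residue_type \<gamma> A"
proof -
  note cs = covering_simps
  have "Min (comp_of \<gamma> v) = Min A \<longleftrightarrow> v \<in> A" if "v \<in> verts \<Gamma>" for v
    using comp_of_Min[OF cs(6) A] comp_of_Min[OF cs(6) comp_of_pi0[OF cs(6)], of v] that cs
      self_in_comp_of[OF cs(6)] comp_of_eq[OF cs(6) A] by metis
  then have "{e \<in> star (contract \<Gamma> \<gamma> j) (Min A). htype (contract \<Gamma> \<gamma> j) e = a} =
      {e \<in> hedges \<gamma>. bdry \<gamma> e \<in> A \<and> sigma \<gamma> e = e \<and> htype \<gamma> e = a}" for a
    using bdry_verts[OF gr] by (auto simp: star_def cs)
  then show ?thesis unfolding vtype_def residue_type_def by simp
qed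

lemma vindex_contract: "A \<in> pi0 \<gamma> \<Longrightarrow> vindex (contract \<Gamma> \<gamma> j) (Min A) = j A"
  using comp_of_Min[OF covering_simps(6)] by simp

text \<open>The condition on j at a component of \<gamma> is exactly the condition on the refined
  type of the vertex that it becomes.\<close>

lemma graph_in_contract:
  assumes "graph_in T \<Gamma>" "specified_graph T (\<gamma>, j)"
  shows "graph_in T (contract \<Gamma> \<gamma> j)"
proof -
  have "(vtype (contract \<Gamma> \<gamma> j) v, vindex (contract \<Gamma> \<gamma> j) v) \<in> rtypes T"
    if v: "v \<in> verts (contract \<Gamma> \<gamma> j)" for v
  proof -
    obtain A where A: "A \<in> pi0 \<gamma>" "v = Min A" using v by auto
    then show ?thesis
      using assms(2) vtype_contract[OF A(1), of j] vindex_contract[OF A(1), of j]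
      by (simp del: contract_simps add: specified_iff specified_component_def)
  qed
  then show ?thesis
    using assms(1) graph_contract[of j] covering_sigma_fixed[OF gr cov] sigma_hedges[OF gr]
    unfolding graph_in_def by simp
qed

end

lemma internal_contract_self: "internal (contract \<Gamma> \<Gamma> j) = {}"
  by (simp add: internal_empty_iff)

lemma contract_skeleton:
  fixes \<Gamma> :: "('v::linorder, 'e, 't) fgraph"
  assumes gr: "graph \<Gamma>"
  shows "contract \<Gamma> (skeleton \<Gamma>) (\<lambda>C\<in>pi0 (skeleton \<Gamma>). vindex \<Gamma> (the_elem C)) = \<Gamma>"
proof -
  have gs: "graph (skeleton \<Gamma>)" by (rule graph_covering[OF gr skeleton_covering])
  have p: "pi0 (skeleton \<Gamma>) = (\<lambda>v. {v}) ` verts \<Gamma>"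
    using pi0_internal_empty[OF gs internal_skeleton[OF gr]] by simp
  have c: "comp_of (skeleton \<Gamma>) v = {v}" if "v \<in> verts \<Gamma>" for v
    using comp_of_internal_empty[OF gs internal_skeleton[OF gr]] that by simp
  have h: "{e \<in> hedges \<Gamma>. sigma (skeleton \<Gamma>) e = e} = hedges \<Gamma>"
    using skeleton_sigma[OF gr] by auto
  show ?thesis
    using gr bdry_verts[OF gr]
    by (intro fgraph.equality)
      (auto simp: h p c image_image fun_eq_iff restrict_def graph_def extensional_def PiE_iff)
qed

text \<open>Components of \<gamma> lie in \<Gamma> and those of \<gamma>' in \<Gamma>', so neither
  the representatives chosen by \<open>Min\<close> nor the indices ever mix.\<close>

lemma contract_concat:
  fixes \<Gamma> \<Gamma>' :: "('v::linorder, 'e, 't) fgraph"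
  assumes gr: "graph \<Gamma>" and gr': "graph \<Gamma>'" and dj: "disjoint_graphs \<Gamma> \<Gamma>'"
    and cov: "covering_subgraph \<gamma> \<Gamma>" and cov': "covering_subgraph \<gamma>' \<Gamma>'"
  shows "contract (concat_graph \<Gamma> \<Gamma>') (concat_graph \<gamma> \<gamma>') (\<lambda>C. if C \<in> pi0 \<gamma> then j C else j' C) =
    concat_graph (contract \<Gamma> \<gamma> j) (contract \<Gamma>' \<gamma>' j')"
proof -
  note cs = covering_simps[OF gr cov] and cs' = covering_simps[OF gr' cov']
  have djg: "disjoint_graphs \<gamma> \<gamma>'" using dj cs cs' by (simp add: disjoint_graphs_def)
  note rs = concat_right_simps[OF gr gr' dj]
  have c: "comp_of (concat_graph \<gamma> \<gamma>') v = comp_of \<gamma> v" if "v \<in> verts \<Gamma>" for v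
    using comp_of_concat[OF cs(6) cs'(6) djg] that cs by simp
  have c': "comp_of (concat_graph \<gamma> \<gamma>') v = comp_of \<gamma>' v" if "v \<in> verts \<Gamma>'" for v
    using comp_of_concat[OF cs(6) cs'(6) djg] that cs' by simp
  have v: "Min A \<in> verts \<Gamma>" "comp_of \<gamma> (Min A) = A" if "A \<in> pi0 \<gamma>" for A
    using verts_contract_subset[OF gr cov] comp_of_Min[OF cs(6)] that by auto
  have v': "Min A \<in> verts \<Gamma>'" "comp_of \<gamma>' (Min A) = A" "A \<notin> pi0 \<gamma>" if "A \<in> pi0 \<gamma>'" for A
    using verts_contract_subset[OF gr' cov'] comp_of_Min[OF cs'(6)] that pi0_disjoint[OF cs(6) cs'(6) djg]
    by auto
  have vv: "Min A \<noteq> Min B" if "A \<in> pi0 \<gamma>" "B \<in> pi0 \<gamma>'" for A B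
    using v(1)[OF that(1)] v'(1)[OF that(2)] rs(2) by metis
  show ?thesis
  proof (intro fgraph.equality ext)
    show "verts (contract (concat_graph \<Gamma> \<Gamma>') (concat_graph \<gamma> \<gamma>') (\<lambda>C. if C \<in> pi0 \<gamma> then j C else j' C)) =
      verts (concat_graph (contract \<Gamma> \<gamma> j) (contract \<Gamma>' \<gamma>' j'))"
      by (simp add: pi0_concat[OF cs(6) cs'(6) djg] image_Un)
    show "hedges (contract (concat_graph \<Gamma> \<Gamma>') (concat_graph \<gamma> \<gamma>') (\<lambda>C. if C \<in> pi0 \<gamma> then j C else j' C)) =
      hedges (concat_graph (contract \<Gamma> \<gamma> j) (contract \<Gamma>' \<gamma>' j'))"
      using rs(1) by (auto simp: cs cs')
    show "vindex (contract (concat_graph \<Gamma> \<Gamma>') (concat_graph \<gamma> \<gamma>') (\<lambda>C. if C \<in> pi0 \<gamma> then j C else j' C)) v =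
      vindex (concat_graph (contract \<Gamma> \<gamma> j) (contract \<Gamma>' \<gamma>' j')) v" for v
    proof (cases "v \<in> Min ` (pi0 \<gamma> \<union> pi0 \<gamma>')")
      case True
      then consider A where "A \<in> pi0 \<gamma>" "v = Min A" | A where "A \<in> pi0 \<gamma>'" "v = Min A" by auto
      then show ?thesis
      proof cases
        case 1
        then show ?thesis using v[OF 1(1)] by (simp add: pi0_concat[OF cs(6) cs'(6) djg] c image_Un)
      next
        case 2
        then have "v \<notin> Min ` pi0 \<gamma>" using vv[OF _ 2(1)] by (metis imageE)
        then show ?thesis using v'[OF 2(1)] 2 by (simp add: pi0_concat[OF cs(6) cs'(6) djg] c' image_Un)
      qed
    next
      case False
      then show ?thesis by (auto simp: pi0_concat[OF cs(6) cs'(6) djg] image_Un)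
    qed
  qed (use rs(1) bdry_verts[OF gr] bdry_verts[OF gr'] in \<open>auto simp: cs cs' c c' restrict_def\<close>)
qed

subsection \<open>Specified covering subgraphs\<close>

text \<open>The index set of the full coproduct, the whole graph and the skeleton included. Unlike
  \<open>proper_subs\<close>, it is multiplicative under concatenation.\<close>

definition spec_subs ::
  "'t qft \<Rightarrow> ('v::linorder, 'e, 't) sgraph \<Rightarrow> ('v, 'e, 't) sgraph set" where
  "spec_subs T s = {u. spec_subgraph T u s \<and> specified_graph T (spec_contract s u)}"

definition skeleton_spec :: "('v, 'e, 't) fgraph \<Rightarrow> ('v, 'e, 't) sgraph" where
  "skeleton_spec \<Gamma> = (skeleton \<Gamma>, \<lambda>C\<in>pi0 (skeleton \<Gamma>). vindex \<Gamma> (the_elem C))"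

lemma spec_contract_eq:
  "spec_contract (\<Gamma>, i) (\<gamma>, j) =
    (contract \<Gamma> \<gamma> j, \<lambda>C\<in>pi0 (contract \<Gamma> \<gamma> j). i (comp_of \<Gamma> (Min C)))"
  by (simp add: spec_contract_def)

lemma spec_subgraph_eq:
  "spec_subgraph T (\<gamma>, j) (\<Gamma>, i) \<longleftrightarrow> specified_graph T (\<gamma>, j) \<and> specified_graph T (\<Gamma>, i) \<and>
    covering_subgraph \<gamma> \<Gamma> \<and> (\<forall>C\<in>pi0 \<gamma> \<inter> pi0 \<Gamma>. induced \<gamma> C = induced \<Gamma> C \<longrightarrow> j C = i C)"
  by (simp add: spec_subgraph_def)

lemma spec_subgraph_covering: "spec_subgraph T u s \<Longrightarrow> covering_subgraph (fst u) (fst s)"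
  by (cases u; cases s) (simp add: spec_subgraph_eq)

text \<open>There are finitely many components, and \<open>wf_qft\<close> allows finitely many
  refinements of each residue type. A sum over an infinite set would be zero by convention, hence
  the need for this.\<close>

lemma finite_specifications:
  assumes wf: "wf_qft T" and gr: "graph \<gamma>"
  shows "finite {j. specified_graph T (\<gamma>, j)}"
proof (rule finite_subset)
  show "{j. specified_graph T (\<gamma>, j)} \<subseteq>
    (\<Pi>\<^sub>E C\<in>pi0 \<gamma>. {k. residue_type \<gamma> C \<in> vtypes T \<and> (residue_type \<gamma> C, k) \<in> rtypes T})"
    by (simp add: subset_iff specified_iff specified_component_def PiE_iff)
  have "finite {k. t \<in> vtypes T \<and> (t, k) \<in> rtypes T}" for t
    using wf by (cases "t \<in> vtypes T") (auto simp: wf_qft_def)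
  then show "finite (\<Pi>\<^sub>E C\<in>pi0 \<gamma>. {k. residue_type \<gamma> C \<in> vtypes T \<and> (residue_type \<gamma> C, k) \<in> rtypes T})"
    by (intro finite_PiE finite_pi0[OF gr]) auto
qed

lemma finite_spec_subs:
  assumes wf: "wf_qft T" and gr: "graph (fst s)"
  shows "finite (spec_subs T s)"
proof (rule finite_subset)
  let ?G = "cut (fst s) ` Pow (internal (fst s))"
  show "spec_subs T s \<subseteq> (SIGMA \<gamma>:?G. {j. specified_graph T (\<gamma>, j)})"
    by (cases s) (auto simp: spec_subs_def spec_subgraph_eq covering_subgraph_def)
  show "finite (SIGMA \<gamma>:?G. {j. specified_graph T (\<gamma>, j)})"
    using finite_internal[OF gr] graph_cut[OF gr] finite_specifications[OF wf]
    by (intro finite_SigmaI) auto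
qed

text \<open>The contraction has no internal edges, so its only candidate specification is given by
  the vertex indices; these are the values of i, which is also what \<open>spec_contract\<close>
  transports.\<close>

lemma spec_contract_self_specified:
  assumes wf: "wf_qft T" and sp: "specified_graph T (\<Gamma>, i)"
  shows "specified_graph T (spec_contract (\<Gamma>, i) (\<Gamma>, i))"
proof -
  have gr: "graph \<Gamma>" by (rule specified_graph_graph[OF sp])
  note cov = covering_refl[OF gr]
  let ?q = "contract \<Gamma> \<Gamma> i"
  have gq: "graph ?q" by (rule graph_contract[OF gr cov])
  have "i (comp_of \<Gamma> (Min D)) = vindex ?q (the_elem D)" if D: "D \<in> pi0 ?q" for D
  proof -
    obtain C where "C \<in> pi0 \<Gamma>" "D = {Min C}"
      using D pi0_internal_empty[OF gq internal_contract_self] by auto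
    then show ?thesis using comp_of_Min[OF gr] by simp
  qed
  then have "(\<lambda>D\<in>pi0 ?q. i (comp_of \<Gamma> (Min D))) = (\<lambda>D\<in>pi0 ?q. vindex ?q (the_elem D))"
    by (intro restrict_ext) auto
  moreover have "graph_in T ?q"
    using graph_in_contract[OF gr cov _ sp] sp by (simp add: specified_iff)
  ultimately show ?thesis
    unfolding spec_contract_eq specified_internal_empty[OF wf internal_contract_self] by blast
qed

lemma self_in_spec_subs:
  assumes "wf_qft T" "specified_graph T s"
  shows "s \<in> spec_subs T s"
proof (cases s)
  case (Pair \<Gamma> i)
  then show ?thesis
    using assms spec_contract_self_specified[OF assms(1), of \<Gamma> i] covering_refl[OF specified_graph_graph]
    by (auto simp: spec_subs_def spec_subgraph_eq)
qed

lemma spec_contract_skeleton: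
  fixes \<Gamma> :: "('v::linorder, 'e, 't) fgraph"
  assumes gr: "graph \<Gamma>" and i: "i \<in> extensional (pi0 \<Gamma>)"
  shows "spec_contract (\<Gamma>, i) (skeleton_spec \<Gamma>) = (\<Gamma>, i)"
  unfolding skeleton_spec_def spec_contract_eq contract_skeleton[OF gr]
  using i comp_of_Min[OF gr] by (auto simp: fun_eq_iff extensional_def)

lemma specified_skeleton:
  assumes wf: "wf_qft T" and gi: "graph_in T \<Gamma>"
  shows "specified_graph T (skeleton \<Gamma>, j) \<longleftrightarrow> (skeleton \<Gamma>, j) = skeleton_spec \<Gamma>"
proof -
  have gr: "graph \<Gamma>" using gi by (simp add: graph_in_def)
  have "vtype (skeleton \<Gamma>) v = vtype \<Gamma> v" for v by (simp add: vtype_def star_def)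
  then have "graph_in T (skeleton \<Gamma>)"
    using gi graph_covering[OF gr skeleton_covering] skeleton_sigma[OF gr]
    by (simp add: graph_in_def)
  then show ?thesis
    by (simp add: specified_internal_empty[OF wf internal_skeleton[OF gr]] skeleton_spec_def)
qed

lemma skeleton_in_spec_subs:
  assumes wf: "wf_qft T" and sp: "specified_graph T s"
  shows "skeleton_spec (fst s) \<in> spec_subs T s"
proof (cases s)
  case (Pair \<Gamma> i)
  have gr: "graph \<Gamma>" and gi: "graph_in T \<Gamma>" and i: "i \<in> extensional (pi0 \<Gamma>)"
    using sp Pair by (auto simp: specified_iff graph_in_def)
  have sk: "specified_graph T (skeleton_spec \<Gamma>)"
    using specified_skeleton[OF wf gi] by (simp add: skeleton_spec_def)
  \<comment> \<open>A component shared by the skeleton and \<Gamma> has no internal edges, and there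
    i is forced to be the vertex index.\<close>
  have "(\<lambda>C\<in>pi0 (skeleton \<Gamma>). vindex \<Gamma> (the_elem C)) C = i C"
    if C: "C \<in> pi0 (skeleton \<Gamma>)" "C \<in> pi0 \<Gamma>" "induced (skeleton \<Gamma>) C = induced \<Gamma> C" for C
  proof -
    have gs: "graph (skeleton \<Gamma>)" by (rule graph_covering[OF gr skeleton_covering])
    obtain v where v: "C = {v}"
      using C(1) pi0_internal_empty[OF gs internal_skeleton[OF gr]] by auto
    have "internal (induced (skeleton \<Gamma>) C) = {}"
      using skeleton_sigma[OF gr] by (auto simp: internal_empty_iff)
    then have "i C = vindex \<Gamma> v"
      using sp Pair C(2,3) v by (auto simp: specified_iff specified_component_def)
    then show ?thesis using C(1) v by simp
  qed
  then show ?thesis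
    using sk sp Pair spec_contract_skeleton[OF gr i] skeleton_covering[of \<Gamma>]
    unfolding spec_subs_def by (auto simp: skeleton_spec_def spec_subgraph_eq)
qed

text \<open>Every component is shared, so the agreement condition determines the specification
  everywhere.\<close>

lemma spec_subs_whole:
  assumes u: "u \<in> spec_subs T s" and eq: "fst u = fst s"
  shows "u = s"
proof -
  obtain \<Gamma> i j where s: "s = (\<Gamma>, i)" "u = (\<Gamma>, j)" using eq by (metis prod.collapse)
  have "\<forall>C\<in>pi0 \<Gamma>. j C = i C"
    using u unfolding s spec_subs_def mem_Collect_eq spec_subgraph_eq by simp
  moreover have "j \<in> extensional (pi0 \<Gamma>)" "i \<in> extensional (pi0 \<Gamma>)"
    using u unfolding s spec_subs_def mem_Collect_eq spec_subgraph_eq specified_iff by auto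
  ultimately have "j = i" using extensionalityI by blast
  then show ?thesis using s by simp
qed

text \<open>The definition excludes subgraphs by their underlying graph. This amounts to excluding
  two elements, because the whole graph and the skeleton each carry a single admissible
  specification.\<close>

lemma proper_subs_eq:
  assumes wf: "wf_qft T" and sp: "specified_graph T s"
  shows "proper_subs T s = spec_subs T s - {s, skeleton_spec (fst s)}"
proof -
  have "u = skeleton_spec (fst s)" if "u \<in> spec_subs T s" "fst u = skeleton (fst s)" for u
  proof -
    have "specified_graph T (skeleton (fst s), snd u)"
      using that by (cases u; cases s) (simp add: spec_subs_def spec_subgraph_eq)
    then show ?thesis
      using specified_skeleton[OF wf, of "fst s" "snd u"] that sp
      by (cases u; cases s) (simp add: specified_iff)
  qed
  moreover have "fst (skeleton_spec (fst s)) = skeleton (fst s)" by (simp add: skeleton_spec_def)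
  moreover have "proper_subs T s = {u \<in> spec_subs T s. fst u \<noteq> fst s \<and> fst u \<noteq> skeleton (fst s)}"
    by (auto simp: proper_subs_def proper_spec_subgraph_def spec_subs_def)
  ultimately show ?thesis using spec_subs_whole[of _ T s] by blast
qed

lemma card_internal_spec_subs_less:
  assumes u: "u \<in> spec_subs T s" and "u \<noteq> s"
  shows "card (internal (fst u)) < card (internal (fst s))"
proof -
  have gr: "graph (fst s)" and cov: "covering_subgraph (fst u) (fst s)"
    using u spec_subgraph_covering[of T u s] by (cases s; cases u; force simp: spec_subs_def spec_subgraph_eq specified_iff graph_in_def)+
  have ne: "fst u \<noteq> fst s" using spec_subs_whole u assms(2) by blast
  obtain S where S: "S \<subseteq> internal (fst s)" "fst u = cut (fst s) S"
    using cov by (auto simp: covering_subgraph_def)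
  then obtain d where d: "d \<in> S" using ne by (fastforce simp: cut_def)
  then have "d \<in> internal (fst s) - internal (fst u)"
    using S Union_internal_iff[OF gr subset_refl] by (auto simp: internal_def)
  then have "internal (fst u) \<subset> internal (fst s)"
    using internal_covering[OF gr cov] by blast
  then show ?thesis using finite_internal[OF gr] psubset_card_mono by blast
qed

context
  fixes \<Gamma> \<Gamma>' :: "('v::linorder, 'e, 't) fgraph"
  assumes gr: "graph \<Gamma>" and gr': "graph \<Gamma>'" and dj: "disjoint_graphs \<Gamma> \<Gamma>'"
begin

lemma disjoint_contract:
  assumes "covering_subgraph \<gamma> \<Gamma>" "covering_subgraph \<gamma>' \<Gamma>'"
  shows "disjoint_graphs (contract \<Gamma> \<gamma> j) (contract \<Gamma>' \<gamma>' j')"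
  using verts_contract_subset[OF gr assms(1), of j] verts_contract_subset[OF gr' assms(2), of j'] dj
  by (auto simp: disjoint_graphs_def)

lemma spec_contract_concat:
  assumes cov: "covering_subgraph \<gamma> \<Gamma>" and cov': "covering_subgraph \<gamma>' \<Gamma>'"
  shows "spec_contract (concat_spec (\<Gamma>, i) (\<Gamma>', i')) (concat_spec (\<gamma>, j) (\<gamma>', j')) =
    concat_spec (spec_contract (\<Gamma>, i) (\<gamma>, j)) (spec_contract (\<Gamma>', i') (\<gamma>', j'))"
proof -
  let ?q = "contract \<Gamma> \<gamma> j" and ?q' = "contract \<Gamma>' \<gamma>' j'"
  note gq = graph_contract[OF gr cov, of j] and gq' = graph_contract[OF gr' cov', of j']
  note p = pi0_concat[OF gq gq' disjoint_contract[OF cov cov']]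
  have in_pi0: "Min D \<in> verts \<Gamma>" "comp_of \<Gamma> (Min D) \<in> pi0 \<Gamma>" if "D \<in> pi0 ?q" for D
    using that Min_component[OF gq that] pi0_subset[OF gq that] verts_contract_subset[OF gr cov, of j]
      component_contract(1)[OF gr cov that] by auto
  have in_pi0': "Min D \<in> verts \<Gamma>'" "comp_of \<Gamma>' (Min D) \<notin> pi0 \<Gamma>" if "D \<in> pi0 ?q'" for D
    using that Min_component[OF gq' that] pi0_subset[OF gq' that] verts_contract_subset[OF gr' cov', of j']
      component_contract(1)[OF gr' cov' that] pi0_disjoint[OF gr gr' dj] by auto
  have "D \<notin> pi0 ?q" if "D \<in> pi0 ?q'" for D
    using that pi0_disjoint[OF gq gq' disjoint_contract[OF cov cov']] by auto
  then show ?thesis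
    unfolding concat_spec_def fst_conv snd_conv spec_contract_eq contract_concat[OF gr gr' dj cov cov'] p
    using in_pi0 in_pi0' comp_of_concat[OF gr gr' dj]
    by (auto simp del: contract_simps simp: fun_eq_iff restrict_def)
qed

lemma spec_subgraph_concat:
  assumes cov: "covering_subgraph \<gamma> \<Gamma>" and cov': "covering_subgraph \<gamma>' \<Gamma>'"
    and i: "i \<in> extensional (pi0 \<Gamma>)" "i' \<in> extensional (pi0 \<Gamma>')"
    and j: "j \<in> extensional (pi0 \<gamma>)" "j' \<in> extensional (pi0 \<gamma>')"
  shows "spec_subgraph T (concat_spec (\<gamma>, j) (\<gamma>', j')) (concat_spec (\<Gamma>, i) (\<Gamma>', i')) \<longleftrightarrow>
    spec_subgraph T (\<gamma>, j) (\<Gamma>, i) \<and> spec_subgraph T (\<gamma>', j') (\<Gamma>', i')"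
proof -
  note cs = covering_simps[OF gr cov] and cs' = covering_simps[OF gr' cov']
  have djg: "disjoint_graphs \<gamma> \<gamma>'" using dj cs cs' by (simp add: disjoint_graphs_def)
  have mix: "pi0 \<gamma> \<inter> pi0 \<Gamma>' = {}" "pi0 \<gamma>' \<inter> pi0 \<Gamma> = {}"
    using pi0_disjoint[OF cs(6) gr'] pi0_disjoint[OF gr cs'(6)] dj cs cs'
    by (auto simp: disjoint_graphs_def)
  let ?A = "\<lambda>C. induced \<gamma> C = induced \<Gamma> C \<longrightarrow> j C = i C"
  let ?A' = "\<lambda>C. induced \<gamma>' C = induced \<Gamma>' C \<longrightarrow> j' C = i' C"
  let ?B = "\<lambda>C. induced (concat_graph \<gamma> \<gamma>') C = induced (concat_graph \<Gamma> \<Gamma>') C \<longrightarrow>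
     (if C \<in> pi0 \<gamma> then j C else j' C) = (if C \<in> pi0 \<Gamma> then i C else i' C)"
  have l: "?B C \<longleftrightarrow> ?A C" if "C \<in> pi0 \<gamma>" "C \<in> pi0 \<Gamma>" for C
    using that induced_concat_left[OF gr gr' dj pi0_subset[OF gr that(2)]]
      induced_concat_left[OF cs(6) cs'(6) djg pi0_subset[OF cs(6) that(1)]] by simp
  have r: "?B C \<longleftrightarrow> ?A' C" if "C \<in> pi0 \<gamma>'" "C \<in> pi0 \<Gamma>'" for C
    using that mix induced_concat_right[OF gr gr' dj pi0_subset[OF gr' that(2)]]
      induced_concat_right[OF cs(6) cs'(6) djg pi0_subset[OF cs'(6) that(1)]] by auto
  have mixed: "(pi0 \<gamma> \<union> pi0 \<gamma>') \<inter> (pi0 \<Gamma> \<union> pi0 \<Gamma>') = (pi0 \<gamma> \<inter> pi0 \<Gamma>) \<union> (pi0 \<gamma>' \<inter> pi0 \<Gamma>')"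
    using mix by blast
  have "(\<forall>C\<in>(pi0 \<gamma> \<union> pi0 \<gamma>') \<inter> (pi0 \<Gamma> \<union> pi0 \<Gamma>'). ?B C) \<longleftrightarrow>
      (\<forall>C\<in>pi0 \<gamma> \<inter> pi0 \<Gamma>. ?A C) \<and> (\<forall>C\<in>pi0 \<gamma>' \<inter> pi0 \<Gamma>'. ?A' C)"
  proof -
    have "(\<forall>C\<in>pi0 \<gamma> \<inter> pi0 \<Gamma>. ?B C) \<longleftrightarrow> (\<forall>C\<in>pi0 \<gamma> \<inter> pi0 \<Gamma>. ?A C)"
      by (rule ball_cong[OF refl], erule IntE, rule l)
    moreover have "(\<forall>C\<in>pi0 \<gamma>' \<inter> pi0 \<Gamma>'. ?B C) \<longleftrightarrow> (\<forall>C\<in>pi0 \<gamma>' \<inter> pi0 \<Gamma>'. ?A' C)"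
      by (rule ball_cong[OF refl], erule IntE, rule r)
    ultimately show ?thesis
      unfolding mixed ball_Un
      by (rule arg_cong2[where f = "(\<and>)"])
  qed
  moreover have "specified_graph T (concat_spec (\<gamma>, j) (\<gamma>', j')) \<longleftrightarrow>
      specified_graph T (\<gamma>, j) \<and> specified_graph T (\<gamma>', j')"
    by (rule specified_concat_iff[OF cs(6) cs'(6) djg j])
  moreover have "specified_graph T (concat_spec (\<Gamma>, i) (\<Gamma>', i')) \<longleftrightarrow>
      specified_graph T (\<Gamma>, i) \<and> specified_graph T (\<Gamma>', i')"
    by (rule specified_concat_iff[OF gr gr' dj i])
  ultimately show ?thesis
    using cov cov' covering_concat[OF gr gr' dj cov cov']
    unfolding concat_spec_def fst_conv snd_conv spec_subgraph_eq
      pi0_concat[OF gr gr' dj] pi0_concat[OF cs(6) cs'(6) djg] by blast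
qed

text \<open>This bijection is the multiplicativity of the coproduct. The factors of a pair are
  recovered by restriction to the vertices of \<Gamma> and of \<Gamma>'; every subgraph of the
  concatenation splits because none of its edges crosses.\<close>

lemma spec_subs_concat:
  assumes sp: "specified_graph T (\<Gamma>, i)" and sp': "specified_graph T (\<Gamma>', i')"
  shows "bij_betw (\<lambda>(u, u'). concat_spec u u') (spec_subs T (\<Gamma>, i) \<times> spec_subs T (\<Gamma>', i'))
    (spec_subs T (concat_spec (\<Gamma>, i) (\<Gamma>', i')))"
proof -
  have i: "i \<in> extensional (pi0 \<Gamma>)" "i' \<in> extensional (pi0 \<Gamma>')"
    using sp sp' by (auto simp: specified_iff)
  have iff: "concat_spec (\<gamma>, j) (\<gamma>', j') \<in> spec_subs T (concat_spec (\<Gamma>, i) (\<Gamma>', i')) \<longleftrightarrow>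
      (\<gamma>, j) \<in> spec_subs T (\<Gamma>, i) \<and> (\<gamma>', j') \<in> spec_subs T (\<Gamma>', i')"
    if cov: "covering_subgraph \<gamma> \<Gamma>" "covering_subgraph \<gamma>' \<Gamma>'"
      and j: "j \<in> extensional (pi0 \<gamma>)" "j' \<in> extensional (pi0 \<gamma>')" for \<gamma> \<gamma>' j j'
    using spec_subgraph_concat[OF cov i j]
      specified_concat_iff[OF graph_contract[OF gr cov(1)] graph_contract[OF gr' cov(2)]
        disjoint_contract[OF cov] restrict_extensional restrict_extensional]
    unfolding spec_subs_def mem_Collect_eq spec_contract_concat[OF cov] spec_contract_eq by blast
  have ext: "covering_subgraph \<gamma> \<Delta>" "j \<in> extensional (pi0 \<gamma>)"
    if "(\<gamma>, j) \<in> spec_subs T (\<Delta>, k)" for \<gamma> j k and \<Delta> :: "('v, 'e, 't) fgraph"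
    using that by (auto simp: spec_subs_def spec_subgraph_eq specified_iff)
  have left: "\<gamma> = induced (concat_graph \<gamma> \<gamma>') (verts \<Gamma>) \<and> \<gamma>' = induced (concat_graph \<gamma> \<gamma>') (verts \<Gamma>')"
    if cov: "covering_subgraph \<gamma> \<Gamma>" "covering_subgraph \<gamma>' \<Gamma>'" for \<gamma> \<gamma>'
  proof -
    have "disjoint_graphs \<gamma> \<gamma>'"
      using dj covering_simps[OF gr cov(1)] covering_simps[OF gr' cov(2)] by (simp add: disjoint_graphs_def)
    then show ?thesis
      using induced_concat[of \<gamma> \<gamma>'] covering_simps[OF gr cov(1)] covering_simps[OF gr' cov(2)] by metis
  qed
  show ?thesis
    unfolding bij_betw_def
  proof (intro conjI inj_onI)
    fix a b
    assume a: "a \<in> spec_subs T (\<Gamma>, i) \<times> spec_subs T (\<Gamma>', i')"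
      and b: "b \<in> spec_subs T (\<Gamma>, i) \<times> spec_subs T (\<Gamma>', i')"
      and eq: "(case a of (u, u') \<Rightarrow> concat_spec u u') = (case b of (u, u') \<Rightarrow> concat_spec u u')"
    obtain \<gamma> j \<gamma>' j' \<delta> k \<delta>' k' where ab: "a = ((\<gamma>, j), (\<gamma>', j'))" "b = ((\<delta>, k), (\<delta>', k'))"
      by (metis surj_pair)
    have cov: "covering_subgraph \<gamma> \<Gamma>" "covering_subgraph \<gamma>' \<Gamma>'" "covering_subgraph \<delta> \<Gamma>" "covering_subgraph \<delta>' \<Gamma>'"
      and e: "j \<in> extensional (pi0 \<gamma>)" "j' \<in> extensional (pi0 \<gamma>')"
        "k \<in> extensional (pi0 \<delta>)" "k' \<in> extensional (pi0 \<delta>')"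
      using a b ext unfolding ab by auto
    have g: "concat_graph \<gamma> \<gamma>' = concat_graph \<delta> \<delta>'"
      using eq by (simp add: ab concat_spec_def)
    then have gd: "\<gamma> = \<delta>" "\<gamma>' = \<delta>'" using left[OF cov(1,2)] left[OF cov(3,4)] by metis+
    have jk: "(if C \<in> pi0 \<gamma> then j C else j' C) = (if C \<in> pi0 \<delta> then k C else k' C)" for C
    proof -
      have "snd (concat_spec (\<gamma>, j) (\<gamma>', j')) C = snd (concat_spec (\<delta>, k) (\<delta>', k')) C"
        using eq by (simp add: ab)
      then show ?thesis unfolding concat_spec_def fst_conv snd_conv .
    qed
    have "pi0 \<gamma> \<inter> pi0 \<gamma>' = {}"
      using pi0_disjoint[of \<gamma> \<gamma>'] dj covering_simps[OF gr cov(1)] covering_simps[OF gr' cov(2)]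
      by (simp add: disjoint_graphs_def)
    then have "j C = k C \<and> j' C = k' C" for C
      using jk[of C] e unfolding gd
      by (cases "C \<in> pi0 \<delta>"; cases "C \<in> pi0 \<delta>'") (auto simp: extensional_def)
    then have "j = k" "j' = k'" by auto
    then show "a = b" by (simp add: ab gd)
  next
    show "(\<lambda>(u, u'). concat_spec u u') ` (spec_subs T (\<Gamma>, i) \<times> spec_subs T (\<Gamma>', i')) =
      spec_subs T (concat_spec (\<Gamma>, i) (\<Gamma>', i'))"
    proof (intro equalityI subsetI)
      fix x
      assume "x \<in> (\<lambda>(u, u'). concat_spec u u') ` (spec_subs T (\<Gamma>, i) \<times> spec_subs T (\<Gamma>', i'))"
      then obtain \<gamma> j \<gamma>' j' where "x = concat_spec (\<gamma>, j) (\<gamma>', j')"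
        "(\<gamma>, j) \<in> spec_subs T (\<Gamma>, i)" "(\<gamma>', j') \<in> spec_subs T (\<Gamma>', i')" by auto
      then show "x \<in> spec_subs T (concat_spec (\<Gamma>, i) (\<Gamma>', i'))"
        using iff[of \<gamma> \<gamma>' j j'] ext[of \<gamma> j] ext[of \<gamma>' j'] by simp
    next
      fix x
      assume x: "x \<in> spec_subs T (concat_spec (\<Gamma>, i) (\<Gamma>', i'))"
      obtain \<delta> k where \<delta>: "x = (\<delta>, k)" by (metis surj_pair)
      then have c: "covering_subgraph \<delta> (concat_graph \<Gamma> \<Gamma>')" and k: "k \<in> extensional (pi0 \<delta>)"
        using x ext by (auto simp: concat_spec_def)
      obtain \<gamma> \<gamma>' where cov: "covering_subgraph \<gamma> \<Gamma>" "covering_subgraph \<gamma>' \<Gamma>'" "\<delta> = concat_graph \<gamma> \<gamma>'"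
        using covering_concat_cases[OF gr gr' dj c] .
      have "pi0 \<delta> = pi0 \<gamma> \<union> pi0 \<gamma>'"
        unfolding cov(3) using pi0_concat[of \<gamma> \<gamma>'] dj covering_simps[OF gr cov(1)] covering_simps[OF gr' cov(2)]
        by (simp add: disjoint_graphs_def)
      \<comment> \<open>The specification k is cut into its restrictions to the components of
        \<gamma> and of \<gamma>'; being extensional, it is determined by them.\<close>
      then have xe: "x = concat_spec (\<gamma>, restrict k (pi0 \<gamma>)) (\<gamma>', restrict k (pi0 \<gamma>'))"
        using k by (auto simp: \<delta> cov(3) concat_spec_def fun_eq_iff restrict_def extensional_def)
      then show "x \<in> (\<lambda>(u, u'). concat_spec u u') ` (spec_subs T (\<Gamma>, i) \<times> spec_subs T (\<Gamma>', i'))"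
        using x iff[OF cov(1,2) restrict_extensional restrict_extensional, of k k] unfolding xe
        by (intro image_eqI[where x = "((\<gamma>, restrict k (pi0 \<gamma>)), (\<gamma>', restrict k (pi0 \<gamma>')))"])
          (simp_all only: prod.case mem_Times_iff fst_conv snd_conv)
    qed
  qed
qed

end

subsection \<open>Momentum spaces\<close>

lemma mom_restrict_line:
  "mom_restrict E (\<lambda>e. p e + t *\<^sub>R q e) = (\<lambda>e. mom_restrict E p e + t *\<^sub>R mom_restrict E q e)"
  by (auto simp: mom_restrict_def)

lemma continuous_on_mom_restrict: "continuous_on X (mom_restrict E)"
proof (rule continuous_on_coordinatewise_then_product)
  fix e
  have "continuous_on X (\<lambda>p. p e)"
    by (rule continuous_on_subset[OF continuous_on_product_coordinates]) simp
  then show "continuous_on X (\<lambda>p. mom_restrict E p e)"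
    by (cases "e \<in> E") (auto simp: mom_restrict_def)
qed

lemma mom_restrict_mom_restrict: "E \<subseteq> F \<Longrightarrow> mom_restrict E (mom_restrict F p) = mom_restrict E p"
  by (auto simp: mom_restrict_def fun_eq_iff)

lemma W_line:
  assumes "p \<in> W \<Gamma>" "q \<in> W \<Gamma>"
  shows "(\<lambda>e. p e + t *\<^sub>R q e) \<in> W \<Gamma>"
proof -
  have "p e + t *\<^sub>R q e + (p e' + t *\<^sub>R q e') = 0" if "p e + p e' = 0" "q e + q e' = 0" for e e'
  proof -
    have "p e + t *\<^sub>R q e + (p e' + t *\<^sub>R q e') = (p e + p e') + t *\<^sub>R (q e + q e')"
      by (simp add: scaleR_right_distrib)
    then show ?thesis using that by simp
  qed
  then show ?thesis
    using assms by (simp add: W_def sum.distrib flip: scaleR_right.sum)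
qed

lemma mom_restrict_W: "p \<in> W \<Gamma> \<Longrightarrow> mom_restrict (hedges \<Gamma>) p = p"
  by (auto simp: W_def mom_restrict_def)

lemma star_induced: "v \<in> U \<Longrightarrow> star (induced \<Gamma> U) v = star \<Gamma> v"
  by (auto simp: star_def)

lemma W_induced:
  assumes gr: "graph \<Gamma>" and cl: "closed_in \<Gamma> U" and p: "p \<in> W \<Gamma>"
  shows "mom_restrict (hedges (induced \<Gamma> U)) p \<in> W (induced \<Gamma> U)"
proof -
  have "(\<Sum>e\<in>star \<Gamma> v. mom_restrict (hedges (induced \<Gamma> U)) p e) = (\<Sum>e\<in>star \<Gamma> v. p e)" if "v \<in> U" for v
    using that by (intro sum.cong) (auto simp: mom_restrict_def star_def)
  then show ?thesis
    using p closed_in_sigma[OF gr cl] sigma_hedges[OF gr]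
    by (auto simp: W_def star_induced mom_restrict_def)
qed

text \<open>Momenta vanish off their graph, so a momentum on part of \<Gamma> is already extended by
  zero. No edge leaves U, hence the extension satisfies all conservation laws.\<close>

lemma W_induced_subset:
  assumes gr: "graph \<Gamma>" and cl: "closed_in \<Gamma> U"
  shows "W (induced \<Gamma> U) \<subseteq> W \<Gamma>"
proof
  fix p :: "('b, 'd::finite) mom"
  assume p: "p \<in> W (induced \<Gamma> U)"
  then have z: "p e = 0" if "\<not> (e \<in> hedges \<Gamma> \<and> bdry \<Gamma> e \<in> U)" for e
    using that by (auto simp: W_def)
  have "(\<Sum>e\<in>star \<Gamma> v. p e) = 0" if "v \<in> verts \<Gamma>" for v
  proof (cases "v \<in> U")
    case True
    then have "(\<Sum>e\<in>star (induced \<Gamma> U) v. p e) = 0"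
      using p that by (auto simp: W_def)
    then show ?thesis using star_induced[OF True, of \<Gamma>] by simp
  next
    case False
    then show ?thesis by (intro sum.neutral) (auto simp: star_def z)
  qed
  moreover have "p e + p (sigma \<Gamma> e) = 0" if "e \<in> hedges \<Gamma>" "e \<noteq> sigma \<Gamma> e" for e
    using that p z[of e] z[of "sigma \<Gamma> e"] closed_in_sigma[OF gr cl that(1)]
    by (cases "bdry \<Gamma> e \<in> U") (auto simp: W_def)
  ultimately show "p \<in> W \<Gamma>" using z by (auto simp: W_def)
qed

lemma W_covering: "graph \<Gamma> \<Longrightarrow> covering_subgraph \<gamma> \<Gamma> \<Longrightarrow> W \<Gamma> \<subseteq> W \<gamma>"
  unfolding covering_iff W_def star_def by auto

text \<open>Conservation at a contracted vertex is the sum of the conservation laws at the vertices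
  of its component A: the internal edges of \<gamma> in A cancel, and only the half-edges kept by
  the contraction remain.\<close>

lemma W_contract:
  fixes \<Gamma> \<gamma> :: "('v::linorder, 'e, 't) fgraph" and p :: "('e, 'd::finite) mom"
  assumes gr: "graph \<Gamma>" and cov: "covering_subgraph \<gamma> \<Gamma>" and p: "p \<in> W \<Gamma>"
  shows "mom_restrict (hedges (contract \<Gamma> \<gamma> j)) p \<in> W (contract \<Gamma> \<gamma> j)"
proof -
  let ?q = "contract \<Gamma> \<gamma> j"
  note cs = covering_simps[OF gr cov]
  have "(\<Sum>e\<in>star ?q v. mom_restrict (hedges ?q) p e) = 0" if v: "v \<in> verts ?q" for v
  proof -
    obtain A where A: "A \<in> pi0 \<gamma>" "v = Min A" using v by auto
    let ?E = "{e \<in> hedges \<Gamma>. bdry \<Gamma> e \<in> A}"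
    let ?X = "{e \<in> ?E. sigma \<gamma> e = e}" and ?Y = "{e \<in> ?E. sigma \<gamma> e \<noteq> e}"
    have "Min (comp_of \<gamma> w) = Min A \<longleftrightarrow> w \<in> A" if "w \<in> verts \<Gamma>" for w
      using comp_of_Min[OF cs(6) A(1)] comp_of_Min[OF cs(6) comp_of_pi0[OF cs(6)], of w] that cs
        self_in_comp_of[OF cs(6)] comp_of_eq[OF cs(6) A(1)] by metis
    then have star: "star ?q v = ?X"
      using bdry_verts[OF gr] by (auto simp: star_def A(2))
    have "(\<Sum>e\<in>?E. p e) = (\<Sum>w\<in>A. \<Sum>e\<in>star \<Gamma> w. p e)"
    proof -
      have "?E = (\<Union>w\<in>A. star \<Gamma> w)" by (auto simp: star_def)
      then show ?thesis
        using finite_component[OF cs(6) A(1)] finite_hedges[OF gr]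
        by (simp add: sum.UNION_disjoint star_def disjoint_iff)
    qed
    also have "\<dots> = 0"
      using p pi0_subset[OF cs(6) A(1)] cs(1) by (intro sum.neutral) (auto simp: W_def)
    finally have E: "(\<Sum>e\<in>?E. p e) = 0" .
    \<comment> \<open>The involution permutes \<open>?Y\<close> and reverses momenta, so the sum
      equals its own negative. This avoids choosing one half of each edge.\<close>
    have "(\<Sum>e\<in>?Y. p e) = (\<Sum>e\<in>?Y. p (sigma \<gamma> e))"
      using sigma_hedges[OF cs(6)] sigma_sigma[OF cs(6)]
        closed_in_sigma[OF cs(6) closed_in_pi0[OF cs(6) A(1)]] cs
      by (intro sum.reindex_bij_witness[of _ "sigma \<gamma>" "sigma \<gamma>"]) auto
    also have "\<dots> = (\<Sum>e\<in>?Y. - p e)"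
    proof (rule sum.cong[OF refl])
      fix e assume e: "e \<in> ?Y"
      then have "p e + p (sigma \<gamma> e) = 0"
        using subsetD[OF W_covering[OF gr cov] p] cs by (auto simp: W_def)
      then show "p (sigma \<gamma> e) = - p e" by (simp add: eq_neg_iff_add_eq_0 add.commute)
    qed
    finally have "(\<Sum>e\<in>?Y. p e) = - (\<Sum>e\<in>?Y. p e)" by (simp only: sum_negf)
    then have "2 *\<^sub>R (\<Sum>e\<in>?Y. p e) = (\<Sum>e\<in>?Y. p e) + - (\<Sum>e\<in>?Y. p e)"
      unfolding scaleR_2 by (rule arg_cong)
    then have "(\<Sum>e\<in>?Y. p e) = 0" by simp
    moreover have "(\<Sum>e\<in>?E. p e) = (\<Sum>e\<in>?X. p e) + (\<Sum>e\<in>?Y. p e)"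
      using finite_hedges[OF gr] by (subst sum.union_disjoint[symmetric]) (auto intro: sum.cong)
    ultimately have "(\<Sum>e\<in>?X. p e) = 0" using E by simp
    moreover have "(\<Sum>e\<in>?X. mom_restrict (hedges ?q) p e) = (\<Sum>e\<in>?X. p e)"
      by (rule sum.cong) (auto simp: mom_restrict_def)
    ultimately show ?thesis unfolding star by simp
  qed
  moreover have "mom_restrict (hedges ?q) p e + mom_restrict (hedges ?q) p (sigma ?q e) = 0"
    if "e \<in> hedges ?q" "e \<noteq> sigma ?q e" for e
    using that p sigma_hedges[OF gr] covering_sigma_fixed[OF gr cov]
    by (auto simp: W_def mom_restrict_def)
  ultimately show ?thesis
    unfolding W_def mem_Collect_eq by (auto simp: mom_restrict_def simp del: contract_simps)
qed

subsection \<open>Smooth functions\<close>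

lemma C_diff_Suc: "C_diff (Suc k) X f \<Longrightarrow> C_diff k X f"
  by (induction k arbitrary: f) (auto, blast)

lemma C_diff_const: "C_diff k X (\<lambda>_. c)"
proof (induction k arbitrary: c)
  case (Suc k)
  then show ?case by (auto intro!: exI[where x = "\<lambda>_. 0"])
qed simp

lemma C_diff_add: "C_diff k X f \<Longrightarrow> C_diff k X g \<Longrightarrow> C_diff k X (\<lambda>p. f p + g p)"
proof (induction k arbitrary: f g)
  case (Suc k)
  show ?case
    unfolding C_diff.simps
  proof (intro conjI ballI)
    fix q assume "q \<in> X"
    then obtain f' g' where f': "\<forall>p\<in>X. ((\<lambda>t. f (\<lambda>e. p e + t *\<^sub>R q e)) has_vector_derivative f' p) (at 0)" "C_diff k X f'"
      and g': "\<forall>p\<in>X. ((\<lambda>t. g (\<lambda>e. p e + t *\<^sub>R q e)) has_vector_derivative g' p) (at 0)" "C_diff k X g'"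
      using Suc.prems unfolding C_diff.simps by blast
    then show "\<exists>h. (\<forall>p\<in>X. ((\<lambda>t. f (\<lambda>e. p e + t *\<^sub>R q e) + g (\<lambda>e. p e + t *\<^sub>R q e))
        has_vector_derivative h p) (at 0)) \<and> C_diff k X h"
      using Suc.IH by (intro exI[where x = "\<lambda>p. f' p + g' p"]) (auto intro: has_vector_derivative_add)
  qed (use Suc.prems in \<open>auto intro: continuous_on_add\<close>)
qed (auto intro: continuous_on_add)

text \<open>The product rule pairs each function with a derivative of the other, so both are also
  used one order lower, which \<open>C_diff_Suc\<close> provides.\<close>

lemma C_diff_mult: "C_diff k X f \<Longrightarrow> C_diff k X g \<Longrightarrow> C_diff k X (\<lambda>p. f p * g p)"
proof (induction k arbitrary: f g)
  case (Suc k)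
  show ?case
    unfolding C_diff.simps
  proof (intro conjI ballI)
    fix q assume "q \<in> X"
    then obtain f' g' where
      f': "\<forall>p\<in>X. ((\<lambda>t. f (\<lambda>e. p e + t *\<^sub>R q e)) has_vector_derivative f' p) (at 0)" "C_diff k X f'" and
      g': "\<forall>p\<in>X. ((\<lambda>t. g (\<lambda>e. p e + t *\<^sub>R q e)) has_vector_derivative g' p) (at 0)" "C_diff k X g'"
      using Suc.prems unfolding C_diff.simps by blast
    show "\<exists>h. (\<forall>p\<in>X. ((\<lambda>t. f (\<lambda>e. p e + t *\<^sub>R q e) * g (\<lambda>e. p e + t *\<^sub>R q e))
        has_vector_derivative h p) (at 0)) \<and> C_diff k X h"
    proof (intro exI[where x = "\<lambda>p. f p * g' p + f' p * g p"] conjI ballI)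
      fix p assume "p \<in> X"
      then show "((\<lambda>t. f (\<lambda>e. p e + t *\<^sub>R q e) * g (\<lambda>e. p e + t *\<^sub>R q e))
          has_vector_derivative f p * g' p + f' p * g p) (at 0)"
        using has_vector_derivative_mult[OF f'(1)[rule_format] g'(1)[rule_format], of p p] by simp
    next
      show "C_diff k X (\<lambda>p. f p * g' p + f' p * g p)"
        using C_diff_Suc[OF Suc.prems(1)] C_diff_Suc[OF Suc.prems(2)]
        by (intro C_diff_add Suc.IH f'(2) g'(2))
    qed
  qed (use Suc.prems in \<open>auto intro: continuous_on_mult\<close>)
qed (auto intro: continuous_on_mult)

text \<open>Restriction of momenta is linear and continuous: a line in direction q is carried to a
  line in the restricted direction, and derivatives pull back along it.\<close>

lemma C_diff_compose:
  assumes "\<And>p. p \<in> X \<Longrightarrow> mom_restrict E p \<in> Y"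
  shows "C_diff k Y f \<Longrightarrow> C_diff k X (\<lambda>p. f (mom_restrict E p))"
proof (induction k arbitrary: f)
  case 0
  then show ?case
    using assms by (auto intro!: continuous_on_compose2[OF _ continuous_on_mom_restrict])
next
  case (Suc k)
  show ?case
    unfolding C_diff.simps
  proof (intro conjI ballI)
    show "continuous_on X (\<lambda>p. f (mom_restrict E p))"
      using Suc.prems assms by (auto intro!: continuous_on_compose2[OF _ continuous_on_mom_restrict])
    fix q assume "q \<in> X"
    then have "mom_restrict E q \<in> Y" by (rule assms)
    then obtain f' where f': "C_diff k Y f'"
      "\<forall>p\<in>Y. ((\<lambda>t. f (\<lambda>e. p e + t *\<^sub>R mom_restrict E q e)) has_vector_derivative f' p) (at 0)"
      using Suc.prems unfolding C_diff.simps by blast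
    then show "\<exists>g. (\<forall>p\<in>X. ((\<lambda>t. f (mom_restrict E (\<lambda>e. p e + t *\<^sub>R q e)))
        has_vector_derivative g p) (at 0)) \<and> C_diff k X g"
      unfolding mom_restrict_line using Suc.IH[OF f'(1)] assms
      by (intro exI[where x = "\<lambda>p. f' (mom_restrict E p)"]) auto
  qed
qed

text \<open>Derivatives at p along q probe f only on a line, which \<open>line\<close> keeps inside
  X. Functions are extended by zero off X; this lets that case distinction be dropped.\<close>

lemma C_diff_cong:
  assumes line: "\<And>p q t. p \<in> X \<Longrightarrow> q \<in> X \<Longrightarrow> (\<lambda>e. p e + t *\<^sub>R q e) \<in> X"
    and eq: "\<And>p. p \<in> X \<Longrightarrow> f p = g p"
  shows "C_diff k X f \<longleftrightarrow> C_diff k X g"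
proof -
  have c: "continuous_on X f \<longleftrightarrow> continuous_on X g"
    using eq by (rule continuous_on_cong[OF refl])
  have "(\<lambda>t. f (\<lambda>e. p e + t *\<^sub>R q e)) = (\<lambda>t. g (\<lambda>e. p e + t *\<^sub>R q e))" if "p \<in> X" "q \<in> X" for p q
    using line[OF that] eq by auto
  then show ?thesis using c by (cases k) (simp_all cong: ball_cong)
qed

lemma C_infinity_mult:
  "f \<in> C_infinity X \<Longrightarrow> g \<in> C_infinity X \<Longrightarrow> (\<lambda>p. f p * g p) \<in> C_infinity X"
  by (simp add: C_infinity_def C_diff_mult)

lemma C_infinity_prod_compose:
  assumes line: "\<And>p q t. p \<in> X \<Longrightarrow> q \<in> X \<Longrightarrow> (\<lambda>e. p e + t *\<^sub>R q e) \<in> X"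
    and fin: "finite I"
    and f: "\<And>i. i \<in> I \<Longrightarrow> f i \<in> C_infinity (Y i)"
    and L: "\<And>i p. i \<in> I \<Longrightarrow> p \<in> X \<Longrightarrow> mom_restrict (E i) p \<in> Y i"
  shows "(\<lambda>p. if p \<in> X then \<Prod>i\<in>I. f i (mom_restrict (E i) p) else 0) \<in> C_infinity X"
proof -
  have "C_diff k X (\<lambda>p. \<Prod>i\<in>I. f i (mom_restrict (E i) p))" for k
    using fin f L
  proof (induction I rule: finite_induct)
    case (insert i I)
    then have "C_diff k X (\<lambda>p. f i (mom_restrict (E i) p))"
      by (intro C_diff_compose[where Y = "Y i"]) (auto simp: C_infinity_def)
    then show ?case using insert by (simp add: C_diff_mult)
  qed (simp add: C_diff_const)
  then have "C_diff k X (\<lambda>p. if p \<in> X then \<Prod>i\<in>I. f i (mom_restrict (E i) p) else 0)" for k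
    by (subst C_diff_cong[OF line, where g = "\<lambda>p. \<Prod>i\<in>I. f i (mom_restrict (E i) p)"]) auto
  then show ?thesis by (auto simp: C_infinity_def)
qed

subsection \<open>Tensor products over the components\<close>

definition tensor :: "('v, 'e, 't) fgraph \<Rightarrow> ('v set \<Rightarrow> ('e, 'd::finite) mom \<Rightarrow> complex) \<Rightarrow>
    ('e, 'd) mom \<Rightarrow> complex" where
  "tensor \<Gamma> v = (\<lambda>p. if p \<in> W \<Gamma>
     then \<Prod>C\<in>pi0 \<Gamma>. v C (mom_restrict (hedges (induced \<Gamma> C)) p) else 0)"

lemma V_iff:
  fixes f :: "('e, 'd::finite) mom \<Rightarrow> complex" and \<Gamma> :: "('v, 'e, 't) fgraph"
  shows "f \<in> V \<Gamma> \<longleftrightarrow> (\<exists>(n::nat) c v. (\<forall>k<n. \<forall>C\<in>pi0 \<Gamma>. v k C \<in> C_infinity (W (induced \<Gamma> C))) \<and>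
     f = (\<lambda>p. \<Sum>k<n. c k * tensor \<Gamma> (v k) p))"
proof -
  have "(\<lambda>p. if p \<in> W \<Gamma>
       then \<Sum>k<n. c k * (\<Prod>C \<in> pi0 \<Gamma>. v k C (mom_restrict (hedges (induced \<Gamma> C)) p))
       else 0) = (\<lambda>p. \<Sum>k<n. c k * tensor \<Gamma> (v k) p)"
    for n :: nat and c and v :: "nat \<Rightarrow> 'v set \<Rightarrow> ('e, 'd) mom \<Rightarrow> complex"
    by (auto simp: tensor_def)
  then show ?thesis by (simp add: V_def)
qed

lemma V_zero: "0 \<in> V \<Gamma>"
  unfolding V_iff by (intro exI[where x = 0]) (auto simp: zero_fun_def)

lemma V_scale:
  assumes "f \<in> V \<Gamma>" shows "(\<lambda>p. a * f p) \<in> V \<Gamma>"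
proof -
  obtain n :: nat and c v where nv: "\<forall>k<n. \<forall>C\<in>pi0 \<Gamma>. v k C \<in> C_infinity (W (induced \<Gamma> C))"
    "f = (\<lambda>p. \<Sum>k<n. c k * tensor \<Gamma> (v k) p)"
    using assms unfolding V_iff by auto
  then have "(\<lambda>p. a * f p) = (\<lambda>p. \<Sum>k<n. (a * c k) * tensor \<Gamma> (v k) p)"
    by (simp add: sum_distrib_left mult.assoc)
  then show ?thesis unfolding V_iff using nv(1)
    by (intro exI[where x = n] exI[where x = "\<lambda>k. a * c k"] exI[where x = v] conjI)
qed

lemma V_add:
  assumes "f \<in> V \<Gamma>" "g \<in> V \<Gamma>" shows "f + g \<in> V \<Gamma>"
proof -
  obtain n :: nat and c v where nv: "\<forall>k<n. \<forall>C\<in>pi0 \<Gamma>. v k C \<in> C_infinity (W (induced \<Gamma> C))"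
    "f = (\<lambda>p. \<Sum>k<n. c k * tensor \<Gamma> (v k) p)"
    using assms(1) unfolding V_iff by auto
  obtain m :: nat and d w where mw: "\<forall>k<m. \<forall>C\<in>pi0 \<Gamma>. w k C \<in> C_infinity (W (induced \<Gamma> C))"
    "g = (\<lambda>p. \<Sum>k<m. d k * tensor \<Gamma> (w k) p)"
    using assms(2) unfolding V_iff by auto
  let ?c = "\<lambda>k. if k < n then c k else d (k - n)" and ?v = "\<lambda>k. if k < n then v k else w (k - n)"
  have "(\<Sum>k<n + m. h k) = (\<Sum>k<n. h k) + (\<Sum>k<m. h (n + k))" for h :: "nat \<Rightarrow> complex"
    by (induction m) simp_all
  then have "f + g = (\<lambda>p. \<Sum>k<n + m. ?c k * tensor \<Gamma> (?v k) p)"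
    by (simp add: nv mw plus_fun_def)
  moreover have "\<forall>k<n + m. \<forall>C\<in>pi0 \<Gamma>. ?v k C \<in> C_infinity (W (induced \<Gamma> C))"
    using nv mw by auto
  ultimately show ?thesis unfolding V_iff
    by (intro exI[where x = "n + m"] exI[where x = ?c] exI[where x = ?v] conjI)
qed

lemma V_sum: "(\<And>i. i \<in> I \<Longrightarrow> f i \<in> V \<Gamma>) \<Longrightarrow> sum f I \<in> V \<Gamma>"
  by (induction I rule: infinite_finite_induct) (auto simp: V_zero V_add)

lemma tensor_in_V:
  assumes "\<And>C. C \<in> pi0 \<Gamma> \<Longrightarrow> v C \<in> C_infinity (W (induced \<Gamma> C))"
  shows "tensor \<Gamma> v \<in> V \<Gamma>"
  unfolding V_iff using assms
  by (intro exI[where x = 1] exI[where x = "\<lambda>_. 1"] exI[where x = "\<lambda>_. v"]) auto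

lemma V_induct [consumes 1, case_names zero tensor scale add]:
  assumes f: "f \<in> V \<Gamma>" and zero: "Q 0"
    and tensor: "\<And>v. (\<And>C. C \<in> pi0 \<Gamma> \<Longrightarrow> v C \<in> C_infinity (W (induced \<Gamma> C))) \<Longrightarrow> Q (tensor \<Gamma> v)"
    and scale: "\<And>a f. Q f \<Longrightarrow> Q (\<lambda>p. a * f p)"
    and add: "\<And>f g. Q f \<Longrightarrow> Q g \<Longrightarrow> Q (f + g)"
  shows "Q f"
proof -
  obtain n :: nat and c v where nv: "\<forall>k<n. \<forall>C\<in>pi0 \<Gamma>. v k C \<in> C_infinity (W (induced \<Gamma> C))"
    "f = (\<lambda>p. \<Sum>k<n. c k * tensor \<Gamma> (v k) p)"
    using f unfolding V_iff by auto
  have "Q (\<lambda>p. \<Sum>k<m. c k * tensor \<Gamma> (v k) p)" if "m \<le> n" for m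
    using that
  proof (induction m)
    case 0
    then show ?case using zero by (simp add: zero_fun_def)
  next
    case (Suc m)
    have "Q (\<lambda>p. c m * tensor \<Gamma> (v m) p)"
      using nv(1) Suc.prems by (intro scale tensor) auto
    then show ?case
      using add[of "\<lambda>p. \<Sum>k<m. c k * tensor \<Gamma> (v k) p" "\<lambda>p. c m * tensor \<Gamma> (v m) p"] Suc
      by (simp add: plus_fun_def)
  qed
  then show ?thesis using nv(2) by simp
qed

text \<open>Elementary tensors multiply factor by factor; the rest is bilinearity.\<close>

lemma V_mult:
  assumes f: "f \<in> V \<Gamma>" and g: "g \<in> V \<Gamma>"
  shows "f * g \<in> V \<Gamma>"
proof -
  have tens: "tensor \<Gamma> v * g \<in> V \<Gamma>"
    if v: "\<And>C. C \<in> pi0 \<Gamma> \<Longrightarrow> v C \<in> C_infinity (W (induced \<Gamma> C))" for v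
    using g
  proof (induction rule: V_induct)
    case zero
    then show ?case unfolding mult_zero_right by (rule V_zero)
  next
    case (tensor w)
    have "tensor \<Gamma> v * tensor \<Gamma> w = tensor \<Gamma> (\<lambda>C p. v C p * w C p)"
      by (auto simp: tensor_def times_fun_def prod.distrib)
    then show ?case
      using tensor v by (auto intro!: tensor_in_V C_infinity_mult)
  next
    case (scale a g)
    have "tensor \<Gamma> v * (\<lambda>p. a * g p) = (\<lambda>p. a * (tensor \<Gamma> v * g) p)"
      by (simp add: fun_eq_iff)
    then show ?case using V_scale[OF scale] by metis
  next
    case (add f g)
    then show ?case unfolding distrib_left by (rule V_add)
  qed
  show ?thesis
    using f
  proof (induction rule: V_induct)
    case zero
    then show ?case unfolding mult_zero_left by (rule V_zero)
  next
    case (scale a f)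
    have "(\<lambda>p. a * f p) * g = (\<lambda>p. a * (f * g) p)" by (simp add: fun_eq_iff mult.assoc)
    then show ?case using V_scale[OF scale] by metis
  next
    case (add f g)
    then show ?case unfolding distrib_right by (rule V_add)
  qed (rule tens)
qed

lemma one_V_in_V:
  fixes \<Gamma> :: "('v, 'e, 't) fgraph"
  assumes gr: "graph \<Gamma>"
  shows "(one_V \<Gamma> :: ('e, 'd::finite) mom \<Rightarrow> complex) \<in> V \<Gamma>"
proof -
  \<comment> \<open>The constant one on each component, written as an empty product so that
    \<open>C_infinity_prod_compose\<close> yields its smoothness; the \<open>undefined\<close> terms
    stand under an empty index set.\<close>
  let ?w = "\<lambda>C (p :: ('e, 'd) mom). if p \<in> W (induced \<Gamma> C)
    then \<Prod>i\<in>({} :: nat set). undefined i (mom_restrict (undefined i) p) else 0 :: complex"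
  have "one_V \<Gamma> = tensor \<Gamma> ?w"
    using W_induced[OF gr closed_in_pi0[OF gr]]
    by (auto simp: one_V_def tensor_def fun_eq_iff intro!: prod.neutral)
  moreover have "?w C \<in> C_infinity (W (induced \<Gamma> C))" for C
    by (rule C_infinity_prod_compose) (auto intro: W_line)
  ultimately show ?thesis using tensor_in_V[of \<Gamma> ?w] by simp
qed

lemma V_outside: "f \<in> V \<Gamma> \<Longrightarrow> p \<notin> W \<Gamma> \<Longrightarrow> f p = 0"
  by (auto simp: V_def)

text \<open>The common form of \<pi> (with \<gamma> for \<Delta>) and of i (with \<Gamma>/\<gamma>).
  Several components D of \<Delta> may lie over one component \<open>g D\<close> of \<Gamma>;
  multiplying their factors gives a single smooth function per component of \<Gamma>, so elementary
  tensors go to elementary tensors.\<close>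

lemma V_pullback:
  fixes f :: "('e, 'd::finite) mom \<Rightarrow> complex"
  assumes gr: "graph \<Gamma>" and gd: "graph \<Delta>"
    and W: "\<And>p :: ('e, 'd) mom. p \<in> W \<Gamma> \<Longrightarrow> mom_restrict (hedges \<Delta>) p \<in> W \<Delta>"
    and g: "\<And>D. D \<in> pi0 \<Delta> \<Longrightarrow> g D \<in> pi0 \<Gamma>"
    and sub: "\<And>D. D \<in> pi0 \<Delta> \<Longrightarrow> hedges (induced \<Delta> D) \<subseteq> hedges (induced \<Gamma> (g D))"
    and f: "f \<in> V \<Delta>"
  shows "pull_i \<Gamma> \<Delta> f \<in> V \<Gamma>"
  using f
proof (induction rule: V_induct)
  case zero
  have "pull_i \<Gamma> \<Delta> 0 = 0" by (auto simp: pull_i_def)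
  then show ?case using V_zero by metis
next
  case (scale a f)
  have "pull_i \<Gamma> \<Delta> (\<lambda>p. a * f p) = (\<lambda>p. a * pull_i \<Gamma> \<Delta> f p)" by (auto simp: pull_i_def)
  then show ?case using V_scale[OF scale] by simp
next
  case (add f g)
  have "pull_i \<Gamma> \<Delta> (f + g) = pull_i \<Gamma> \<Delta> f + pull_i \<Gamma> \<Delta> g" by (auto simp: pull_i_def)
  then show ?case using V_add[OF add] by metis
next
  case (tensor v)
  let ?H = "\<lambda>D. hedges (induced \<Delta> D)" and ?K = "\<lambda>C. hedges (induced \<Gamma> C)"
  let ?w = "\<lambda>C p. if p \<in> W (induced \<Gamma> C)
    then \<Prod>D\<in>{D \<in> pi0 \<Delta>. g D = C}. v D (mom_restrict (?H D) p) else 0"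
  \<comment> \<open>A momentum on the component \<open>g D\<close> counts as one on \<Gamma> through
    extension by zero, so the assumption \<open>W\<close> applies to it.\<close>
  have HW: "mom_restrict (?H D) p \<in> W (induced \<Delta> D)"
    if "D \<in> pi0 \<Delta>" "p \<in> W (induced \<Gamma> (g D))" for D and p :: "('e, 'd) mom"
  proof -
    have "p \<in> W \<Gamma>" using W_induced_subset[OF gr closed_in_pi0[OF gr g[OF that(1)]]] that(2) by blast
    then have "mom_restrict (?H D) (mom_restrict (hedges \<Delta>) p) \<in> W (induced \<Delta> D)"
      by (intro W_induced gd W closed_in_pi0 that)
    then show ?thesis by (subst (asm) mom_restrict_mom_restrict) auto
  qed
  have "?w C \<in> C_infinity (W (induced \<Gamma> C))" for C
    by (rule C_infinity_prod_compose[where Y = "\<lambda>D. W (induced \<Delta> D)"])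
      (use finite_pi0[OF gd] tensor HW W_line in auto)
  moreover have "pull_i \<Gamma> \<Delta> (tensor \<Delta> v) = tensor \<Gamma> ?w"
  proof
    fix p
    show "pull_i \<Gamma> \<Delta> (tensor \<Delta> v) p = tensor \<Gamma> ?w p"
    proof (cases "p \<in> W \<Gamma>")
      case p: True
      have "pull_i \<Gamma> \<Delta> (tensor \<Delta> v) p = (\<Prod>D\<in>pi0 \<Delta>. v D (mom_restrict (?H D) p))"
        using p W[OF p] unfolding pull_i_def tensor_def
        by (auto intro!: prod.cong arg_cong[where f = "v _"] mom_restrict_mom_restrict)
      also have "\<dots> = (\<Prod>C\<in>pi0 \<Gamma>. \<Prod>D\<in>{D \<in> pi0 \<Delta>. g D = C}. v D (mom_restrict (?H D) p))"
        using g by (intro prod.group[symmetric] finite_pi0 gr gd) auto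
      also have "\<dots> = (\<Prod>C\<in>pi0 \<Gamma>. \<Prod>D\<in>{D \<in> pi0 \<Delta>. g D = C}.
          v D (mom_restrict (?H D) (mom_restrict (?K C) p)))"
        using mom_restrict_mom_restrict[OF sub, where p = p] by (intro prod.cong refl) auto
      also have "\<dots> = tensor \<Gamma> ?w p"
        using p W_induced[OF gr closed_in_pi0[OF gr] p] unfolding tensor_def
        by (auto intro!: prod.cong)
      finally show ?thesis .
    qed (simp add: pull_i_def tensor_def)
  qed
  ultimately show ?case using tensor_in_V[of \<Gamma> ?w] by simp
qed

context
  fixes \<Gamma> \<gamma> :: "('v::linorder, 'e, 't) fgraph"
  assumes gr: "graph \<Gamma>" and cov: "covering_subgraph \<gamma> \<Gamma>"
begin

lemma V_restr_pi:
  fixes f :: "('e, 'd::finite) mom \<Rightarrow> complex"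
  assumes f: "f \<in> V \<gamma>"
  shows "restr_pi \<Gamma> f \<in> V \<Gamma>"
proof -
  note cs = covering_simps[OF gr cov]
  \<comment> \<open>The half-edges of \<gamma> and \<Gamma> coincide, so restricting momenta of
    \<Gamma> to them changes nothing.\<close>
  have "restr_pi \<Gamma> f = pull_i \<Gamma> \<gamma> f"
    by (rule ext) (simp add: restr_pi_def pull_i_def cs mom_restrict_W)
  also have "\<dots> \<in> V \<Gamma>"
  proof (rule V_pullback[OF gr cs(6), where g = "\<lambda>D. comp_of \<Gamma> (Min D)"])
    show "mom_restrict (hedges \<gamma>) p \<in> W \<gamma>" if "p \<in> W \<Gamma>" for p :: "('e, 'd) mom"
      using that W_covering[OF gr cov] mom_restrict_W[OF that] cs by auto
    fix D assume D: "D \<in> pi0 \<gamma>"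
    then have "Min D \<in> verts \<Gamma>" using Min_component[OF cs(6) D] pi0_subset[OF cs(6) D] cs by auto
    then show "comp_of \<Gamma> (Min D) \<in> pi0 \<Gamma>" by (rule comp_of_pi0[OF gr])
    have "D \<subseteq> comp_of \<Gamma> (Min D)"
      using comp_of_Min[OF cs(6) D] conn_covering[OF gr cov] by (auto simp: comp_of_def)
    then show "hedges (induced \<gamma> D) \<subseteq> hedges (induced \<Gamma> (comp_of \<Gamma> (Min D)))"
      using cs by auto
  qed (rule f)
  finally show ?thesis .
qed

lemma V_pull_i:
  assumes f: "f \<in> V (contract \<Gamma> \<gamma> j)"
  shows "pull_i \<Gamma> (contract \<Gamma> \<gamma> j) f \<in> V \<Gamma>"
proof (rule V_pullback[OF gr graph_contract[OF gr cov] W_contract[OF gr cov]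
      component_contract(1)[OF gr cov] _ f])
  fix D assume D: "D \<in> pi0 (contract \<Gamma> \<gamma> j)"
  have "bdry \<Gamma> e \<in> comp_of \<Gamma> (Min D)"
    if "e \<in> hedges \<Gamma>" "Min (comp_of \<gamma> (bdry \<Gamma> e)) \<in> D" for e
    using that component_contract[OF gr cov D] Min_comp_of_mem[OF gr cov _ bdry_verts[OF gr that(1)]]
    by blast
  then show "hedges (induced (contract \<Gamma> \<gamma> j) D) \<subseteq> hedges (induced \<Gamma> (comp_of \<Gamma> (Min D)))"
    by auto
qed

end

subsection \<open>The algebra of functions\<close>

text \<open>At the concatenation only the splitting \<open>A = pi0 \<Gamma>\<close> produces the two
  factors. At any other \<Delta> a nonzero term would exhibit \<Delta> as that concatenation, since
  the two parts of a splitting glue back to \<Delta>.\<close>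

lemma bmul_emb:
  fixes \<Gamma> \<Gamma>' :: "('v, 'e, 't) fgraph" and f f' :: "('e, 'd::finite) mom \<Rightarrow> complex"
  assumes gr: "graph \<Gamma>" and gr': "graph \<Gamma>'" and dj: "disjoint_graphs \<Gamma> \<Gamma>'"
  shows "emb \<Gamma> f \<bullet>\<^sub>B emb \<Gamma>' f' = emb (concat_graph \<Gamma> \<Gamma>') (\<lambda>p. if p \<in> W (concat_graph \<Gamma> \<Gamma>')
    then f (mom_restrict (hedges \<Gamma>) p) * f' (mom_restrict (hedges \<Gamma>') p) else 0)" (is "_ = emb ?c ?F")
proof (intro ext)
  fix \<Delta> and p :: "('e, 'd) mom"
  let ?t = "\<lambda>A. emb \<Gamma> f (induced \<Delta> (\<Union>A)) (mom_restrict (hedges (induced \<Delta> (\<Union>A))) p) *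
    emb \<Gamma>' f' (induced \<Delta> (\<Union>(pi0 \<Delta> - A))) (mom_restrict (hedges (induced \<Delta> (\<Union>(pi0 \<Delta> - A)))) p)"
  have gc: "graph ?c" by (rule graph_concat[OF gr gr' dj])
  have lhs: "(emb \<Gamma> f \<bullet>\<^sub>B emb \<Gamma>' f') \<Delta> p = (if graph \<Delta> \<and> p \<in> W \<Delta> then \<Sum>A\<in>Pow (pi0 \<Delta>). ?t A else 0)"
    by (simp add: bmul_def Let_def)
  show "(emb \<Gamma> f \<bullet>\<^sub>B emb \<Gamma>' f') \<Delta> p = emb ?c ?F \<Delta> p"
  proof (cases "\<Delta> = ?c")
    case True
    have p0: "pi0 \<Delta> = pi0 \<Gamma> \<union> pi0 \<Gamma>'" "pi0 \<Gamma> \<inter> pi0 \<Gamma>' = {}"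
      using pi0_concat[OF gr gr' dj] pi0_disjoint[OF gr gr' dj] True by auto
    have "?t A = (if A = pi0 \<Gamma> then f (mom_restrict (hedges \<Gamma>) p) * f' (mom_restrict (hedges \<Gamma>') p) else 0)"
      if A: "A \<in> Pow (pi0 \<Delta>)" for A
    proof (cases "A = pi0 \<Gamma>")
      case eq: True
      then have "pi0 \<Delta> - A = pi0 \<Gamma>'" using p0 by auto
      then show ?thesis
        using eq induced_concat[OF gr gr' dj] True by (simp add: Union_pi0 gr gr' emb_def)
    next
      case False
      have "induced \<Delta> (\<Union>A) \<noteq> \<Gamma>"
      proof
        assume "induced \<Delta> (\<Union>A) = \<Gamma>"
        moreover have "closed_in \<Delta> (\<Union>A)" using closed_in_Union[of \<Delta> A] gc True A by auto
        ultimately have "pi0 \<Gamma> = {C \<in> pi0 \<Delta>. C \<subseteq> \<Union>A}"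
          using pi0_induced[of \<Delta> "\<Union>A"] gc True by simp
        then show False using subset_pi0_eq[of \<Delta> A] gc True A False by auto
      qed
      then show ?thesis using False by (simp add: emb_def)
    qed
    then have "(\<Sum>A\<in>Pow (pi0 \<Delta>). ?t A) =
        (\<Sum>A\<in>Pow (pi0 \<Delta>). if A = pi0 \<Gamma> then f (mom_restrict (hedges \<Gamma>) p) * f' (mom_restrict (hedges \<Gamma>') p) else 0)"
      by (rule sum.cong[OF refl])
    also have "\<dots> = f (mom_restrict (hedges \<Gamma>) p) * f' (mom_restrict (hedges \<Gamma>') p)"
      using finite_pi0[OF gc] True p0 by (subst sum.delta) auto
    finally show ?thesis unfolding lhs using True gc by (simp add: emb_def)
  next
    case False
    have "?t A = 0" if gd: "graph \<Delta>" and A: "A \<in> Pow (pi0 \<Delta>)" for A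
    proof (rule ccontr)
      assume "?t A \<noteq> 0"
      then have "induced \<Delta> (\<Union>A) = \<Gamma>" "induced \<Delta> (\<Union>(pi0 \<Delta> - A)) = \<Gamma>'"
        by (auto simp: emb_def split: if_splits)
      moreover have "\<Union>(pi0 \<Delta> - A) = verts \<Delta> - \<Union>A"
        using A pi0_eqI[OF gd] unfolding Union_pi0[OF gd, symmetric] by blast
      ultimately show False
        using concat_induced(2)[OF gd closed_in_Union[OF gd]] A False by auto
    qed
    then have "(\<Sum>A\<in>Pow (pi0 \<Delta>). ?t A) = 0" if "graph \<Delta>" using that by (intro sum.neutral ballI)
    moreover have "emb ?c ?F \<Delta> = 0" using False by (simp add: emb_def)
    ultimately show ?thesis unfolding lhs by simp
  qed
qed

lemma bmul_emb_commute:
  assumes "graph \<Gamma>" "graph \<Gamma>'" "disjoint_graphs \<Gamma> \<Gamma>'"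
  shows "emb \<Gamma>' f' \<bullet>\<^sub>B emb \<Gamma> f = emb \<Gamma> f \<bullet>\<^sub>B emb \<Gamma>' f'"
  unfolding bmul_emb[OF assms] bmul_emb[OF assms(2,1) assms(3)[unfolded disjoint_graphs_commute[of \<Gamma>]]]
    concat_graph_commute[OF assms]
  by (intro arg_cong[where f = "emb _"]) (auto simp: mult.commute)

lemma mom_restrict_W_concat:
  assumes "graph \<Gamma>" "graph \<Gamma>'" "disjoint_graphs \<Gamma> \<Gamma>'" and "p \<in> W (concat_graph \<Gamma> \<Gamma>')"
  shows "mom_restrict (hedges \<Gamma>) p \<in> W \<Gamma>" "mom_restrict (hedges \<Gamma>') p \<in> W \<Gamma>'"
  using W_induced[OF graph_concat[OF assms(1-3)] closed_in_concat[OF assms(1-3)] assms(4)]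
    W_induced[OF graph_concat[OF assms(1-3)] closed_in_concat_right[OF assms(1-3)] assms(4)]
    induced_concat[OF assms(1-3)] by simp_all

lemma VB_Bspace:
  assumes "graph \<Gamma>" shows "VB \<Gamma> \<subseteq> Bspace"
  using assms by (auto simp: VB_def Bspace_def emb_def V_zero)

lemma Bspace_add: "x \<in> Bspace \<Longrightarrow> y \<in> Bspace \<Longrightarrow> x + y \<in> Bspace"
  by (auto simp: Bspace_def V_add)

lemma Bspace_scale: "x \<in> Bspace \<Longrightarrow> bscale a x \<in> Bspace"
  by (fastforce simp: Bspace_def bscale_def V_scale zero_fun_def split: if_splits)

lemma Bspace_zero: "0 \<in> Bspace"
  by (auto simp: Bspace_def V_zero)

lemma VB_iff: "x \<in> VB \<Gamma> \<longleftrightarrow> x \<Gamma> \<in> V \<Gamma> \<and> x = emb \<Gamma> (x \<Gamma>)"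
  by (auto simp: VB_def emb_def)

lemma emb_apply [simp]: "emb \<Gamma> f \<Gamma> = f"
  by (simp add: emb_def)

lemma emb_in_VB: "f \<in> V \<Gamma> \<Longrightarrow> emb \<Gamma> f \<in> VB \<Gamma>"
  by (simp add: VB_def)

lemma emb_add: "emb \<Gamma> (f + g) = emb \<Gamma> f + emb \<Gamma> g"
  by (auto simp: emb_def)

lemma emb_uminus: "emb \<Gamma> (- f) = - emb \<Gamma> f"
  by (auto simp: emb_def)

lemma uminus_V: "f \<in> V \<Gamma> \<Longrightarrow> - f \<in> V \<Gamma>"
  using V_scale[of f \<Gamma> "-1"] by (simp add: fun_Compl_def)

subsection \<open>Linear extension\<close>

lemma linear_ext_eq:
  assumes "finite S" "{s. x s \<noteq> 0} \<subseteq> S"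
  shows "linear_ext f x = (\<Sum>s\<in>S. bscale (x s) (f s))"
  unfolding linear_ext_def
  using assms by (intro sum.mono_neutral_left) (auto simp: bscale_def zero_fun_def)

lemma linear_ext_gen: "linear_ext f (gen s) = f s"
  using linear_ext_eq[of "{s}" "gen s" f] by (auto simp: gen_def bscale_def)

lemma bscale_add_left: "bscale (a + b) x = bscale a x + bscale b x"
  by (simp add: bscale_def fun_eq_iff distrib_right)

lemma bscale_mult: "bscale (a * b) x = bscale a (bscale b x)"
  by (simp add: bscale_def fun_eq_iff mult.assoc)

lemma bscale_add_right: "bscale a (x + y) = bscale a x + bscale a y"
  by (simp add: bscale_def fun_eq_iff distrib_left)

lemma bscale_sum: "bscale a (\<Sum>i\<in>I. f i) = (\<Sum>i\<in>I. bscale a (f i))"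
proof -
  have "bscale a 0 = 0" by (simp add: bscale_def fun_eq_iff)
  then show ?thesis
    by (induction I rule: infinite_finite_induct) (simp_all add: bscale_add_right)
qed

lemma bscale_minus_one: "bscale (- 1) x = - x"
  by (simp add: bscale_def fun_eq_iff)

lemma linear_linear_ext:
  fixes T :: "'t qft" and f :: "('v::linorder, 'e, 't) sgraph \<Rightarrow> ('v, 'e, 't, 'd::finite) bvec"
  shows "linear_between (Hspace T) hscale bscale (linear_ext f)"
  unfolding linear_between_def
proof (intro conjI ballI allI)
  fix x y :: "('v, 'e, 't) hvec" assume "x \<in> Hspace T" "y \<in> Hspace T"
  \<comment> \<open>The support of x + y may be smaller than those of x and y, so all three sums are
    taken over the union of these two.\<close>
  then have "finite ({s. x s \<noteq> 0} \<union> {s. y s \<noteq> 0})" (is "finite ?S") by (simp add: Hspace_def)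
  then have "linear_ext f (x + y) = (\<Sum>s\<in>?S. bscale ((x + y) s) (f s))"
    "linear_ext f x = (\<Sum>s\<in>?S. bscale (x s) (f s))" "linear_ext f y = (\<Sum>s\<in>?S. bscale (y s) (f s))"
    by (intro linear_ext_eq; auto)+
  then show "linear_ext f (x + y) = linear_ext f x + linear_ext f y"
    by (simp add: bscale_add_left sum.distrib)
next
  fix c and x :: "('v, 'e, 't) hvec" assume "x \<in> Hspace T"
  then have "finite {s. x s \<noteq> 0}" by (simp add: Hspace_def)
  then have "linear_ext f (hscale c x) = (\<Sum>s\<in>{s. x s \<noteq> 0}. bscale (c * x s) (f s))"
    by (subst linear_ext_eq[where S = "{s. x s \<noteq> 0}"]) (auto simp: hscale_def)
  then show "linear_ext f (hscale c x) = bscale c (linear_ext f x)"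
    by (simp add: linear_ext_def bscale_sum bscale_mult)
qed

text \<open>The axioms of a character are conditions on generators, apart from linearity and values
  in \<open>Bspace\<close>, which the extension supplies. The value at the empty graph is a case of
  \<open>unit\<close>.\<close>

lemma character_linear_ext:
  assumes VB: "\<And>s. specified_graph T s \<Longrightarrow> f s \<in> VB (fst s)"
    and indep: "\<And>\<Gamma> i i'. specified_graph T (\<Gamma>, i) \<Longrightarrow> specified_graph T (\<Gamma>, i') \<Longrightarrow> f (\<Gamma>, i) = f (\<Gamma>, i')"
    and unit: "\<And>s. graph (fst s) \<Longrightarrow> internal (fst s) = {} \<Longrightarrow> f s = emb (fst s) (one_V (fst s))"
    and mult: "\<And>s s'. specified_graph T s \<Longrightarrow> specified_graph T s' \<Longrightarrow> disjoint_graphs (fst s) (fst s') \<Longrightarrow>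
      f (concat_spec s s') = f s \<bullet>\<^sub>B f s'"
  shows "character T (linear_ext f)"
proof -
  have gr: "graph (fst s)" if "specified_graph T s" for s
    using specified_graph_graph[of T "fst s" "snd s"] that by simp
  have "linear_ext f x \<in> Bspace" if "x \<in> Hspace T" for x
  proof -
    have "(\<Sum>s\<in>S. bscale (x s) (f s)) \<in> Bspace" if "S \<subseteq> Collect (specified_graph T)" for S
      using that
    proof (induction S rule: infinite_finite_induct)
      case (insert s S)
      then have "f s \<in> Bspace" using subsetD[OF VB_Bspace[OF gr] VB] by blast
      then show ?case
        using insert unfolding sum.insert[OF insert(1,2)] by (intro Bspace_add Bspace_scale) auto
    qed (simp_all only: sum.infinite sum.empty Bspace_zero not_False_eq_True)
    then show ?thesis using that unfolding linear_ext_def Hspace_def by blast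
  qed
  moreover have "linear_ext f (gen empty_spec) = one_B"
    using unit[of empty_spec]
    by (simp add: linear_ext_gen one_B_def empty_spec_def Let_def empty_graph_def graph_def internal_def)
  ultimately show ?thesis
    unfolding character_def linear_ext_gen
  proof (intro conjI allI impI)
    show "f (\<Gamma>, i) \<in> VB \<Gamma>" if "specified_graph T (\<Gamma>, i)" for \<Gamma> i using VB[OF that] by simp
    show "f (\<Gamma>, i) = emb \<Gamma> (one_V \<Gamma>)" if "specified_graph T (\<Gamma>, i) \<and> internal \<Gamma> = {}" for \<Gamma> i
      using unit[of "(\<Gamma>, i)"] gr[of "(\<Gamma>, i)"] that by simp
  qed (use linear_linear_ext[of T f] indep mult in blast)+
qed

text \<open>Induction on the number of components: with at least two, splitting off one leaves two
  smaller factors to which both specifications restrict. The empty graph has only one extensional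
  specification.\<close>

lemma independent_of_specification:
  assumes mult: "\<And>s s'. specified_graph T s \<Longrightarrow> specified_graph T s' \<Longrightarrow> disjoint_graphs (fst s) (fst s') \<Longrightarrow>
      F (concat_spec s s') = F s \<bullet>\<^sub>B F s'"
    and conn: "\<And>\<Gamma> i i'. specified_graph T (\<Gamma>, i) \<Longrightarrow> specified_graph T (\<Gamma>, i') \<Longrightarrow>
      connected_graph \<Gamma> \<Longrightarrow> F (\<Gamma>, i) = F (\<Gamma>, i')"
  shows "specified_graph T (\<Gamma>, i) \<Longrightarrow> specified_graph T (\<Gamma>, i') \<Longrightarrow> F (\<Gamma>, i) = F (\<Gamma>, i')"
proof (induction "card (pi0 \<Gamma>)" arbitrary: \<Gamma> i i' rule: less_induct)
  case less
  have gr: "graph \<Gamma>" by (rule specified_graph_graph[OF less(2)])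
  have ext: "i \<in> extensional (pi0 \<Gamma>)" "i' \<in> extensional (pi0 \<Gamma>)"
    using less(2,3) by (auto simp: specified_iff)
  consider "pi0 \<Gamma> = {}" | "card (pi0 \<Gamma>) = 1" | "card (pi0 \<Gamma>) \<ge> 2"
    using finite_pi0[OF gr] by (metis card_eq_0_iff One_nat_def less_2_cases not_less)
  then show ?case
  proof cases
    case 1
    then have "i = i'" using ext by auto
    then show ?thesis by simp
  next
    case 2
    then show ?thesis by (intro conn less(2,3)) (simp add: connected_graph_def)
  next
    case 3
    then obtain C where C: "C \<in> pi0 \<Gamma>" by fastforce
    have cl: "closed_in \<Gamma> C" by (rule closed_in_pi0[OF gr C])
    let ?A = "induced \<Gamma> C" and ?B = "induced \<Gamma> (verts \<Gamma> - C)"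
    have g: "graph ?A" "graph ?B" and dj: "disjoint_graphs ?A ?B"
      using graph_induced[OF gr cl] graph_induced[OF gr closed_in_diff[OF gr cl]]
        concat_induced(1)[OF gr cl] by auto
    have split: "(\<Gamma>, k) = concat_spec (?A, restrict k (pi0 ?A)) (?B, restrict k (pi0 ?B))"
      if "k \<in> extensional (pi0 \<Gamma>)" for k
      by (rule concat_spec_split[OF gr cl that])
    have sp: "specified_graph T (?A, restrict k (pi0 ?A)) \<and> specified_graph T (?B, restrict k (pi0 ?B))"
      if "specified_graph T (\<Gamma>, k)" "k \<in> extensional (pi0 \<Gamma>)" for k
      using that(1) unfolding split[OF that(2)]
      by (subst (asm) specified_concat_iff[OF g dj]) auto
    have "pi0 ?A \<union> pi0 ?B = pi0 \<Gamma>" "pi0 ?A \<inter> pi0 ?B = {}"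
      using pi0_concat[OF g dj] pi0_disjoint[OF g dj] concat_induced(2)[OF gr cl] by auto
    moreover have "pi0 ?A = {C}" by (rule pi0_induced_component[OF gr C])
    ultimately have "card (pi0 ?A) < card (pi0 \<Gamma>)" "card (pi0 ?B) < card (pi0 \<Gamma>)"
      using 3 finite_pi0[OF gr] C by (auto intro!: psubset_card_mono)
    then have "F (?A, restrict i (pi0 ?A)) = F (?A, restrict i' (pi0 ?A))"
      "F (?B, restrict i (pi0 ?B)) = F (?B, restrict i' (pi0 ?B))"
      using less.hyps sp[OF less(2) ext(1)] sp[OF less(3) ext(2)] by blast+
    then show ?thesis
      using mult[of "(?A, restrict i (pi0 ?A))" "(?B, restrict i (pi0 ?B))"]
        mult[of "(?A, restrict i' (pi0 ?A))" "(?B, restrict i' (pi0 ?B))"]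
        sp[OF less(2) ext(1)] sp[OF less(3) ext(2)] dj split[OF ext(1)] split[OF ext(2)] by simp
  qed
qed

subsection \<open>Multiplicativity of the recursion\<close>

text \<open>The product of two embedded functions, as a function on the concatenation. It turns
  identities in \<open>Bspace\<close> into pointwise ones, free of the sum over splittings.\<close>

definition join :: "('v, 'e, 't) fgraph \<Rightarrow> ('v, 'e, 't) fgraph \<Rightarrow> (('e, 'd::finite) mom \<Rightarrow> complex) \<Rightarrow>
    (('e, 'd) mom \<Rightarrow> complex) \<Rightarrow> ('e, 'd) mom \<Rightarrow> complex" where
  "join \<Gamma> \<Gamma>' f f' = (\<lambda>p. if p \<in> W (concat_graph \<Gamma> \<Gamma>')
    then f (mom_restrict (hedges \<Gamma>) p) * f' (mom_restrict (hedges \<Gamma>') p) else 0)"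

lemma bmul_emb_join:
  assumes "graph \<Gamma>" "graph \<Gamma>'" "disjoint_graphs \<Gamma> \<Gamma>'"
  shows "emb \<Gamma> f \<bullet>\<^sub>B emb \<Gamma>' f' = emb (concat_graph \<Gamma> \<Gamma>') (join \<Gamma> \<Gamma>' f f')"
  unfolding join_def by (rule bmul_emb[OF assms])

lemma join_one:
  assumes "graph \<Gamma>" "graph \<Gamma>'" "disjoint_graphs \<Gamma> \<Gamma>'"
  shows "join \<Gamma> \<Gamma>' (one_V \<Gamma>) (one_V \<Gamma>') = one_V (concat_graph \<Gamma> \<Gamma>')"
  using mom_restrict_W_concat[OF assms] by (auto simp: join_def one_V_def fun_eq_iff)

lemma bmul_add_left: "(x + y) \<bullet>\<^sub>B z = x \<bullet>\<^sub>B z + y \<bullet>\<^sub>B z"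
  by (simp add: bmul_def Let_def fun_eq_iff distrib_right sum.distrib)

lemma bmul_add_right: "x \<bullet>\<^sub>B (y + z) = x \<bullet>\<^sub>B y + x \<bullet>\<^sub>B z"
  by (simp add: bmul_def Let_def fun_eq_iff distrib_left sum.distrib)

lemma bmul_uminus_left: "(- x) \<bullet>\<^sub>B y = - (x \<bullet>\<^sub>B y)"
  by (simp add: bmul_def Let_def fun_eq_iff sum_negf)

lemma bmul_uminus_right: "x \<bullet>\<^sub>B (- y) = - (x \<bullet>\<^sub>B y)"
  by (simp add: bmul_def Let_def fun_eq_iff sum_negf)

lemma bmul_zero_left: "0 \<bullet>\<^sub>B y = 0"
  by (simp add: bmul_def Let_def fun_eq_iff)

lemma bmul_zero_right: "x \<bullet>\<^sub>B 0 = 0"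
  by (simp add: bmul_def Let_def fun_eq_iff)

lemma emb_zero: "emb \<Gamma> 0 = 0"
  by (auto simp: emb_def)

lemma one_V_mult:
  assumes "f \<in> V \<Gamma>" shows "one_V \<Gamma> * f = f" "f * one_V \<Gamma> = f"
  using V_outside[OF assms] by (auto simp: one_V_def fun_eq_iff)

section \<open>Changing the specification of a connected graph\<close>

text \<open>Contraction only drops halves of internal edges, so the external half-edges of a
  component survive. Hence an index whose refined type is allowed for a component of \<Gamma> is
  allowed for the residue of its image too.\<close>

lemma residue_type_contract:
  fixes \<Gamma> \<gamma> :: "('v::linorder, 'e, 't) fgraph"
  assumes gr: "graph \<Gamma>" and cov: "covering_subgraph \<gamma> \<Gamma>" and D: "D \<in> pi0 (contract \<Gamma> \<gamma> j)"
  shows "residue_type (contract \<Gamma> \<gamma> j) D = residue_type \<Gamma> (comp_of \<Gamma> (Min D))"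
proof -
  have fixed: "sigma \<gamma> e = e" if "e \<in> hedges \<Gamma>" "sigma \<Gamma> e = e" for e
    using cov that unfolding covering_iff[OF gr] by metis
  have mem: "Min (comp_of \<gamma> v) \<in> D \<longleftrightarrow> v \<in> comp_of \<Gamma> (Min D)" if "v \<in> verts \<Gamma>" for v
  proof -
    have "Min (comp_of \<gamma> v) \<in> verts (contract \<Gamma> \<gamma> j)"
      using comp_of_pi0[OF covering_simps(6)[OF gr cov]] covering_simps[OF gr cov] that by simp
    then show ?thesis
      using component_contract[OF gr cov D] Min_comp_of_mem[OF gr cov _ that] by blast
  qed
  have "{e \<in> hedges (contract \<Gamma> \<gamma> j). bdry (contract \<Gamma> \<gamma> j) e \<in> D \<and>
      sigma (contract \<Gamma> \<gamma> j) e = e \<and> htype (contract \<Gamma> \<gamma> j) e = a} =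
    {e \<in> hedges \<Gamma>. bdry \<Gamma> e \<in> comp_of \<Gamma> (Min D) \<and> sigma \<Gamma> e = e \<and> htype \<Gamma> e = a}" for a
    using fixed mem[OF bdry_verts[OF gr]] by auto
  then show ?thesis unfolding residue_type_def by simp
qed

text \<open>An edge cut in \<gamma> stays internal in \<Gamma>/\<gamma>; if there is none, nothing
  has been cut.\<close>

lemma internal_contract_empty:
  assumes gr: "graph \<Gamma>" and cov: "covering_subgraph \<gamma> \<Gamma>" and "internal (contract \<Gamma> \<gamma> j) = {}"
  shows "\<gamma> = \<Gamma>"
proof -
  have "sigma \<gamma> e = sigma \<Gamma> e" for e
  proof (cases "e \<in> hedges \<Gamma>")
    case True
    then show ?thesis
      using cov assms(3) unfolding covering_iff[OF gr] internal_empty_iff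
      by (cases "sigma \<gamma> e = e") auto
  next
    case False
    then show ?thesis
      using cov gr unfolding covering_iff[OF gr] by (auto simp: graph_def PiE_iff extensional_def)
  qed
  then show ?thesis using cov unfolding covering_iff[OF gr] by (intro fgraph.equality) auto
qed

text \<open>The specification of \<Gamma> enters twice. Agreement on full components is vacuous, as
  a covering subgraph other than \<Gamma> contains no full component of a connected \<Gamma>. In
  \<Gamma>/\<gamma> an internal edge survives, so the index of its one component is restricted only
  by the residue type, which is that of \<Gamma>.\<close>

lemma spec_subs_connected:
  assumes sp: "specified_graph T (\<Gamma>, i)" "specified_graph T (\<Gamma>, i')" and conn: "connected_graph \<Gamma>"
    and u: "(\<gamma>, j) \<in> spec_subs T (\<Gamma>, i)" and ne: "\<gamma> \<noteq> \<Gamma>"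
  shows "(\<gamma>, j) \<in> spec_subs T (\<Gamma>, i')"
proof -
  have gr: "graph \<Gamma>" by (rule specified_graph_graph[OF sp(1)])
  have cov: "covering_subgraph \<gamma> \<Gamma>" and gj: "specified_graph T (\<gamma>, j)"
    using u by (auto simp: spec_subs_def spec_subgraph_eq)
  note cs = covering_simps[OF gr cov]
  obtain C where "pi0 \<Gamma> = {C}" using conn by (auto simp: connected_graph_def card_1_singleton_iff)
  then have p: "pi0 \<Gamma> = {verts \<Gamma>}" using Union_pi0[OF gr] by auto
  have "C \<noteq> verts \<Gamma>" if "induced \<gamma> C = induced \<Gamma> C" for C
    using that ne induced_verts[OF gr] induced_verts[OF cs(6)] cs(1) by metis
  then have "spec_subgraph T (\<gamma>, j) (\<Gamma>, i')"
    unfolding spec_subgraph_eq p using gj sp(2) cov by blast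
  moreover have "specified_graph T (spec_contract (\<Gamma>, i') (\<gamma>, j))"
  proof -
    let ?q = "contract \<Gamma> \<gamma> j"
    have gq: "graph ?q" by (rule graph_contract[OF gr cov])
    have sq: "graph_in T ?q"
      "\<And>D. D \<in> pi0 ?q \<Longrightarrow> specified_component T ?q D (i (comp_of \<Gamma> (Min D)))"
      using u unfolding spec_subs_def mem_Collect_eq spec_contract_eq specified_iff by auto
    have "specified_component T ?q D (i' (comp_of \<Gamma> (Min D)))" if D: "D \<in> pi0 ?q" for D
    proof -
      have m: "comp_of \<Gamma> (Min D) \<in> pi0 \<Gamma>" and "D = comp_of \<Gamma> (Min D) \<inter> verts ?q"
        by (rule component_contract[OF gr cov D])+
      then have "D = verts ?q" using p verts_contract_subset[OF gr cov, of j] by auto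
      then have "internal (induced ?q D) \<noteq> {}"
        using induced_verts[OF gq] internal_contract_empty[OF gr cov] ne by metis
      moreover have "(residue_type ?q D, i' (comp_of \<Gamma> (Min D))) \<in> rtypes T"
        unfolding residue_type_contract[OF gr cov D] using sp(2) m
        by (simp add: specified_iff specified_component_def)
      ultimately show ?thesis using sq(2)[OF D] by (simp add: specified_component_def)
    qed
    then show ?thesis using sq(1) unfolding spec_contract_eq specified_iff by simp
  qed
  ultimately show ?thesis by (simp add: spec_subs_def)
qed

section \<open>The recursion for a fixed theory, character and scheme\<close>

locale renormalization =
  fixes T :: "'t qft"
    and \<phi> :: "('v::linorder, 'e, 't) hvec \<Rightarrow> ('v, 'e, 't, 'd::finite) bvec"
    and P :: "nat \<Rightarrow> ('v, 'e, 't, 'd) bvec \<Rightarrow> ('v, 'e, 't, 'd) bvec"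
  assumes wf: "wf_qft T"
    and character: "character T \<phi>"
    and scheme: "indexed_renormalization_scheme P"
    and preserves: "\<And>t \<Gamma> x. graph \<Gamma> \<Longrightarrow> x \<in> VB \<Gamma> \<Longrightarrow> P t x \<in> VB \<Gamma>"
    and degree_zero: "\<And>t \<Gamma> \<Gamma>' x. graph \<Gamma> \<Longrightarrow> x \<in> VB \<Gamma> \<Longrightarrow> graph \<Gamma>' \<Longrightarrow> internal \<Gamma>' = {} \<Longrightarrow>
      P t (x \<bullet>\<^sub>B emb \<Gamma>' (one_V \<Gamma>')) = P t x \<bullet>\<^sub>B emb \<Gamma>' (one_V \<Gamma>')"
begin

abbreviation minus_gen :: "('v, 'e, 't) sgraph \<Rightarrow> ('v, 'e, 't, 'd) bvec" where
  "minus_gen \<equiv> phi_minus_gen T P \<phi>"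

abbreviation plus_gen :: "('v, 'e, 't) sgraph \<Rightarrow> ('v, 'e, 't, 'd) bvec" where
  "plus_gen \<equiv> phi_plus_gen T P \<phi>"

definition summand :: "('v, 'e, 't) sgraph \<Rightarrow> ('v, 'e, 't) sgraph \<Rightarrow> ('e, 'd) mom \<Rightarrow> complex" where
  "summand s u = restr_pi (fst s) (minus_gen u (fst u)) *
     pull_i (fst s) (fst (spec_contract s u)) (\<phi> (gen (spec_contract s u)) (fst (spec_contract s u)))"

text \<open>The function b(s) of the overview, on momenta. Leaving out s itself makes the sum
  available before \<open>minus_gen s\<close> is known.\<close>

definition bracket_sum :: "('v, 'e, 't) sgraph \<Rightarrow> ('e, 'd) mom \<Rightarrow> complex" where
  "bracket_sum s = (\<Sum>u\<in>spec_subs T s - {s}. summand s u)"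

lemma specified_graph_fst: "specified_graph T s \<Longrightarrow> graph (fst s)"
  by (cases s) (simp add: specified_graph_graph)

lemma spec_subs_fst:
  assumes "u \<in> spec_subs T s"
  shows "covering_subgraph (fst u) (fst s)" "specified_graph T u" "specified_graph T s"
    "specified_graph T (spec_contract s u)" "graph (fst s)" "graph (fst u)"
  using assms specified_graph_fst by (cases u; cases s; auto simp: spec_subs_def spec_subgraph_eq)+

lemma fst_spec_contract: "fst (spec_contract s u) = contract (fst s) (fst u) (snd u)"
  by (cases s; cases u) (simp add: spec_contract_eq)

lemma loops_specified:
  assumes sp: "specified_graph T s" shows "loops (fst s) = 0 \<longleftrightarrow> internal (fst s) = {}"
proof (rule loops_eq_0_iff[OF specified_graph_fst[OF sp]])
  show "locally_one_PI (fst s)"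
    using sp specified_iff[of T "fst s" "snd s"]
    by (simp add: locally_one_PI_def specified_component_def)
qed

lemma phi_VB: "specified_graph T s \<Longrightarrow> \<phi> (gen s) \<in> VB (fst s)"
  using character unfolding character_def by (metis prod.collapse)

lemma minus_gen_internal_empty:
  "graph (fst s) \<Longrightarrow> internal (fst s) = {} \<Longrightarrow> minus_gen s = emb (fst s) (one_V (fst s))"
  by (simp add: phi_minus_gen.simps loops_internal_empty)

lemma plus_gen_internal_empty:
  "graph (fst s) \<Longrightarrow> internal (fst s) = {} \<Longrightarrow> plus_gen s = emb (fst s) (one_V (fst s))"
  by (simp add: phi_plus_gen_def loops_internal_empty)

lemma summand_V:
  assumes u: "u \<in> spec_subs T s" and m: "minus_gen u \<in> VB (fst u)"
  shows "summand s u \<in> V (fst s)"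
proof -
  note f = spec_subs_fst[OF u]
  have "\<phi> (gen (spec_contract s u)) (fst (spec_contract s u)) \<in> V (contract (fst s) (fst u) (snd u))"
    using phi_VB[OF f(4)] unfolding VB_iff fst_spec_contract by blast
  then show ?thesis
    unfolding summand_def using m
    by (intro V_mult V_restr_pi[OF f(5,1)]) (auto simp: VB_iff fst_spec_contract V_pull_i[OF f(5,1)])
qed

lemma bracket_eq_sum:
  assumes sp: "specified_graph T s" and int: "internal (fst s) \<noteq> {}"
  shows "bracket T \<phi> minus_gen s = emb (fst s) (bracket_sum s)"
proof -
  let ?\<Gamma> = "fst s" and ?k = "skeleton_spec (fst s)"
  have gr: "graph ?\<Gamma>" by (rule specified_graph_fst[OF sp])
  have k: "?k \<in> spec_subs T s" by (rule skeleton_in_spec_subs[OF wf sp])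
  have kf: "fst ?k = skeleton ?\<Gamma>" by (simp add: skeleton_spec_def)
  then have ks: "?k \<noteq> s" using skeleton_eq_iff[OF gr] int by metis
  have q: "spec_contract s ?k = s"
    using spec_contract_skeleton[OF gr, of "snd s"] sp specified_iff[of T "fst s" "snd s"] by simp
  have "minus_gen ?k = emb (skeleton ?\<Gamma>) (one_V (skeleton ?\<Gamma>))"
    using minus_gen_internal_empty[of ?k] kf graph_covering[OF gr skeleton_covering]
      internal_skeleton[OF gr] by simp
  \<comment> \<open>At the skeleton the left factor is the constant one and the contraction gives
    back s, so its term is the free-standing \<phi>(\<Gamma>) of the bracket.\<close>
  then have "restr_pi ?\<Gamma> (minus_gen ?k (fst ?k)) = one_V ?\<Gamma>"
    using W_covering[OF gr skeleton_covering] by (auto simp: kf restr_pi_def one_V_def fun_eq_iff)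
  moreover have V: "\<phi> (gen s) ?\<Gamma> \<in> V ?\<Gamma>" and e: "\<phi> (gen s) = emb ?\<Gamma> (\<phi> (gen s) ?\<Gamma>)"
    using phi_VB[OF sp] VB_iff by blast+
  moreover have "pull_i ?\<Gamma> ?\<Gamma> (\<phi> (gen s) ?\<Gamma>) = \<phi> (gen s) ?\<Gamma>"
    using V_outside[OF V] by (auto simp: pull_i_def fun_eq_iff mom_restrict_W)
  ultimately have k_summand: "summand s ?k = \<phi> (gen s) ?\<Gamma>"
    unfolding summand_def q by (simp add: one_V_mult)
  have "bracket_sum s = summand s ?k + (\<Sum>u\<in>proper_subs T s. summand s u)"
  proof -
    have "spec_subs T s - {s} - {?k} = proper_subs T s"
      using proper_subs_eq[OF wf sp] by auto
    then show ?thesis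
      unfolding bracket_sum_def
      using sum.remove[of "spec_subs T s - {s}" ?k "summand s"] finite_spec_subs[OF wf gr] k ks by auto
  qed
  then have "emb ?\<Gamma> (bracket_sum s) = \<phi> (gen s) + emb ?\<Gamma> (\<Sum>u\<in>proper_subs T s. summand s u)"
    using e k_summand by (simp add: emb_add)
  then show ?thesis by (simp add: bracket_def Let_def summand_def)
qed

lemma bracket_sum_internal_empty:
  assumes "internal (fst s) = {}" shows "bracket_sum s = 0"
proof -
  have "spec_subs T s - {s} = {}"
    using card_internal_spec_subs_less[of _ T s] assms by fastforce
  then show ?thesis unfolding bracket_sum_def by (simp only: sum.empty)
qed

lemma minus_gen_eq:
  assumes "specified_graph T s" "internal (fst s) \<noteq> {}"
  shows "minus_gen s = - P (loops (fst s)) (emb (fst s) (bracket_sum s))"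
  using assms loops_specified[OF assms(1)] bracket_eq_sum[OF assms]
  by (subst phi_minus_gen.simps) simp

lemma plus_gen_eq:
  assumes sp: "specified_graph T s"
  shows "plus_gen s = emb (fst s) (bracket_sum s) + minus_gen s"
proof (cases "internal (fst s) = {}")
  case True
  then show ?thesis
    using minus_gen_internal_empty plus_gen_internal_empty specified_graph_fst[OF sp]
    by (simp add: bracket_sum_internal_empty emb_zero)
next
  case False
  then show ?thesis
    using loops_specified[OF sp] bracket_eq_sum[OF sp False] minus_gen_eq[OF sp False]
    by (simp add: phi_plus_gen_def Let_def)
qed

lemma uminus_VB:
  assumes "x \<in> VB \<Gamma>" shows "- x \<in> VB \<Gamma>"
proof -
  have "- x = emb \<Gamma> (- x \<Gamma>)" "- x \<Gamma> \<in> V \<Gamma>"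
    using assms uminus_V emb_uminus unfolding VB_iff by metis+
  then show ?thesis unfolding VB_def by blast
qed

text \<open>The bracket involves \<open>minus_gen\<close> only at subgraphs with fewer internal
  edges, whose values restriction brings into \<open>V \<Gamma>\<close>; by
  \<open>preserves\<close>, P then keeps the result there.\<close>

lemma minus_gen_VB: "specified_graph T s \<Longrightarrow> minus_gen s \<in> VB (fst s)"
proof (induction "card (internal (fst s))" arbitrary: s rule: less_induct)
  case less
  have gr: "graph (fst s)" by (rule specified_graph_fst[OF less(2)])
  show ?case
  proof (cases "internal (fst s) = {}")
    case True
    then show ?thesis using minus_gen_internal_empty gr by (simp add: emb_in_VB one_V_in_V)
  next
    case False
    have "summand s u \<in> V (fst s)" if "u \<in> spec_subs T s - {s}" for u
      using that card_internal_spec_subs_less[of u T s] spec_subs_fst(2)[of u s]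
      by (intro summand_V less(1)) auto
    then have "emb (fst s) (bracket_sum s) \<in> VB (fst s)"
      unfolding bracket_sum_def by (intro emb_in_VB V_sum)
    then show ?thesis
      unfolding minus_gen_eq[OF less(2) False] by (intro uminus_VB preserves[OF gr])
  qed
qed

lemma bracket_sum_V: "specified_graph T s \<Longrightarrow> bracket_sum s \<in> V (fst s)"
  unfolding bracket_sum_def by (intro V_sum summand_V minus_gen_VB) (auto dest: spec_subs_fst(2))

lemma plus_gen_VB: "specified_graph T s \<Longrightarrow> plus_gen s \<in> VB (fst s)"
  using minus_gen_VB[of s] bracket_sum_V[of s] plus_gen_eq[of s]
  by (auto simp: VB_def emb_add[symmetric] V_add)

text \<open>The contraction \<Gamma>/\<Gamma> has no internal edges, so \<phi> is one there and only
  the left factor remains. This term completes \<open>bracket_sum\<close> to the sum that gives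
  \<open>plus_gen\<close>.\<close>

lemma summand_self:
  assumes sp: "specified_graph T s"
  shows "summand s s = minus_gen s (fst s)"
proof -
  let ?\<Gamma> = "fst s" and ?q = "fst (spec_contract s s)"
  have gr: "graph ?\<Gamma>" by (rule specified_graph_fst[OF sp])
  have q: "?q = contract ?\<Gamma> ?\<Gamma> (snd s)" by (rule fst_spec_contract)
  have V: "minus_gen s ?\<Gamma> \<in> V ?\<Gamma>" using minus_gen_VB[OF sp] by (simp add: VB_iff)
  have "specified_graph T (spec_contract s s)"
    using spec_contract_self_specified[OF wf, of "fst s" "snd s"] sp by simp
  moreover have "internal ?q = {}" unfolding q by (rule internal_contract_self)
  ultimately have "\<phi> (gen (spec_contract s s)) = emb ?q (one_V ?q)"
    using character unfolding character_def by (metis prod.collapse)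
  then have "pull_i ?\<Gamma> ?q (\<phi> (gen (spec_contract s s)) ?q) = one_V ?\<Gamma>"
    using W_contract[OF gr covering_refl[OF gr]] unfolding q
    by (auto simp: pull_i_def one_V_def fun_eq_iff simp del: contract_simps)
  moreover have "restr_pi ?\<Gamma> (minus_gen s ?\<Gamma>) = minus_gen s ?\<Gamma>"
    using V_outside[OF V] by (auto simp: restr_pi_def)
  ultimately show ?thesis unfolding summand_def by (simp add: one_V_mult[OF V])
qed

text \<open>Contraction commutes with concatenation, and both \<phi> and, by m,
  \<open>minus_gen\<close> split. The pointwise product of two joins is the join of the
  products.\<close>

lemma summand_concat:
  assumes dj: "disjoint_graphs (fst s) (fst s')"
    and u: "u \<in> spec_subs T s" and u': "u' \<in> spec_subs T s'"
    and m: "minus_gen (concat_spec u u') = minus_gen u \<bullet>\<^sub>B minus_gen u'"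
  shows "summand (concat_spec s s') (concat_spec u u') =
    join (fst s) (fst s') (summand s u) (summand s' u')"
proof
  fix p
  let ?\<Gamma> = "fst s" and ?\<Gamma>' = "fst s'" and ?\<gamma> = "fst u" and ?\<gamma>' = "fst u'"
  let ?q = "spec_contract s u" and ?q' = "spec_contract s' u'"
  let ?r = "concat_graph (fst ?q) (fst ?q')"
  note f = spec_subs_fst[OF u] and f' = spec_subs_fst[OF u']
  note cs = covering_simps[OF f(5,1)] and cs' = covering_simps[OF f'(5,1)]
  have q: "spec_contract (concat_spec s s') (concat_spec u u') = concat_spec ?q ?q'"
    using spec_contract_concat[OF f(5) f'(5) dj f(1) f'(1), of "snd s" "snd s'" "snd u" "snd u'"] by simp
  have gd: "graph (concat_graph ?\<Gamma> ?\<Gamma>')" by (rule graph_concat[OF f(5) f'(5) dj])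
  have cov: "covering_subgraph (concat_graph ?\<gamma> ?\<gamma>') (concat_graph ?\<Gamma> ?\<Gamma>')"
    by (rule covering_concat[OF f(5) f'(5) dj f(1) f'(1)])
  have djg: "disjoint_graphs ?\<gamma> ?\<gamma>'" using dj cs cs' by (simp add: disjoint_graphs_def)
  have djq: "disjoint_graphs (fst ?q) (fst ?q')"
    unfolding fst_spec_contract by (rule disjoint_contract[OF f(5) f'(5) dj f(1) f'(1)])
  have gq: "graph (fst ?q)" "graph (fst ?q')" using specified_graph_fst[OF f(4)] specified_graph_fst[OF f'(4)] by auto
  have r: "?r = contract (concat_graph ?\<Gamma> ?\<Gamma>') (concat_graph ?\<gamma> ?\<gamma>') (\<lambda>C. if C \<in> pi0 ?\<gamma> then snd u C else snd u' C)"
    unfolding fst_spec_contract by (rule contract_concat[OF f(5) f'(5) dj f(1) f'(1), symmetric])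
  have min: "minus_gen (concat_spec u u') (concat_graph ?\<gamma> ?\<gamma>') =
      join ?\<gamma> ?\<gamma>' (minus_gen u ?\<gamma>) (minus_gen u' ?\<gamma>')"
    using m bmul_emb_join[OF f(6) f'(6) djg, of "minus_gen u ?\<gamma>" "minus_gen u' ?\<gamma>'"]
      minus_gen_VB[OF f(2)] minus_gen_VB[OF f'(2)] unfolding VB_iff by (metis emb_apply)
  have ph: "\<phi> (gen (concat_spec ?q ?q')) ?r =
      join (fst ?q) (fst ?q') (\<phi> (gen ?q) (fst ?q)) (\<phi> (gen ?q') (fst ?q'))"
  proof -
    have "\<phi> (gen (concat_spec ?q ?q')) = \<phi> (gen ?q) \<bullet>\<^sub>B \<phi> (gen ?q')"
      using character f(4) f'(4) djq unfolding character_def by blast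
    then show ?thesis
      using bmul_emb_join[OF gq djq, of "\<phi> (gen ?q) (fst ?q)" "\<phi> (gen ?q') (fst ?q')"]
        phi_VB[OF f(4)] phi_VB[OF f'(4)] unfolding VB_iff by (metis emb_apply)
  qed
  have fs: "fst (concat_spec a b) = concat_graph (fst a) (fst b)" for a b :: "('v, 'e, 't) sgraph"
    by (simp add: concat_spec_def)
  show "summand (concat_spec s s') (concat_spec u u') p =
    join ?\<Gamma> ?\<Gamma>' (summand s u) (summand s' u') p"
  proof (cases "p \<in> W (concat_graph ?\<Gamma> ?\<Gamma>')")
    case True
    have pr: "mom_restrict (hedges ?\<Gamma>) p \<in> W ?\<Gamma>" "mom_restrict (hedges ?\<Gamma>') p \<in> W ?\<Gamma>'"
      using mom_restrict_W_concat[OF f(5) f'(5) dj True] by auto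
    have pg: "p \<in> W (concat_graph ?\<gamma> ?\<gamma>')" using W_covering[OF gd cov] True by blast
    have pq: "mom_restrict (hedges ?r) p \<in> W ?r" unfolding r by (rule W_contract[OF gd cov True])
    have sub: "hedges (fst ?q) \<subseteq> hedges ?\<Gamma>" "hedges (fst ?q') \<subseteq> hedges ?\<Gamma>'"
      by (auto simp: fst_spec_contract)
    \<comment> \<open>Restricting first to the half-edges of the contracted concatenation or first
      to those of one factor yields the same momentum on the contracted factor.\<close>
    have rr: "mom_restrict (hedges (fst ?q)) (mom_restrict (hedges ?r) p) =
        mom_restrict (hedges (fst ?q)) (mom_restrict (hedges ?\<Gamma>) p)"
      "mom_restrict (hedges (fst ?q')) (mom_restrict (hedges ?r) p) =
        mom_restrict (hedges (fst ?q')) (mom_restrict (hedges ?\<Gamma>') p)"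
      using sub by (simp_all add: mom_restrict_mom_restrict)
    show ?thesis
      using True pr pg pq unfolding summand_def q fs times_fun_def restr_pi_def pull_i_def min ph
      by (simp only: join_def if_True rr cs(2) cs'(2) mult.assoc mult.left_commute)
  next
    case False
    then show ?thesis by (simp add: summand_def fs restr_pi_def join_def)
  qed
qed

text \<open>Over all pairs the sum is the product of b + x and b' + x', where x and x' are the
  values of \<open>minus_gen\<close>. The pair (s, s') accounts for the product of x and x' and
  corresponds to the omitted subgraph, which is why m excludes it.\<close>

lemma bracket_sum_concat:
  assumes sp: "specified_graph T s" and sp': "specified_graph T s'" and dj: "disjoint_graphs (fst s) (fst s')"
    and m: "\<And>u u'. u \<in> spec_subs T s \<Longrightarrow> u' \<in> spec_subs T s' \<Longrightarrow> (u, u') \<noteq> (s, s') \<Longrightarrow>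
      minus_gen (concat_spec u u') = minus_gen u \<bullet>\<^sub>B minus_gen u'"
  defines "b \<equiv> emb (fst s) (bracket_sum s)" and "b' \<equiv> emb (fst s') (bracket_sum s')"
  shows "emb (fst (concat_spec s s')) (bracket_sum (concat_spec s s')) =
    b \<bullet>\<^sub>B b' + b \<bullet>\<^sub>B minus_gen s' + minus_gen s \<bullet>\<^sub>B b'"
proof -
  let ?S = "spec_subs T s" and ?S' = "spec_subs T s'" and ?c = "concat_spec s s'"
  let ?j = "join (fst s) (fst s')"
  have gr: "graph (fst s)" "graph (fst s')" using specified_graph_fst[OF sp] specified_graph_fst[OF sp'] by auto
  have fin: "finite ?S" "finite ?S'" using finite_spec_subs[OF wf gr(1)] finite_spec_subs[OF wf gr(2)] by auto
  have in_S: "s \<in> ?S" "s' \<in> ?S'" using self_in_spec_subs[OF wf sp] self_in_spec_subs[OF wf sp'] by auto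
  have "bij_betw (\<lambda>(u, u'). concat_spec u u') (?S \<times> ?S') (spec_subs T ?c)"
    using spec_subs_concat[OF gr dj, of T "snd s" "snd s'"] sp sp' by simp
  then have bij: "bij_betw (\<lambda>(u, u'). concat_spec u u') (?S \<times> ?S' - {(s, s')}) (spec_subs T ?c - {?c})"
    using in_S by (intro bij_betw_DiffI) (auto simp: bij_betw_def)
  have "bracket_sum ?c = (\<Sum>(u, u')\<in>?S \<times> ?S' - {(s, s')}. summand ?c (concat_spec u u'))"
    unfolding bracket_sum_def sum.reindex_bij_betw[OF bij, symmetric] by (simp add: case_prod_unfold)
  also have "\<dots> = (\<Sum>(u, u')\<in>?S \<times> ?S' - {(s, s')}. ?j (summand s u) (summand s' u'))"
    using summand_concat[OF dj] m by (intro sum.cong) auto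
  also have "\<dots> = ?j (bracket_sum s) (bracket_sum s') + ?j (bracket_sum s) (minus_gen s' (fst s')) +
      ?j (minus_gen s (fst s)) (bracket_sum s')"
  proof
    fix p
    let ?a = "\<lambda>u. summand s u (mom_restrict (hedges (fst s)) p)"
      and ?a' = "\<lambda>u. summand s' u (mom_restrict (hedges (fst s')) p)"
    have app: "(sum F I) p = (\<Sum>i\<in>I. F i p)" for F :: "'i \<Rightarrow> ('e, 'd) mom \<Rightarrow> complex" and I
      by (induction I rule: infinite_finite_induct) auto
    have app': "(sum F I) x = (\<Sum>i\<in>I. F i x)" for F :: "('v, 'e, 't) sgraph \<Rightarrow> ('e, 'd) mom \<Rightarrow> complex" and I x
      by (induction I rule: infinite_finite_induct) auto
    have "(\<Sum>(u, u')\<in>?S \<times> ?S'. ?a u * ?a' u') = (\<Sum>u\<in>?S. ?a u) * (\<Sum>u'\<in>?S'. ?a' u')"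
      by (simp add: sum_product sum.cartesian_product)
    moreover have "(\<Sum>(u, u')\<in>?S \<times> ?S'. ?a u * ?a' u') =
        ?a s * ?a' s' + (\<Sum>(u, u')\<in>?S \<times> ?S' - {(s, s')}. ?a u * ?a' u')"
      using sum.remove[of "?S \<times> ?S'" "(s, s')" "\<lambda>(u, u'). ?a u * ?a' u'"] fin in_S by simp
    moreover have "(\<Sum>u\<in>?S. ?a u) = ?a s + (\<Sum>u\<in>?S - {s}. ?a u)"
      "(\<Sum>u\<in>?S'. ?a' u) = ?a' s' + (\<Sum>u\<in>?S' - {s'}. ?a' u)"
      using sum.remove[of ?S s ?a] sum.remove[of ?S' s' ?a'] fin in_S by auto
    ultimately have "(\<Sum>(u, u')\<in>?S \<times> ?S' - {(s, s')}. ?a u * ?a' u') =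
        (\<Sum>u\<in>?S - {s}. ?a u) * (\<Sum>u\<in>?S' - {s'}. ?a' u) + (\<Sum>u\<in>?S - {s}. ?a u) * ?a' s' +
        ?a s * (\<Sum>u\<in>?S' - {s'}. ?a' u)"
      by (simp add: algebra_simps)
    then show "(\<Sum>(u, u')\<in>?S \<times> ?S' - {(s, s')}. ?j (summand s u) (summand s' u')) p =
        (?j (bracket_sum s) (bracket_sum s') + ?j (bracket_sum s) (minus_gen s' (fst s')) +
          ?j (minus_gen s (fst s)) (bracket_sum s')) p"
      unfolding app bracket_sum_def
      by (simp add: join_def app' summand_self[OF sp] summand_self[OF sp'] case_prod_unfold)
  qed
  finally have "bracket_sum ?c = ?j (bracket_sum s) (bracket_sum s') +
    ?j (bracket_sum s) (minus_gen s' (fst s')) + ?j (minus_gen s (fst s)) (bracket_sum s')" .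
  then have "emb (fst ?c) (bracket_sum ?c) = b \<bullet>\<^sub>B b' + b \<bullet>\<^sub>B emb (fst s') (minus_gen s' (fst s')) +
      emb (fst s) (minus_gen s (fst s)) \<bullet>\<^sub>B b'"
    unfolding b_def b'_def bmul_emb_join[OF gr dj] emb_add[symmetric] by (simp add: concat_spec_def)
  moreover have "emb (fst s) (minus_gen s (fst s)) = minus_gen s" "emb (fst s') (minus_gen s' (fst s')) = minus_gen s'"
    using minus_gen_VB[OF sp] minus_gen_VB[OF sp'] unfolding VB_iff by (auto dest: sym)
  ultimately show ?thesis by simp
qed

lemma specified_concat:
  assumes "specified_graph T s" "specified_graph T s'" "disjoint_graphs (fst s) (fst s')"
  shows "specified_graph T (concat_spec s s')"
  using assms specified_concat_iff[OF specified_graph_fst specified_graph_fst, of s s' "snd s" "snd s'" T]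
    specified_iff[of T "fst s" "snd s"] specified_iff[of T "fst s'" "snd s'"] by simp

lemma P_uminus: "x \<in> Bspace \<Longrightarrow> P t (- x) = - P t x"
  using scheme unfolding indexed_renormalization_scheme_def endo_B_def linear_between_def
  by (metis bscale_minus_one)

lemma scheme_eq: "x \<in> Bspace \<Longrightarrow> y \<in> Bspace \<Longrightarrow>
    P s x \<bullet>\<^sub>B P t y = P (s + t) (P s x \<bullet>\<^sub>B y + x \<bullet>\<^sub>B P t y - x \<bullet>\<^sub>B y)"
  using scheme unfolding indexed_renormalization_scheme_def by blast

lemma minus_gen_concat:
  "specified_graph T s \<Longrightarrow> specified_graph T s' \<Longrightarrow> disjoint_graphs (fst s) (fst s') \<Longrightarrow>
    minus_gen (concat_spec s s') = minus_gen s \<bullet>\<^sub>B minus_gen s'"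
proof (induction "card (internal (fst s)) + card (internal (fst s'))" arbitrary: s s' rule: less_induct)
  case less
  note sp = less(2) and sp' = less(3) and dj = less(4)
  have gr: "graph (fst s)" and gr': "graph (fst s')" using specified_graph_fst[OF sp] specified_graph_fst[OF sp'] by auto
  let ?c = "concat_spec s s'" and ?l = "loops (fst s)" and ?l' = "loops (fst s')"
  let ?b = "emb (fst s) (bracket_sum s)" and ?b' = "emb (fst s') (bracket_sum s')"
  let ?m = "minus_gen s" and ?m' = "minus_gen s'"
  have fc: "fst ?c = concat_graph (fst s) (fst s')" by (simp add: concat_spec_def)
  have spc: "specified_graph T ?c" by (rule specified_concat[OF sp sp' dj])
  have bV: "?b \<in> VB (fst s)" "?b' \<in> VB (fst s')" using bracket_sum_V emb_in_VB sp sp' by blast+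
  have B: "?b \<in> Bspace" "?b' \<in> Bspace" using bV VB_Bspace[OF gr] VB_Bspace[OF gr'] by auto
  have me: "?m = emb (fst s) (?m (fst s))" "?m' = emb (fst s') (?m' (fst s'))"
    using minus_gen_VB sp sp' by (auto simp: VB_iff)
  have lc: "loops (fst ?c) = ?l + ?l'" unfolding fc by (rule loops_concat[OF gr gr' dj])
  have ic: "internal (fst ?c) = internal (fst s) \<union> internal (fst s')"
    unfolding fc by (rule internal_concat[OF gr gr' dj])
  have bc: "emb (fst ?c) (bracket_sum ?c) = ?b \<bullet>\<^sub>B ?b' + ?b \<bullet>\<^sub>B ?m' + ?m \<bullet>\<^sub>B ?b'"
  proof (rule bracket_sum_concat[OF sp sp' dj])
    fix u u' assume u: "u \<in> spec_subs T s" "u' \<in> spec_subs T s'" "(u, u') \<noteq> (s, s')"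
    have "card (internal (fst u)) + card (internal (fst u')) < card (internal (fst s)) + card (internal (fst s'))"
      using u card_internal_spec_subs_less[OF u(1)] card_internal_spec_subs_less[OF u(2)]
      by (cases "u = s"; cases "u' = s'") auto
    moreover have "disjoint_graphs (fst u) (fst u')"
      using dj covering_simps[OF gr spec_subs_fst(1)[OF u(1)]] covering_simps[OF gr' spec_subs_fst(1)[OF u(2)]]
      by (simp add: disjoint_graphs_def)
    ultimately show "minus_gen (concat_spec u u') = minus_gen u \<bullet>\<^sub>B minus_gen u'"
      using less(1) spec_subs_fst(2) u by blast
  qed
  show ?case
  proof (cases "internal (fst s) = {}"; cases "internal (fst s') = {}")
    assume i: "internal (fst s) = {}" "internal (fst s') = {}"
    then show ?thesis
      using minus_gen_internal_empty[of ?c] ic graph_concat[OF gr gr' dj]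
      by (simp add: fc minus_gen_internal_empty gr gr' bmul_emb_join[OF gr gr' dj] join_one[OF gr gr' dj])
  next
    assume i: "internal (fst s) \<noteq> {}" "internal (fst s') = {}"
    \<comment> \<open>With no internal edges on the right, the bracket of the concatenation is that
      of s times one and the loop number is that of s, so \<open>degree_zero\<close> lets P pass to
      the first factor.\<close>
    have "?b' = 0" using i(2) by (simp add: bracket_sum_internal_empty emb_zero)
    moreover have "?l' = 0" using loops_internal_empty[OF gr' i(2)] .
    moreover have "minus_gen ?c = - P (loops (fst ?c)) (emb (fst ?c) (bracket_sum ?c))"
      using minus_gen_eq[OF spc] ic i by simp
    ultimately show ?thesis
      unfolding bc lc minus_gen_eq[OF sp i(1)] minus_gen_internal_empty[OF gr' i(2)]
      using degree_zero[OF gr bV(1) gr' i(2)] by (simp add: bmul_zero_right bmul_uminus_left)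
  next
    assume i: "internal (fst s) = {}" "internal (fst s') \<noteq> {}"
    have "?b = 0" using i(1) by (simp add: bracket_sum_internal_empty emb_zero)
    moreover have "?l = 0" using loops_internal_empty[OF gr i(1)] .
    moreover have "minus_gen ?c = - P (loops (fst ?c)) (emb (fst ?c) (bracket_sum ?c))"
      using minus_gen_eq[OF spc] ic i by simp
    ultimately have "minus_gen ?c = - P ?l' (?m \<bullet>\<^sub>B ?b')"
      unfolding bc lc by (simp add: bmul_zero_left)
    \<comment> \<open>The function one stands on the right in \<open>degree_zero\<close>, so the
      factors are exchanged.\<close>
    also have "?m \<bullet>\<^sub>B ?b' = ?b' \<bullet>\<^sub>B emb (fst s) (one_V (fst s))"
      unfolding minus_gen_internal_empty[OF gr i(1)] by (rule bmul_emb_commute[OF gr gr' dj, symmetric])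
    also have "- P ?l' (?b' \<bullet>\<^sub>B emb (fst s) (one_V (fst s))) = ?m' \<bullet>\<^sub>B ?m"
      using degree_zero[OF gr' bV(2) gr i(1)]
      by (simp add: minus_gen_eq[OF sp' i(2)] minus_gen_internal_empty[OF gr i(1)] bmul_uminus_left)
    also have "\<dots> = ?m \<bullet>\<^sub>B ?m'"
      using bmul_emb_commute[OF gr gr' dj] me by metis
    finally show ?thesis .
  next
    assume i: "internal (fst s) \<noteq> {}" "internal (fst s') \<noteq> {}"
    let ?y = "P ?l ?b \<bullet>\<^sub>B ?b' + ?b \<bullet>\<^sub>B P ?l' ?b' - ?b \<bullet>\<^sub>B ?b'"
    have m: "?m = - P ?l ?b" "?m' = - P ?l' ?b'"
      using minus_gen_eq[OF sp i(1)] minus_gen_eq[OF sp' i(2)] by auto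
    \<comment> \<open>With both \<open>minus_gen\<close> values replaced by -P b and -P b', the
      three terms are the negative of the argument of P in the scheme. The sign in front of P
      cancels this one.\<close>
    have y: "emb (fst ?c) (bracket_sum ?c) = - ?y"
      unfolding bc m by (simp add: bmul_uminus_left bmul_uminus_right)
    have "minus_gen ?c = - P (?l + ?l') (- ?y)"
      using minus_gen_eq[OF spc] ic i unfolding lc y by simp
    also have "\<dots> = P (?l + ?l') ?y"
    proof -
      \<comment> \<open>Linearity of P is available on \<open>Bspace\<close>; membership comes from
        \<open>- ?y\<close> being the embedded bracket of the concatenation.\<close>
      have "- ?y \<in> Bspace"
        unfolding y[symmetric]
        by (rule subsetD[OF VB_Bspace[OF specified_graph_fst[OF spc]] emb_in_VB[OF bracket_sum_V[OF spc]]])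
      then show ?thesis using P_uminus[of "- ?y"] by simp
    qed
    also have "\<dots> = P ?l ?b \<bullet>\<^sub>B P ?l' ?b'"
      by (rule scheme_eq[OF B, symmetric])
    also have "\<dots> = ?m \<bullet>\<^sub>B ?m'"
      unfolding m by (simp add: bmul_uminus_left bmul_uminus_right)
    finally show ?thesis .
  qed
qed

lemma plus_gen_concat:
  assumes sp: "specified_graph T s" and sp': "specified_graph T s'" and dj: "disjoint_graphs (fst s) (fst s')"
  shows "plus_gen (concat_spec s s') = plus_gen s \<bullet>\<^sub>B plus_gen s'"
proof -
  have gr: "graph (fst s)" "graph (fst s')" using specified_graph_fst[OF sp] specified_graph_fst[OF sp'] by auto
  have "minus_gen (concat_spec u u') = minus_gen u \<bullet>\<^sub>B minus_gen u'"
    if u: "u \<in> spec_subs T s" "u' \<in> spec_subs T s'" for u u'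
    using dj covering_simps[OF gr(1) spec_subs_fst(1)[OF u(1)]] covering_simps[OF gr(2) spec_subs_fst(1)[OF u(2)]]
    by (intro minus_gen_concat spec_subs_fst(2)[OF u(1)] spec_subs_fst(2)[OF u(2)]) (simp add: disjoint_graphs_def)
  then show ?thesis
    using bracket_sum_concat[OF sp sp' dj] minus_gen_concat[OF sp sp' dj]
    unfolding plus_gen_eq[OF sp] plus_gen_eq[OF sp'] plus_gen_eq[OF specified_concat[OF sp sp' dj]]
    by (simp add: bmul_add_left bmul_add_right)
qed

text \<open>By \<open>spec_subs_connected\<close> both sums run over the same subgraphs once the
  whole graph is removed. The specification then enters only through that of \<Gamma>/\<gamma>, to
  which \<phi> is blind.\<close>

lemma bracket_sum_connected:
  assumes sp: "specified_graph T (\<Gamma>, i)" "specified_graph T (\<Gamma>, i')" and conn: "connected_graph \<Gamma>"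
  shows "bracket_sum (\<Gamma>, i) = bracket_sum (\<Gamma>, i')"
proof -
  have ne: "\<gamma> \<noteq> \<Gamma>" if "(\<gamma>, j) \<in> spec_subs T (\<Gamma>, k)" "(\<gamma>, j) \<noteq> (\<Gamma>, k)" for \<gamma> j k
    using spec_subs_whole[OF that(1)] that(2) by auto
  have "u \<in> spec_subs T (\<Gamma>, k') - {(\<Gamma>, k')}"
    if "specified_graph T (\<Gamma>, k)" "specified_graph T (\<Gamma>, k')" "u \<in> spec_subs T (\<Gamma>, k) - {(\<Gamma>, k)}" for u k k'
    using spec_subs_connected[OF that(1,2) conn, of "fst u" "snd u"] ne[of "fst u" "snd u" k] that(3) by auto
  then have eq: "spec_subs T (\<Gamma>, i) - {(\<Gamma>, i)} = spec_subs T (\<Gamma>, i') - {(\<Gamma>, i')}"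
    using sp by blast
  have "summand (\<Gamma>, i) u = summand (\<Gamma>, i') u"
    if u: "u \<in> spec_subs T (\<Gamma>, i)" "u \<in> spec_subs T (\<Gamma>, i')" for u
  proof -
    let ?q = "spec_contract (\<Gamma>, i) u" and ?q' = "spec_contract (\<Gamma>, i') u"
    have "fst ?q = fst ?q'" by (simp add: fst_spec_contract)
    moreover from this have "\<phi> (gen ?q) = \<phi> (gen ?q')"
      using character spec_subs_fst(4)[OF u(1)] spec_subs_fst(4)[OF u(2)]
      unfolding character_def by (metis prod.collapse)
    ultimately show ?thesis unfolding summand_def by simp
  qed
  then show ?thesis unfolding bracket_sum_def eq using eq by (intro sum.cong) auto
qed

lemma minus_gen_connected:
  assumes sp: "specified_graph T (\<Gamma>, i)" "specified_graph T (\<Gamma>, i')" and conn: "connected_graph \<Gamma>"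
  shows "minus_gen (\<Gamma>, i) = minus_gen (\<Gamma>, i')"
proof (cases "internal \<Gamma> = {}")
  case True
  then show ?thesis using minus_gen_internal_empty specified_graph_graph[OF sp(1)] by simp
next
  case False
  then show ?thesis
    using minus_gen_eq[OF sp(1)] minus_gen_eq[OF sp(2)] bracket_sum_connected[OF assms] by simp
qed

lemma character_phi_minus: "character T (phi_minus T P \<phi>)"
  unfolding phi_minus_def
  by (rule character_linear_ext[OF minus_gen_VB
        independent_of_specification[of T minus_gen, OF minus_gen_concat minus_gen_connected]
        minus_gen_internal_empty minus_gen_concat])

lemma character_phi_plus: "character T (phi_plus T P \<phi>)"
proof -
  have conn: "plus_gen (\<Gamma>, i) = plus_gen (\<Gamma>, i')"
    if "specified_graph T (\<Gamma>, i)" "specified_graph T (\<Gamma>, i')" "connected_graph \<Gamma>" for \<Gamma> i i'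
    unfolding plus_gen_eq[OF that(1)] plus_gen_eq[OF that(2)]
      bracket_sum_connected[OF that] minus_gen_connected[OF that] by simp
  show ?thesis
    unfolding phi_plus_def
    by (rule character_linear_ext[OF plus_gen_VB
          independent_of_specification[of T plus_gen, OF plus_gen_concat conn]
          plus_gen_internal_empty plus_gen_concat])
qed

end

theorem theorem7:
  fixes T :: "'t qft"
    and \<phi> :: "('v::linorder, 'e, 't) hvec \<Rightarrow> ('v, 'e, 't, 'd::finite) bvec"
    and P :: "nat \<Rightarrow> ('v, 'e, 't, 'd) bvec \<Rightarrow> ('v, 'e, 't, 'd) bvec"
  assumes "wf_qft T"
    and "character T \<phi>"
    and "indexed_renormalization_scheme P"
    and preserves: "\<And>t \<Gamma> x. graph \<Gamma> \<Longrightarrow> x \<in> VB \<Gamma> \<Longrightarrow> P t x \<in> VB \<Gamma>"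
    and degree_zero: "\<And>t \<Gamma> \<Gamma>' x. graph \<Gamma> \<Longrightarrow> x \<in> VB \<Gamma> \<Longrightarrow> graph \<Gamma>' \<Longrightarrow> internal \<Gamma>' = {} \<Longrightarrow>
      P t (x \<bullet>\<^sub>B emb \<Gamma>' (one_V \<Gamma>')) = P t x \<bullet>\<^sub>B emb \<Gamma>' (one_V \<Gamma>')"
  shows "character T (phi_minus T P \<phi>) \<and> character T (phi_plus T P \<phi>)"
proof -
  interpret renormalization T \<phi> P
    using assms by unfold_locales
  show ?thesis using character_phi_minus character_phi_plus by simp
qed

end
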